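(* Let $L,m,\beta,\lambda,\kappa>0$, let $C=\beta^{-1}(m^2-\Delta)^{-1}$ and $\sigma=C^s$ for some $s>0$, and let $$V(\phi)=-\frac{\lambda}{4}\|\phi\|_4^4+\frac{\kappa}{2r}\|\phi\|_2^{2r}$$ with $r>9$. Suppose that $I\le\sigma^2C^{-1}\le(-\Delta+m^2)^\gamma$ for some $0<\gamma<1/8$. Let $$U(\phi)=\frac{\beta}{2}(\mathcal{H}_0V)(\phi)+\frac{\beta^2}{4}\|\sigma DV(\phi)\|_{\mathcal{K}}^2 .$$ Then $$\int_\Omega e^{-\tau U}\,d\mu_\beta<\infty\qquad\text{for all }\tau>0.$$
   Context: $\mathbb{T}^1$ is the circle of circumference $L$, $\Delta$ its Laplacian, $\Omega=C(\mathbb{T}^1)$ the space of continuous complex-valued functions on it, and $\|\cdot\|_q$ the norm of $L^q(\mathbb{T}^1)$. $L^2(\mathbb{T}^1)$ is regarded as a real Hilbert space with inner product $\langle\phi,\psi\rangle_{\mathcal{K}}=\Re\langle\phi,\psi\rangle_{L^2}$ and norm $\|\cdot\|_{\mathcal{K}}=\|\cdot\|_2$. For $k\in\mathbb{Z}$ let $\theta_k=\beta((2\pi k/L)^2+m^2)$. $\mu_\beta$ is the centered Gaussian probability measure on $\Omega$ with covariance $C=\beta^{-1}(m^2-\Delta)^{-1}$ on this real Hilbert space; that is, under $\mu_\beta$ the Fourier coefficients $X_k=\langle L^{-1/2}e^{2\pi ikx/L},\phi\rangle_{L^2}$ are independent, and the law of $X_k$ on $\mathbb{C}\cong\mathbb{R}^2$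 has density $\frac{\theta_k}{2\pi}e^{-\theta_k|x|^2/2}$. $D$ is the (Fréchet) gradient with respect to $\langle\cdot,\cdot\rangle_{\mathcal{K}}$: $\langle DF(\phi),\psi\rangle_{\mathcal{K}}=\frac{d}{dt}F(\phi+t\psi)|_{t=0}$. For $V(\phi)=-\frac{\lambda}{4}\|\phi\|_4^4+\frac{\kappa}{2r}\|\phi\|_2^{2r}$, $DV(\phi)=-\lambda|\phi|^2\phi+\kappa\|\phi\|_2^{2r-2}\phi$. The operator $\mathcal{H}_0$ is the nonnegative operator on $L^2(\mu_\beta)$ associated with the Dirichlet form $\mathcal{E}_0(f,f)=\int_\Omega\langle Df,\sigma^2Df\rangle_{\mathcal{K}}\,d\mu_\beta$; explicitly $$(\mathcal{H}_0F)(\phi)=-\mathrm{Tr}_{\mathcal K}\left(\sigma^2D^2F(\phi)\right)+\langle\sigma^2C^{-1}\phi,DF(\phi)\rangle_{\mathcal{K}},$$ where $D^2F(\phi)$ is the Hessian and $\mathrm{Tr}_{\mathcal K}$ the trace over the real Hilbert space $L^2(\mathbb{T}^1)$. (Under the stated hypotheses $\sigma^2$ is trace class and $\sigma^2C^{-1}\phi\in L^2(\mathbb{T}^1)$ for $\mu_\beta$-a.e. $\phi$, so $U$ is defined $\mu_\beta$-a.e.) *)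

theory Defs
  imports "HOL-Probability.Probability"
begin

section \<open>The circle and its function spaces\<close>

text \<open>
  Functions on the circle of circumference \<open>L\<close> are functions on the real line; integrals run over
  the fundamental domain \<open>{0..L}\<close>. Elements of \<open>L2\<close> are represented by Borel functions whose
  values outside \<open>{0..L}\<close> are irrelevant; everything below depends on them only up to null sets.
\<close>

definition circ :: "real \<Rightarrow> real measure" where
  "circ L = restrict_space lborel {0..L}"

definition L2 :: "real \<Rightarrow> (real \<Rightarrow> complex) set" where
  "L2 L = {f. f \<in> borel_measurable (circ L) \<and> integrable (circ L) (\<lambda>x. (cmod (f x))\<^sup>2)}"

definition Lnorm :: "real \<Rightarrow> real \<Rightarrow> (real \<Rightarrow> complex) \<Rightarrow> real" where
  "Lnorm L p f = (LINT x|circ L. cmod (f x) powr p) powr (1 / p)"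

definition innerL2 :: "real \<Rightarrow> (real \<Rightarrow> complex) \<Rightarrow> (real \<Rightarrow> complex) \<Rightarrow> complex" where
  "innerL2 L f g = (LINT x|circ L. cnj (f x) * g x)"

definition innerK :: "real \<Rightarrow> (real \<Rightarrow> complex) \<Rightarrow> (real \<Rightarrow> complex) \<Rightarrow> real" where
  "innerK L f g = Re (innerL2 L f g)"

abbreviation normK :: "real \<Rightarrow> (real \<Rightarrow> complex) \<Rightarrow> real" where
  "normK L \<equiv> Lnorm L 2"

text \<open>Continuous functions on the circle, as a closed subspace of a Banach space (sup norm).\<close>

definition Omega :: "real \<Rightarrow> (real \<Rightarrow>\<^sub>C complex) set" where
  "Omega L = {\<phi>. \<forall>x. apply_bcontfun \<phi> (x + L) = apply_bcontfun \<phi> x}"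

definition expo :: "real \<Rightarrow> int \<Rightarrow> real \<Rightarrow> complex" where
  "expo L k x = complex_of_real (1 / sqrt L) * cis (2 * pi * of_int k * x / L)"

definition fcoeff :: "real \<Rightarrow> int \<Rightarrow> (real \<Rightarrow> complex) \<Rightarrow> complex" where
  "fcoeff L k f = innerL2 L (expo L k) f"


section \<open>Functional calculus of the Laplacian\<close>

definition lap_eig :: "real \<Rightarrow> int \<Rightarrow> real" where
  "lap_eig L k = (2 * pi * of_int k / L)\<^sup>2"

text \<open>
  For real \<open>a\<close>, \<open>lap_op L a\<close> is the self-adjoint operator \<open>a(-\<Delta>)\<close>, which acts on the \<open>k\<close>-th Fourier
  mode as multiplication by \<open>a (lap_eig L k)\<close>, with domain \<open>lap_dom L a\<close>. It is extended by the
  value 0 outside its domain. The chosen representative is unique almost everywhere.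
\<close>

definition lap_dom :: "real \<Rightarrow> (real \<Rightarrow> real) \<Rightarrow> (real \<Rightarrow> complex) set" where
  "lap_dom L a =
     {f \<in> L2 L. (\<lambda>k. (cmod (of_real (a (lap_eig L k)) * fcoeff L k f))\<^sup>2) summable_on UNIV}"

definition lap_op :: "real \<Rightarrow> (real \<Rightarrow> real) \<Rightarrow> (real \<Rightarrow> complex) \<Rightarrow> real \<Rightarrow> complex" where
  "lap_op L a f =
     (if f \<in> lap_dom L a
      then SOME g. g \<in> L2 L \<and> (\<forall>k. fcoeff L k g = of_real (a (lap_eig L k)) * fcoeff L k f)
      else (\<lambda>_. 0))"

text \<open>
  The order \<open>A \<le> B\<close> of nonnegative, possibly unbounded self-adjoint operators \<open>A = a(-\<Delta>)\<close>,
  \<open>B = b(-\<Delta>)\<close>, in the sense of quadratic forms: the form domain of \<open>B\<close>, i.e. the domain of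
  its square root, is contained in that of \<open>A\<close>, and there the form of \<open>A\<close> is at most that of \<open>B\<close>.
\<close>

definition lap_op_le :: "real \<Rightarrow> (real \<Rightarrow> real) \<Rightarrow> (real \<Rightarrow> real) \<Rightarrow> bool" where
  "lap_op_le L a b \<longleftrightarrow>
     (\<forall>f \<in> lap_dom L (\<lambda>t. sqrt (b t)).
        f \<in> lap_dom L (\<lambda>t. sqrt (a t)) \<and>
        (normK L (lap_op L (\<lambda>t. sqrt (a t)) f))\<^sup>2 \<le> (normK L (lap_op L (\<lambda>t. sqrt (b t)) f))\<^sup>2)"

text \<open>
  \<open>C_sym\<close> and \<open>sigma_sym\<close> are the functions of \<open>-\<Delta>\<close> giving \<open>C = \<beta>\<^sup>-\<^sup>1(m\<^sup>2 - \<Delta>)\<^sup>-\<^sup>1\<close> and \<open>\<sigma> = C\<^sup>s\<close>;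
  \<open>sigma2_Cinv_sym\<close> gives \<open>\<sigma>\<^sup>2C\<^sup>-\<^sup>1\<close>, taken as a single (closed) operator.
\<close>

definition C_sym :: "real \<Rightarrow> real \<Rightarrow> real \<Rightarrow> real" where
  "C_sym \<beta> m t = 1 / (\<beta> * (m\<^sup>2 + t))"

definition sigma_sym :: "real \<Rightarrow> real \<Rightarrow> real \<Rightarrow> real \<Rightarrow> real" where
  "sigma_sym \<beta> m s t = C_sym \<beta> m t powr s"

definition sigma2_Cinv_sym :: "real \<Rightarrow> real \<Rightarrow> real \<Rightarrow> real \<Rightarrow> real" where
  "sigma2_Cinv_sym \<beta> m s t = (sigma_sym \<beta> m s t)\<^sup>2 * inverse (C_sym \<beta> m t)"


section \<open>The Gaussian measure\<close>

definition theta :: "real \<Rightarrow> real \<Rightarrow> real \<Rightarrow> int \<Rightarrow> real" where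
  "theta L m \<beta> k = \<beta> * ((2 * pi * of_int k / L)\<^sup>2 + m\<^sup>2)"

text \<open>
  The Fourier coefficients generate the Borel sets of \<open>Omega L\<close>, so these conditions determine
  the measure uniquely.
\<close>

definition is_mu :: "real \<Rightarrow> real \<Rightarrow> real \<Rightarrow> (real \<Rightarrow>\<^sub>C complex) measure \<Rightarrow> bool" where
  "is_mu L m \<beta> \<mu> \<longleftrightarrow>
     prob_space \<mu> \<and>
     sets \<mu> = sets (restrict_space borel (Omega L)) \<and>
     prob_space.indep_vars \<mu> (\<lambda>_. borel) (\<lambda>k \<phi>. fcoeff L k (apply_bcontfun \<phi>)) (UNIV :: int set) \<and>
     (\<forall>k. distributed \<mu> lborel (\<lambda>\<phi>. fcoeff L k (apply_bcontfun \<phi>))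
            (\<lambda>x. ennreal (theta L m \<beta> k / (2 * pi) * exp (- theta L m \<beta> k * (cmod x)\<^sup>2 / 2))))"


section \<open>Gradient, Hessian, trace\<close>

text \<open>
  The test directions are the elements of \<open>Omega L\<close>; these are dense in \<open>L2\<close>, so a gradient is
  unique almost everywhere.
\<close>

definition is_gradK ::
  "real \<Rightarrow> ((real \<Rightarrow>\<^sub>C complex) \<Rightarrow> real) \<Rightarrow> (real \<Rightarrow>\<^sub>C complex) \<Rightarrow> (real \<Rightarrow> complex) \<Rightarrow> bool" where
  "is_gradK L F \<phi> g \<longleftrightarrow> g \<in> L2 L \<and>
     (\<forall>\<psi> \<in> Omega L. ((\<lambda>t. F (\<phi> + t *\<^sub>R \<psi>)) has_real_derivative innerK L g (apply_bcontfun \<psi>)) (at 0))"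

definition gradK ::
  "real \<Rightarrow> ((real \<Rightarrow>\<^sub>C complex) \<Rightarrow> real) \<Rightarrow> (real \<Rightarrow>\<^sub>C complex) \<Rightarrow> real \<Rightarrow> complex" where
  "gradK L F \<phi> = (SOME g. is_gradK L F \<phi> g)"

text \<open>
  \<open>D\<^sup>2F(\<phi>)\<psi>\<close> for \<open>\<psi>\<close> in the dense subspace \<open>Omega L\<close> is the gradient at \<open>\<phi>\<close> of \<open>\<eta> \<mapsto> \<langle>DF(\<eta>), \<psi>\<rangle>\<close>, i.e.
  \<open>\<langle>D\<^sup>2F(\<phi>)\<psi>, \<chi>\<rangle>\<close> is the second derivative of \<open>F\<close> at \<open>\<phi>\<close> in the directions \<open>\<psi>\<close> and \<open>\<chi>\<close>.
\<close>

definition hessK ::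
  "real \<Rightarrow> ((real \<Rightarrow>\<^sub>C complex) \<Rightarrow> real) \<Rightarrow> (real \<Rightarrow>\<^sub>C complex) \<Rightarrow> (real \<Rightarrow>\<^sub>C complex) \<Rightarrow> real \<Rightarrow> complex" where
  "hessK L F \<phi> \<psi> = gradK L (\<lambda>\<eta>. innerK L (gradK L F \<eta>) (apply_bcontfun \<psi>)) \<phi>"

text \<open>
  Trace over the real Hilbert space: every Fourier mode \<open>e\<close> contributes the two orthonormal
  vectors \<open>e\<close> and \<open>\<i> e\<close>. All of them lie in \<open>Omega L\<close>, so \<open>T\<close> need only be given there.
\<close>

definition basisK :: "real \<Rightarrow> int \<Rightarrow> complex \<Rightarrow> (real \<Rightarrow>\<^sub>C complex)" where
  "basisK L k z = Bcontfun (\<lambda>x. z * expo L k x)"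

definition traceK :: "real \<Rightarrow> ((real \<Rightarrow>\<^sub>C complex) \<Rightarrow> real \<Rightarrow> complex) \<Rightarrow> real" where
  "traceK L T =
     (\<Sum>\<^sub>\<infinity>(k, z) \<in> (UNIV :: int set) \<times> {1, \<i>}. innerK L (apply_bcontfun (basisK L k z)) (T (basisK L k z)))"


section \<open>The operator and the potential\<close>

definition H0 ::
  "real \<Rightarrow> real \<Rightarrow> real \<Rightarrow> real \<Rightarrow> ((real \<Rightarrow>\<^sub>C complex) \<Rightarrow> real) \<Rightarrow> (real \<Rightarrow>\<^sub>C complex) \<Rightarrow> real" where
  "H0 L m \<beta> s F \<phi> =
     - traceK L (\<lambda>\<psi>. lap_op L (\<lambda>t. (sigma_sym \<beta> m s t)\<^sup>2) (hessK L F \<phi> \<psi>))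
     + innerK L (lap_op L (sigma2_Cinv_sym \<beta> m s) (apply_bcontfun \<phi>)) (gradK L F \<phi>)"

definition V :: "real \<Rightarrow> real \<Rightarrow> real \<Rightarrow> real \<Rightarrow> (real \<Rightarrow>\<^sub>C complex) \<Rightarrow> real" where
  "V L lam \<kappa> r \<phi> =
     - lam / 4 * (Lnorm L 4 (apply_bcontfun \<phi>)) ^ 4
     + \<kappa> / (2 * r) * (Lnorm L 2 (apply_bcontfun \<phi>)) powr (2 * r)"

definition U ::
  "real \<Rightarrow> real \<Rightarrow> real \<Rightarrow> real \<Rightarrow> real \<Rightarrow> real \<Rightarrow> real \<Rightarrow> (real \<Rightarrow>\<^sub>C complex) \<Rightarrow> real" where
  "U L m \<beta> lam \<kappa> r s \<phi> =
     \<beta> / 2 * H0 L m \<beta> s (V L lam \<kappa> r) \<phi>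
     + \<beta>\<^sup>2 / 4 * (normK L (lap_op L (sigma_sym \<beta> m s) (gradK L (V L lam \<kappa> r) \<phi>)))\<^sup>2"

end

theory Submission
  imports Defs
begin

text \<open>
  Write \<open>p k\<close> for the eigenvalues of \<open>m\<^sup>2 - \<Delta>\<close>, \<open>N\<close> for the \<open>L2\<close> norm of \<open>\<phi>\<close> and \<open>Y\<close> for the Sobolev sum
  of \<open>p k powr (3/8) * |\<phi>\<^sub>k|\<^sup>2\<close>. The term \<open>\<sigma>DV\<close> contributes nonnegatively and the trace contributes at most
  a multiple of \<open>N powr (2 * r - 2)\<close>, so \<open>- U\<close> is bounded by \<open>- N powr (2 * r)\<close> plus lower order terms plus
  the pairing of \<open>\<sigma>\<^sup>2C\<^sup>-\<^sup>1\<phi>\<close> with \<open>|\<phi>|\<^sup>2\<phi>\<close> (up to constants). The pairing is at most a multiple of \<open>Y\<^sup>2\<close>: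
  the symbol of \<open>\<sigma>\<^sup>2C\<^sup>-\<^sup>1\<close> is at most \<open>p powr (1/8)\<close> up to constants, and \<open>\<phi>\<^sup>3\<close> is controlled in \<open>L2\<close> by two convolutions.

  Under the Gaussian measure \<open>Y\<^sup>2\<close> has no exponential moments, so the frequency cutoff is chosen depending
  on \<open>\<phi>\<close>: let \<open>n\<close> be the first level at which the part of \<open>Y\<close> with \<open>p k > n\<close> is at most \<open>n powr (3/8)\<close>.
  Then \<open>Y \<le> n powr (3/8) * (1 + N\<^sup>2)\<close>, and because \<open>r > 9\<close> the potential absorbs \<open>Y\<^sup>2\<close> up to
  \<open>D * (1 + n powr (27/28))\<close>. Level \<open>n\<close> is reached with probability at most \<open>exp (- c * n)\<close> up to a sublinear
  correction in the exponent, which wins since \<open>27/28 < 1\<close>.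
\<close>

section \<open>Fourier coefficients on the circle\<close>

text \<open>The exponent 3/8 in \<open>Y\<close> serves three ends. Since \<open>p k\<close> grows
  like the square of \<open>k\<close>, \<open>p k powr (3/8 - 1)\<close> is summable, so
  \<open>Y\<close> is finite almost surely. In the double convolution, three weights
  \<open>p powr (-3/8)\<close> can be traded for two weights \<open>p powr (-9/16)\<close>, which
  are still summable. And 3/8 exceeds twice \<gamma>, so \<open>Y\<close> also controls the norm of
  \<open>\<sigma>\<^sup>2C\<^sup>-\<^sup>1\<phi>\<close>.

  The rates fit as follows. A mode with \<open>p k > n\<close> tolerates an exponential tilt of
  order \<open>n powr (5/8)\<close> in its contribution to \<open>Y\<close>. A tail above
  \<open>n powr (3/8)\<close> therefore has probability of order \<open>exp (- c * n)\<close>, at a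
  cost that is only exponential in \<open>n powr (5/8)\<close>. On the other side
  \<open>Y\<^sup>2\<close> is at most \<open>n powr (3/4) * (1 + N\<^sup>2)\<^sup>2\<close>, and
  Young's inequality against the ninth power of \<open>N\<^sup>2\<close> raises 3/4 to 3/4 * 9/7 =
  27/28.

  Operators and gradients are defined by choice and are accessible only through their Fourier
  coefficients, up to null sets. This is why completeness of the exponentials and Riesz--Fischer
  precede any statement about \<open>U\<close>.\<close>

locale circle =
  fixes L :: real
  assumes L_pos: "0 < L"
begin

lemma space_circ [simp]: "space (circ L) = {0..L}"
  by (simp add: circ_def space_restrict_space)

lemma borel_circ [measurable (raw)]: "f \<in> borel_measurable borel \<Longrightarrow> f \<in> borel_measurable (circ L)"
  unfolding circ_def by (intro measurable_restrict_space1) simp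

lemma emeasure_circ: "emeasure (circ L) {0..L} = ennreal L"
  using L_pos by (simp add: circ_def emeasure_restrict_space)

lemma measure_circ: "measure (circ L) {0..L} = L"
  using L_pos by (simp add: measure_def emeasure_circ)

sublocale C: finite_measure "circ L"
  by standard (simp add: emeasure_circ)

lemma L2_measurable [measurable_dest]: "f \<in> L2 L \<Longrightarrow> f \<in> borel_measurable (circ L)"
  by (simp add: L2_def)

lemma L2_square_integrable: "f \<in> L2 L \<Longrightarrow> integrable (circ L) (\<lambda>x. (cmod (f x))\<^sup>2)"
  by (simp add: L2_def)

lemma bounded_L2:
  assumes "f \<in> borel_measurable (circ L)" "\<And>x. x \<in> {0..L} \<Longrightarrow> cmod (f x) \<le> B"
  shows "f \<in> L2 L"
proof -
  have "integrable (circ L) (\<lambda>x. (cmod (f x))\<^sup>2)"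
    using assms by (intro C.integrable_const_bound[where B="B\<^sup>2"])
      (auto intro!: AE_I2 power_mono)
  then show ?thesis using assms by (simp add: L2_def)
qed

lemma L2_mult_integrable:
  assumes f: "f \<in> L2 L" and g: "g \<in> L2 L"
  shows "integrable (circ L) (\<lambda>x. f x * g x)"
proof (rule Bochner_Integration.integrable_bound)
  show "integrable (circ L) (\<lambda>x. (cmod (f x))\<^sup>2 + (cmod (g x))\<^sup>2)"
    using f g by (simp add: L2_square_integrable)
  show "(\<lambda>x. f x * g x) \<in> borel_measurable (circ L)" using f g by measurable
  have "a * b \<le> a\<^sup>2 + b\<^sup>2" if "a \<ge> 0" "b \<ge> 0" for a b :: real
    using sum_squares_bound[of a b] mult_nonneg_nonneg[OF that] by (simp add: mult.assoc)
  then show "AE x in circ L. norm (f x * g x) \<le> norm ((cmod (f x))\<^sup>2 + (cmod (g x))\<^sup>2)"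
    by (auto simp: norm_mult intro!: AE_I2)
qed

lemma L2_cnj: "f \<in> L2 L \<Longrightarrow> (\<lambda>x. cnj (f x)) \<in> L2 L"
  using measurable_compose[of f "circ L" borel cnj borel]
    borel_measurable_continuous_onI[OF continuous_on_cnj[OF continuous_on_id]]
  by (simp add: L2_def)

lemma L2_inner_integrable:
  "f \<in> L2 L \<Longrightarrow> g \<in> L2 L \<Longrightarrow> integrable (circ L) (\<lambda>x. cnj (f x) * g x)"
  by (intro L2_mult_integrable L2_cnj)

lemma L2_const: "(\<lambda>x. c) \<in> L2 L"
  by (rule bounded_L2[where B="cmod c"]) auto

lemma L2_integrable: "f \<in> L2 L \<Longrightarrow> integrable (circ L) f"
  using L2_mult_integrable[OF L2_const[of 1]] by simp

lemma L2_scale: "f \<in> L2 L \<Longrightarrow> (\<lambda>x. c * f x) \<in> L2 L"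
  unfolding L2_def by (auto simp: norm_mult power_mult_distrib)

lemma L2_add:
  assumes f: "f \<in> L2 L" and g: "g \<in> L2 L"
  shows "(\<lambda>x. f x + g x) \<in> L2 L"
proof -
  have "integrable (circ L) (\<lambda>x. (cmod (f x + g x))\<^sup>2)"
  proof (rule Bochner_Integration.integrable_bound)
    show "integrable (circ L) (\<lambda>x. 2 * (cmod (f x))\<^sup>2 + 2 * (cmod (g x))\<^sup>2)"
      using f g by (simp add: L2_square_integrable)
    show "(\<lambda>x. (cmod (f x + g x))\<^sup>2) \<in> borel_measurable (circ L)" using f g by measurable
    have "(cmod (f x + g x))\<^sup>2 \<le> 2 * (cmod (f x))\<^sup>2 + 2 * (cmod (g x))\<^sup>2" for x
    proof -
      have "(cmod (f x + g x))\<^sup>2 \<le> (cmod (f x) + cmod (g x))\<^sup>2"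
        by (intro power_mono norm_triangle_ineq) auto
      also have "\<dots> \<le> 2 * (cmod (f x))\<^sup>2 + 2 * (cmod (g x))\<^sup>2"
        using sum_squares_bound[of "cmod (f x)" "cmod (g x)"] by (simp add: power2_sum)
      finally show ?thesis .
    qed
    then show "AE x in circ L. norm ((cmod (f x + g x))\<^sup>2)
                 \<le> norm (2 * (cmod (f x))\<^sup>2 + 2 * (cmod (g x))\<^sup>2)"
      by auto
  qed
  then show ?thesis using f g by (auto simp: L2_def)
qed

lemma L2_diff: "f \<in> L2 L \<Longrightarrow> g \<in> L2 L \<Longrightarrow> (\<lambda>x. f x - g x) \<in> L2 L"
  using L2_add[of f "\<lambda>x. - 1 * g x"] L2_scale[of g "-1"] by simp

lemma L2_sum: "(\<And>k. k \<in> F \<Longrightarrow> f k \<in> L2 L) \<Longrightarrow> (\<lambda>x. \<Sum>k\<in>F. f k x) \<in> L2 L"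
  by (induction F rule: infinite_finite_induct) (auto intro: L2_add L2_const)

lemma innerL2_add_right: "f \<in> L2 L \<Longrightarrow> g \<in> L2 L \<Longrightarrow> h \<in> L2 L \<Longrightarrow>
   innerL2 L f (\<lambda>x. g x + h x) = innerL2 L f g + innerL2 L f h"
  by (simp add: innerL2_def distrib_left L2_inner_integrable)

lemma innerL2_diff_right: "f \<in> L2 L \<Longrightarrow> g \<in> L2 L \<Longrightarrow> h \<in> L2 L \<Longrightarrow>
   innerL2 L f (\<lambda>x. g x - h x) = innerL2 L f g - innerL2 L f h"
  by (simp add: innerL2_def right_diff_distrib L2_inner_integrable)

lemma innerL2_scale_right: "innerL2 L f (\<lambda>x. c * g x) = c * innerL2 L f g"
  by (simp add: innerL2_def mult.left_commute)

lemma innerL2_sum_right: "f \<in> L2 L \<Longrightarrow> (\<And>k. k \<in> F \<Longrightarrow> g k \<in> L2 L) \<Longrightarrow>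
   innerL2 L f (\<lambda>x. \<Sum>k\<in>F. g k x) = (\<Sum>k\<in>F. innerL2 L f (g k))"
  by (simp add: innerL2_def sum_distrib_left L2_inner_integrable)

lemma innerL2_commute: "innerL2 L g f = cnj (innerL2 L f g)"
  unfolding innerL2_def Bochner_Integration.integral_cnj[symmetric] by (simp add: mult.commute)

lemma innerL2_scale_left: "innerL2 L (\<lambda>x. c * f x) g = cnj c * innerL2 L f g"
  by (metis innerL2_commute innerL2_scale_right complex_cnj_mult)

lemma innerL2_add_left: "f \<in> L2 L \<Longrightarrow> g \<in> L2 L \<Longrightarrow> h \<in> L2 L \<Longrightarrow>
   innerL2 L (\<lambda>x. g x + h x) f = innerL2 L g f + innerL2 L h f"
  by (metis innerL2_commute innerL2_add_right complex_cnj_add)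

lemma innerL2_diff_left: "f \<in> L2 L \<Longrightarrow> g \<in> L2 L \<Longrightarrow> h \<in> L2 L \<Longrightarrow>
   innerL2 L (\<lambda>x. g x - h x) f = innerL2 L g f - innerL2 L h f"
  by (metis innerL2_commute innerL2_diff_right complex_cnj_diff)

lemma innerL2_sum_left: "f \<in> L2 L \<Longrightarrow> (\<And>k. k \<in> F \<Longrightarrow> g k \<in> L2 L) \<Longrightarrow>
   innerL2 L (\<lambda>x. \<Sum>k\<in>F. g k x) f = (\<Sum>k\<in>F. innerL2 L (g k) f)"
  by (subst innerL2_commute, subst innerL2_sum_right) (auto simp: innerL2_commute[of f])

text \<open>Gradients are chosen by \<open>SOME\<close> and hence known only almost everywhere;
  inside inner products this replaces them by explicit representatives.\<close>

lemma innerL2_cong_AE: 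
  assumes "f \<in> L2 L" "f' \<in> L2 L" "g \<in> L2 L" "g' \<in> L2 L" 
    "AE x in circ L. f x = f' x" "AE x in circ L. g x = g' x"
  shows "innerL2 L f g = innerL2 L f' g'"
  unfolding innerL2_def using assms
  by (intro integral_cong_AE) (auto intro: borel_measurable_integrable L2_inner_integrable)

text \<open>The square of \<open>normK\<close>. Taking it as the basic quantity makes norms along a
  line polynomial in the parameter and turns \<open>normK\<close> to the power \<open>2 * r\<close>
  into \<open>sqn f powr r\<close>.\<close>

definition sqn :: "(real \<Rightarrow> complex) \<Rightarrow> real" where
  "sqn f = (LINT x|circ L. (cmod (f x))\<^sup>2)"

lemma sqn_nonneg: "0 \<le> sqn f"
  by (simp add: sqn_def)

lemma sqn_eq_inner: "innerL2 L f f = of_real (sqn f)"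
  unfolding innerL2_def sqn_def
  by (subst integral_complex_of_real[symmetric])
     (intro Bochner_Integration.integral_cong refl, simp add: complex_norm_square mult.commute del: of_real_power)

lemma normK_square: "(normK L f)\<^sup>2 = sqn f"
proof -
  have "Lnorm L 2 f = sqn f powr (1/2)"
    unfolding Lnorm_def sqn_def by (simp add: powr_numeral)
  then show ?thesis using sqn_nonneg[of f] by (simp add: powr_half_sqrt)
qed

lemma normK_powr: "Lnorm L 2 f powr (2 * r) = sqn f powr r"
proof -
  have "Lnorm L 2 f = sqn f powr (1/2)"
    unfolding Lnorm_def sqn_def by (simp add: powr_numeral)
  then show ?thesis by (simp add: powr_powr)
qed

section \<open>The exponentials as an orthonormal system\<close>

lemma expo_measurable [measurable]: "expo L k \<in> borel_measurable borel"
  unfolding expo_def [abs_def] by (intro borel_measurable_continuous_onI continuous_intros) (use L_pos in auto)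

lemma norm_expo: "cmod (expo L k x) = 1 / sqrt L"
  using L_pos by (simp add: expo_def norm_mult norm_divide)

lemma expo_L2: "expo L k \<in> L2 L"
  by (rule bounded_L2[where B="1 / sqrt L"]) (auto simp: norm_expo)

lemma expo_periodic: "expo L k (x + L) = expo L k x"
proof -
  have "2 * pi * of_int k * (x + L) / L = 2 * pi * of_int k * x / L + 2 * pi * of_int k"
    using L_pos by (simp add: field_simps)
  moreover have "cis (2 * pi * of_int k) = 1"
    by (simp add: cis_multiple_2pi)
  ultimately show ?thesis by (simp add: expo_def flip: cis_mult)
qed

lemma expo_mult: "expo L j x * expo L k x = of_real (1 / sqrt L) * expo L (j + k) x"
  by (simp add: expo_def cis_mult add_divide_distrib algebra_simps)

lemma cnj_expo: "cnj (expo L k x) = expo L (- k) x"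
  by (simp add: expo_def flip: cis_cnj)

lemma expo_0: "expo L 0 x = of_real (1 / sqrt L)"
  by (simp add: expo_def)

lemma integral_expo: "(LINT x|circ L. expo L k x) = (if k = 0 then of_real (sqrt L) else 0)"
proof (cases "k = 0")
  case True
  have "L / sqrt L = sqrt L" using L_pos by (simp add: real_div_sqrt)
  moreover have "(LINT x|circ L. expo L k x) = of_real (L / sqrt L)"
    using True by (simp add: expo_0 measure_circ scaleR_conv_of_real)
  ultimately show ?thesis using True by simp
next
  case False
  define w where "w = 2 * pi * of_int k / L"
  have w: "w \<noteq> 0" using False L_pos by (simp add: w_def)
  have e: "expo L k x = of_real (1 / sqrt L) * cis (w * x)" for x
    by (simp add: expo_def w_def)
  let ?F = "\<lambda>x. of_real (1 / sqrt L) * (cis (w * x) / (\<i> * of_real w))"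
  have "((\<lambda>x. cis (w * x)) has_vector_derivative (\<i> * of_real w * cis (w * x))) (at x within S)" for x S
  proof -
    have "((\<lambda>z. exp (\<i> * of_real w * z)) has_field_derivative \<i> * of_real w * exp (\<i> * of_real w * of_real x))
        (at (of_real x))"
      by (auto intro!: derivative_eq_intros)
    from has_vector_derivative_real_field[OF this, of S] show ?thesis
      by (simp add: cis_conv_exp mult.assoc)
  qed
  then have d: "(?F has_vector_derivative expo L k x) (at x within S)" for x S
    by (rule has_vector_derivative_eq_rhs[OF has_vector_derivative_mult_right[OF has_vector_derivative_divide]])
       (use w in \<open>simp add: e\<close>)
  have "(LINT x|circ L. expo L k x) = (\<integral>x. indicator {0..L} x *\<^sub>R expo L k x \<partial>lborel)"
    unfolding circ_def by (subst integral_restrict_space) auto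
  also have "\<dots> = ?F L - ?F 0"
    using L_pos by (intro integral_FTC_Icc d) (auto simp: e intro!: continuous_intros)
  also have "w * L = 2 * pi * of_int k" using L_pos by (simp add: w_def)
  then have "?F L - ?F 0 = 0" by (simp add: cis_multiple_2pi)
  finally show ?thesis using False by simp
qed

lemma fcoeff_expo: "fcoeff L k (expo L j) = (if j = k then 1 else 0)"
proof -
  have "fcoeff L k (expo L j) = of_real (1 / sqrt L) * (LINT x|circ L. expo L (j - k) x)"
    by (simp add: fcoeff_def innerL2_def cnj_expo expo_mult)
  also have "\<dots> = (if j = k then 1 else 0)"
    using L_pos by (simp only: integral_expo) auto
  finally show ?thesis .
qed

lemma fcoeff_add: "f \<in> L2 L \<Longrightarrow> g \<in> L2 L \<Longrightarrow> fcoeff L k (\<lambda>x. f x + g x) = fcoeff L k f + fcoeff L k g"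
  by (simp add: fcoeff_def innerL2_add_right expo_L2)

lemma fcoeff_diff: "f \<in> L2 L \<Longrightarrow> g \<in> L2 L \<Longrightarrow> fcoeff L k (\<lambda>x. f x - g x) = fcoeff L k f - fcoeff L k g"
  by (simp add: fcoeff_def innerL2_diff_right expo_L2)

lemma fcoeff_scale: "fcoeff L k (\<lambda>x. c * f x) = c * fcoeff L k f"
  by (simp add: fcoeff_def innerL2_scale_right)

lemma fcoeff_sum: "(\<And>i. i \<in> F \<Longrightarrow> f i \<in> L2 L) \<Longrightarrow>
    fcoeff L k (\<lambda>x. \<Sum>i\<in>F. f i x) = (\<Sum>i\<in>F. fcoeff L k (f i))"
  by (simp add: fcoeff_def innerL2_sum_right expo_L2)

section \<open>Trigonometric polynomials and Bessel's inequality\<close>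

definition trig :: "int set \<Rightarrow> (int \<Rightarrow> complex) \<Rightarrow> real \<Rightarrow> complex" where
  "trig F c x = (\<Sum>k\<in>F. c k * expo L k x)"

lemma trig_L2: "trig F c \<in> L2 L"
  unfolding trig_def [abs_def] by (intro L2_sum L2_scale expo_L2)

lemma fcoeff_trig: "finite F \<Longrightarrow> fcoeff L k (trig F c) = (if k \<in> F then c k else 0)"
  unfolding trig_def [abs_def]
  by (subst fcoeff_sum) (auto simp: fcoeff_scale fcoeff_expo L2_scale expo_L2 if_distrib cong: if_cong)

lemma innerL2_trig: 
  assumes "finite F" "f \<in> L2 L"
  shows "innerL2 L (trig F c) f = (\<Sum>k\<in>F. cnj (c k) * fcoeff L k f)"
  unfolding trig_def [abs_def] using assms
  by (subst innerL2_sum_left) (auto simp: innerL2_scale_left fcoeff_def L2_scale expo_L2)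

lemma sqn_trig:
  assumes "finite F"
  shows "sqn (trig F c) = (\<Sum>k\<in>F. (cmod (c k))\<^sup>2)"
proof -
  have "of_real (sqn (trig F c)) = (\<Sum>k\<in>F. cnj (c k) * c k)"
    unfolding sqn_eq_inner[symmetric] using assms by (subst innerL2_trig) (auto simp: trig_L2 fcoeff_trig)
  also have "\<dots> = of_real (\<Sum>k\<in>F. (cmod (c k))\<^sup>2)"
    by (simp add: complex_norm_square mult.commute del: of_real_power)
  finally show ?thesis by (simp only: of_real_eq_iff)
qed

lemma sqn_diff:
  assumes "f \<in> L2 L" "g \<in> L2 L"
  shows "sqn (\<lambda>x. f x - g x) = sqn f - 2 * Re (innerL2 L g f) + sqn g"
proof -
  have "of_real (sqn (\<lambda>x. f x - g x)) = of_real (sqn f) - innerL2 L g f - (cnj (innerL2 L g f) - of_real (sqn g))"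
    using assms by (simp add: innerL2_diff_right innerL2_diff_left L2_diff innerL2_commute[of f g] flip: sqn_eq_inner)
  from arg_cong[where f=Re, OF this] show ?thesis by simp
qed

lemma sqn_add:
  assumes "f \<in> L2 L" "g \<in> L2 L"
  shows "sqn (\<lambda>x. f x + g x) = sqn f + 2 * Re (innerL2 L g f) + sqn g"
proof -
  have "of_real (sqn (\<lambda>x. f x + g x)) = of_real (sqn f) + innerL2 L g f + (cnj (innerL2 L g f) + of_real (sqn g))"
    using assms by (simp add: innerL2_add_right innerL2_add_left L2_add innerL2_commute[of f g] flip: sqn_eq_inner)
  from arg_cong[where f=Re, OF this] show ?thesis by simp
qed

text \<open>The squared distance from \<open>f\<close> to its Fourier partial sum over
  \<open>F\<close> is \<open>sqn f\<close> minus the left-hand side, and it is nonnegative.\<close>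

lemma bessel:
  assumes "finite F" "f \<in> L2 L"
  shows "(\<Sum>k\<in>F. (cmod (fcoeff L k f))\<^sup>2) \<le> sqn f"
proof -
  let ?c = "\<lambda>k. fcoeff L k f"
  have "innerL2 L (trig F ?c) f = of_real (\<Sum>k\<in>F. (cmod (?c k))\<^sup>2)"
    using assms by (simp add: innerL2_trig complex_norm_square mult.commute del: of_real_power)
  then have "sqn (\<lambda>x. f x - trig F ?c x) = sqn f - (\<Sum>k\<in>F. (cmod (?c k))\<^sup>2)"
    using assms by (simp add: sqn_diff trig_L2 sqn_trig)
  then show ?thesis using sqn_nonneg[of "\<lambda>x. f x - trig F ?c x"] by simp
qed

lemma fcoeff_square_summable:
  assumes "f \<in> L2 L"
  shows "(\<lambda>k. (cmod (fcoeff L k f))\<^sup>2) summable_on UNIV"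
  by (rule nonneg_bdd_above_summable_on) (auto intro!: bdd_aboveI2 bessel assms)

end

section \<open>Uniqueness of Fourier coefficients\<close>

context circle
begin

text \<open>The annihilator of the exponentials among integrable functions. No conjugate is taken
  because \<open>k\<close> and \<open>- k\<close> both occur, and integrability is the condition
  that survives multiplication by bounded functions.\<close>

definition null_spectrum :: "(real \<Rightarrow> complex) set" where
  "null_spectrum = {f. integrable (circ L) f \<and> (\<forall>k. (LINT x|circ L. expo L k x * f x) = 0)}"

text \<open>
  Multipliers of \<open>null_spectrum\<close> form an algebra containing the exponentials. This makes the polynomials
  in \<open>wind\<close> multipliers, to which Stone--Weierstrass on the unit circle applies.
\<close>

definition multiplier :: "(real \<Rightarrow> complex) \<Rightarrow> bool" where
  "multiplier h \<longleftrightarrow> (\<forall>f \<in> null_spectrum. (\<lambda>x. h x * f x) \<in> null_spectrum)"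

lemma bounded_mult_integrable:
  fixes f h :: "real \<Rightarrow> complex"
  assumes "integrable (circ L) f" "h \<in> borel_measurable (circ L)" "\<And>x. cmod (h x) \<le> B"
  shows "integrable (circ L) (\<lambda>x. h x * f x)"
proof (rule Bochner_Integration.integrable_bound)
  show "integrable (circ L) (\<lambda>x. B * norm (f x))" using assms by simp
  show "(\<lambda>x. h x * f x) \<in> borel_measurable (circ L)" using assms by measurable
  have "0 \<le> B" using assms(3)[of 0] norm_ge_zero order_trans by blast
  then show "AE x in circ L. norm (h x * f x) \<le> norm (B * norm (f x))"
    using assms(3) by (auto simp: norm_mult intro!: mult_right_mono)
qed

lemma expo_mult_integrable: "integrable (circ L) f \<Longrightarrow> integrable (circ L) (\<lambda>x. expo L k x * f x)"
  by (rule bounded_mult_integrable[where B="1 / sqrt L"]) (auto simp: norm_expo)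

lemma null_spectrum_integral:
  assumes "f \<in> null_spectrum" shows "(LINT x|circ L. f x) = 0"
proof -
  have "(LINT x|circ L. expo L 0 x * f x) = of_real (1 / sqrt L) * (LINT x|circ L. f x)"
    by (simp add: expo_0)
  then show ?thesis using assms L_pos by (auto simp: null_spectrum_def)
qed

lemma multiplier_expo: "multiplier (expo L k)"
proof -
  have "(\<lambda>x. expo L k x * f x) \<in> null_spectrum" if f: "f \<in> null_spectrum" for f
  proof -
    have "(LINT x|circ L. expo L j x * (expo L k x * f x)) = 0" for j
    proof -
      have "(LINT x|circ L. expo L j x * (expo L k x * f x)) = 
          (LINT x|circ L. of_real (1 / sqrt L) * (expo L (j + k) x * f x))"
        by (simp only: mult.assoc[symmetric] expo_mult)
      then show ?thesis using f by (simp add: null_spectrum_def)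
    qed
    then show ?thesis using f by (simp add: null_spectrum_def expo_mult_integrable)
  qed
  then show ?thesis by (simp add: multiplier_def)
qed

lemma null_spectrum_scale: "f \<in> null_spectrum \<Longrightarrow> (\<lambda>x. c * f x) \<in> null_spectrum"
  by (simp add: null_spectrum_def mult.left_commute)

lemma null_spectrum_add:
  "f \<in> null_spectrum \<Longrightarrow> g \<in> null_spectrum \<Longrightarrow> (\<lambda>x. f x + g x) \<in> null_spectrum"
  by (simp add: null_spectrum_def distrib_left expo_mult_integrable)

lemma multiplier_const: "multiplier (\<lambda>x. c)"
  by (simp add: multiplier_def null_spectrum_scale)

lemma multiplier_add: "multiplier g \<Longrightarrow> multiplier h \<Longrightarrow> multiplier (\<lambda>x. g x + h x)"
  by (simp add: multiplier_def null_spectrum_add distrib_right)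

lemma multiplier_mult: "multiplier g \<Longrightarrow> multiplier h \<Longrightarrow> multiplier (\<lambda>x. g x * h x)"
  by (simp add: multiplier_def mult.assoc)

section \<open>Transfer to the unit circle\<close>

definition wind :: "real \<Rightarrow> complex" where
  "wind x = cis (2 * pi * x / L)"

lemma wind_continuous: "continuous_on S wind"
  unfolding wind_def by (intro continuous_intros) (use L_pos in auto)

lemma wind_measurable [measurable]: "wind \<in> borel_measurable borel"
  by (rule borel_measurable_continuous_onI[OF wind_continuous])

lemma wind_expo: "wind x = of_real (sqrt L) * expo L 1 x" "cnj (wind x) = of_real (sqrt L) * expo L (-1) x"
  using L_pos by (simp_all add: expo_def wind_def cis_cnj)

lemma wind_sphere: "wind x \<in> sphere 0 1"
  by (simp add: wind_def)

text \<open>Injectivity holds on the half-open interval only, as \<open>wind\<close> takes the same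
  value at 0 and at \<open>L\<close>. The fundamental domain of \<open>circ\<close> is closed, so
  the point \<open>L\<close> is later discarded as a null set.\<close>

lemma wind_inj:
  assumes "wind x = wind y" "0 \<le> x" "x < L" "0 \<le> y" "y < L"
  shows "x = y"
proof -
  have "sin (2 * pi * x / L) = sin (2 * pi * y / L) \<and> cos (2 * pi * x / L) = cos (2 * pi * y / L)"
    using assms(1) by (simp add: wind_def complex_eq_iff)
  then obtain n :: int where "2 * pi * x / L = 2 * pi * y / L + 2 * pi * of_int n"
    using sin_cos_eq_iff by blast
  then have "2 * pi * (x - y) = 2 * pi * (of_int n * L)" using L_pos by (simp add: field_simps)
  then have n: "x - y = of_int n * L" by simp
  have "\<bar>x - y\<bar> < L" using assms by auto
  then have "\<bar>of_int n * L\<bar> < L" by (simp add: n)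
  then have "\<bar>of_int n :: real\<bar> < 1" using L_pos by (simp add: abs_mult)
  then have "n = 0" by linarith
  then show ?thesis using n by simp
qed

lemma multiplier_polynomial:
  "real_polynomial_function p \<Longrightarrow> multiplier (\<lambda>x. of_real (p (wind x)))"
proof (induction p rule: real_polynomial_function.induct)
  case (linear l)
  have l: "l z = Re z * l 1 + Im z * l \<i>" for z
  proof -
    interpret l: bounded_linear l by fact
    have "l z = l (Re z *\<^sub>R 1 + Im z *\<^sub>R \<i>)" by (rule arg_cong[where f=l]) (simp add: complex_eq_iff)
    then show ?thesis by (simp only: l.add l.scaleR real_scaleR_def)
  qed
  \<comment> \<open>From \<open>Re z = (z + cnj z) / 2\<close> and
    \<open>Im z = (z - cnj z) / (2 * \<i>)\<close>: a real-linear functional combines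
    \<open>z\<close> and \<open>cnj z\<close>, which \<open>wind\<close> turns into the exponentials
    of index 1 and -1.\<close>
  have d: "of_real (l z) = (of_real (l 1) / 2 + of_real (l \<i>) / (2 * \<i>)) * z 
       + (of_real (l 1) / 2 - of_real (l \<i>) / (2 * \<i>)) * cnj z" for z
    unfolding l[of z] by (simp add: complex_eq_iff field_simps)
  have "(\<lambda>x. of_real (l (wind x))) = 
    (\<lambda>x. (of_real (l 1) / 2 + of_real (l \<i>) / (2 * \<i>)) * (of_real (sqrt L) * expo L 1 x) 
       + (of_real (l 1) / 2 - of_real (l \<i>) / (2 * \<i>)) * (of_real (sqrt L) * expo L (-1) x))"
    by (intro ext, rule trans[OF d], subst wind_expo(2), subst wind_expo(1)) (rule refl)
  then show ?case
    by (simp only:) (intro multiplier_add multiplier_mult multiplier_const multiplier_expo)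
qed (simp_all add: multiplier_const multiplier_add multiplier_mult)

text \<open>Polynomials approximate \<open>h\<close> uniformly on the unit circle and integrate to
  zero against \<open>f\<close>; a uniform error \<open>e\<close> changes the integral by at most
  \<open>e\<close> times the L1 norm of \<open>f\<close>.\<close>

lemma null_spectrum_continuous:
  assumes f: "f \<in> null_spectrum" and h: "continuous_on UNIV h"
  shows "(LINT x|circ L. of_real (h (wind x)) * f x) = 0"
proof -
  let ?I = "LINT x|circ L. of_real (h (wind x)) * f x"
  have fi: "integrable (circ L) f" using f by (simp add: null_spectrum_def)
  have h': "continuous_on (sphere 0 1) h" using h continuous_on_subset by blast
  have "compact (h ` sphere 0 1)" by (intro compact_continuous_image h') auto
  then obtain B where B: "\<And>z. z \<in> sphere 0 1 \<Longrightarrow> \<bar>h z\<bar> \<le> B"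
    by (meson bounded_real compact_imp_bounded imageI)
  have mh[measurable]: "h \<in> borel_measurable borel" by (rule borel_measurable_continuous_onI[OF h])
  have i1: "integrable (circ L) (\<lambda>x. of_real (h (wind x)) * f x)"
    by (rule bounded_mult_integrable[OF fi, where B=B]) (use B wind_sphere in auto)
  have b: "norm ?I \<le> e * (LINT x|circ L. norm (f x))" if e: "e > 0" for e
  proof -
    obtain p where p: "real_polynomial_function p" "\<And>z. z \<in> sphere 0 1 \<Longrightarrow> \<bar>h z - p z\<bar> < e"
      using Stone_Weierstrass_real_polynomial_function[OF compact_sphere h' e] by metis
    have pf: "(\<lambda>x. of_real (p (wind x)) * f x) \<in> null_spectrum"
      using multiplier_polynomial[OF p(1)] f by (simp add: multiplier_def)
    then have i2: "integrable (circ L) (\<lambda>x. of_real (p (wind x)) * f x)" by (simp add: null_spectrum_def)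
    have "?I = (LINT x|circ L. of_real (h (wind x)) * f x) - (LINT x|circ L. of_real (p (wind x)) * f x)"
      using null_spectrum_integral[OF pf] by simp
    also have "\<dots> = (LINT x|circ L. of_real (h (wind x) - p (wind x)) * f x)"
      using i1 i2 by (simp add: left_diff_distrib)
    finally have "norm ?I \<le> (LINT x|circ L. norm (of_real (h (wind x) - p (wind x)) * f x))"
      by (simp only: integral_norm_bound)
    also have "\<dots> \<le> (LINT x|circ L. e * norm (f x))"
    proof (rule integral_mono)
      show "integrable (circ L) (\<lambda>x. norm (of_real (h (wind x) - p (wind x)) * f x))"
        using i1 i2 by (intro integrable_norm) (simp add: left_diff_distrib)
      show "norm (of_real (h (wind x) - p (wind x)) * f x) \<le> e * norm (f x)" for x
        using p(2)[OF wind_sphere, of x]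
        by (simp add: norm_mult mult_right_mono flip: of_real_diff)
    qed (use fi in simp)
    finally show ?thesis by simp
  qed
  \<comment> \<open>The added 1 allows division by this factor even if the L1 norm of
    \<open>f\<close> is zero.\<close>
  have *: "norm ?I \<le> e * (1 + (LINT x|circ L. norm (f x)))" if "e > 0" for e
    by (rule order_trans[OF b[OF that]], rule mult_left_mono) (use that in simp_all)
  have J: "0 \<le> (LINT x|circ L. norm (f x))" by simp
  show ?thesis
  proof (rule ccontr)
    assume "?I \<noteq> 0"
    then have pos: "norm ?I > 0" by simp
    define J where "J = (LINT x|circ L. norm (f x))"
    have "norm ?I \<le> norm ?I / 2 / (1 + J) * (1 + J)"
      unfolding J_def by (rule *) (use pos J in \<open>intro divide_pos_pos add_pos_nonneg; simp\<close>)
    also have "\<dots> = norm ?I / 2" using J unfolding J_def[symmetric] by (subst nonzero_eq_divide_eq[symmetric]) auto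
    finally have "norm ?I \<le> norm ?I / 2" .
    then show False using pos by linarith
  qed
qed

text \<open>The continuous functions \<open>h n\<close> decrease to the indicator of
  \<open>K\<close>, and dominated convergence applies with the norm of \<open>f\<close>. An empty
  \<open>K\<close> is excluded because \<open>infdist\<close> to it is 0 by convention, which would
  make every \<open>h n\<close> equal to 1.\<close>

lemma null_spectrum_closed:
  assumes f: "f \<in> null_spectrum" and K: "closed K" "K \<noteq> {}"
  shows "(LINT x|circ L. of_real (indicator K (wind x)) * f x) = 0"
proof -
  define h where "h n z = max 0 (1 - real n * infdist z K)" for n z
  have hc: "continuous_on UNIV (h n)" for n
    unfolding h_def by (intro continuous_intros)
  have [measurable]: "h n \<in> borel_measurable borel" for n
    by (rule borel_measurable_continuous_onI[OF hc])
  have [measurable]: "K \<in> sets borel" using K by simp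
  have fi: "integrable (circ L) f" using f by (simp add: null_spectrum_def)
  have lim: "(\<lambda>n. h n z) \<longlonglongrightarrow> indicator K z" for z
  proof (cases "z \<in> K")
    case True then show ?thesis using K by (simp add: h_def)
  next
    case False
    then have d: "infdist z K > 0" using K by (simp add: infdist_pos_not_in_closed)
    obtain N where N: "1 < real N * infdist z K" using reals_Archimedean3[OF d] by auto
    have "eventually (\<lambda>n. h n z = 0) sequentially"
      using eventually_ge_at_top[of N]
    proof eventually_elim
      case (elim n)
      have "real N * infdist z K \<le> real n * infdist z K" using elim d by simp
      then show ?case using N by (simp add: h_def)
    qed
    then have "(\<lambda>n. h n z) \<longlonglongrightarrow> 0" by (rule tendsto_eventually)
    then show ?thesis using False by simp
  qed
  have "(\<lambda>n. LINT x|circ L. of_real (h n (wind x)) * f x) \<longlonglongrightarrow>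
     (LINT x|circ L. of_real (indicator K (wind x)) * f x)"
  proof (rule integral_dominated_convergence[where w="\<lambda>x. norm (f x)"])
    show "AE x in circ L. (\<lambda>n. of_real (h n (wind x)) * f x) \<longlonglongrightarrow> of_real (indicator K (wind x)) * f x"
      by (intro AE_I2 tendsto_mult tendsto_of_real lim tendsto_const)
    have "0 \<le> h n z \<and> h n z \<le> 1" for n z by (simp add: h_def infdist_nonneg)
    then show "AE x in circ L. norm (of_real (h n (wind x)) * f x) \<le> norm (f x)" for n
      by (intro AE_I2) (simp add: norm_mult mult_left_le_one_le)
  qed (use fi in auto)
  then show ?thesis using null_spectrum_continuous[OF f hc] by (simp add: LIMSEQ_const_iff)
qed

section \<open>From closed arcs to all Borel sets\<close>

lemma AE_circ_ne: "AE x in circ L. x \<noteq> a"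
  unfolding circ_def by (subst AE_restrict_space_iff) (auto intro: AE_mp[OF AE_lborel_singleton[of a]])

lemma null_spectrum_atMost:
  assumes f: "f \<in> null_spectrum"
  shows "(LINT x|circ L. indicator {..b} x *\<^sub>R f x) = 0"
proof -
  have fi: "integrable (circ L) f" using f by (simp add: null_spectrum_def)
  consider "b < 0" | "L \<le> b" | "0 \<le> b" "b < L" by linarith
  then show ?thesis
  proof cases
    case 1
    then have "(LINT x|circ L. indicator {..b} x *\<^sub>R f x) = (LINT x|circ L. 0)"
      by (intro Bochner_Integration.integral_cong refl) (auto simp: indicator_def)
    then show ?thesis by simp
  next
    case 2
    then have "(LINT x|circ L. indicator {..b} x *\<^sub>R f x) = (LINT x|circ L. f x)"
      by (intro Bochner_Integration.integral_cong refl) (auto simp: indicator_def)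
    then show ?thesis using null_spectrum_integral[OF f] by simp
  next
    case 3
    \<comment> \<open>Up to the point \<open>L\<close>, the initial interval is the preimage of this
      compact arc.\<close>
    define K where "K = wind ` {0..b}"
    have K: "closed K" "K \<noteq> {}"
      using 3 by (auto simp: K_def intro!: compact_imp_closed compact_continuous_image wind_continuous)
    then have [measurable]: "K \<in> sets borel" by simp
    have iff: "wind x \<in> K \<longleftrightarrow> x \<le> b" if "0 \<le> x" "x < L" for x
      unfolding K_def using that 3 wind_inj[OF _ that] by fastforce
    have "(LINT x|circ L. indicator {..b} x *\<^sub>R f x) = (LINT x|circ L. of_real (indicator K (wind x)) * f x)"
    proof (rule integral_cong_AE)
      show "AE x in circ L. indicator {..b} x *\<^sub>R f x = of_real (indicator K (wind x)) * f x"
        using AE_circ_ne[of L] AE_space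
        by eventually_elim (auto simp: indicator_def iff)
    qed (use fi in auto)
    then show ?thesis using null_spectrum_closed[OF f K] by simp
  qed
qed

text \<open>The intervals \<open>{..a}\<close> are stable under intersection and generate the Borel
  sets, while the sets over which \<open>f\<close> integrates to zero are stable under complement
  and countable disjoint union. So \<open>f\<close> integrates to zero over every Borel set.\<close>

lemma null_spectrum_AE_zero:
  assumes f: "f \<in> null_spectrum"
  shows "AE x in circ L. f x = 0"
proof -
  have fi: "integrable (circ L) f" using f by (simp add: null_spectrum_def)
  define F where "F x = indicator {0..L} x *\<^sub>R f x" for x
  have Fi: "integrable lborel F"
    using fi unfolding circ_def F_def by (subst (asm) integrable_restrict_space) auto
  have tr: "(LINT x:A|lborel. F x) = (LINT x|circ L. indicator A x *\<^sub>R f x)" for A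
    unfolding circ_def set_lebesgue_integral_def F_def
    by (subst integral_restrict_space) (auto simp: mult.commute)
  have Fs: "set_integrable lborel A F" if "A \<in> sets lborel" for A
    using Fi that unfolding set_integrable_def by (intro integrable_mult_indicator) auto
  have G: "sets lborel = sigma_sets UNIV (range (\<lambda>a::real. {..a}))"
    unfolding sets_lborel by (subst borel_eq_atMost) (rule sets_measure_of, simp)
  have "(LINT x:A|lborel. F x) = 0" if A: "A \<in> sets lborel" for A
  proof -
    have "Int_stable (range (\<lambda>a::real. {..a}))"
      by (auto simp: Int_stable_def)
    then show ?thesis using subset_UNIV[of "range (\<lambda>a::real. {..a})", folded Pow_UNIV] A[unfolded G]
    proof (induct rule: sigma_sets_induct_disjoint)
      case (basic A)
      then show ?case using null_spectrum_atMost[OF f] by (auto simp: tr)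
    next
      case (compl A)
      then have A: "A \<in> sets lborel" by (simp only: G)
      have "(LINT x:A \<union> (UNIV - A)|lborel. F x) = (LINT x:A|lborel. F x) + (LINT x:UNIV - A|lborel. F x)"
        using A by (intro set_integral_Un Fs) auto
      moreover have "(LINT x:UNIV|lborel. F x) = 0" using null_spectrum_integral[OF f] by (simp add: tr)
      ultimately show ?case using compl by (simp add: Un_absorb1)
    next
      case (union A)
      then have A: "\<And>i. A i \<in> sets lborel" unfolding G by blast
      have "(LINT x:(\<Union>i. A i)|lborel. F x) = (\<Sum>i. (LINT x:(A i)|lborel. F x))"
        using A union(1) by (intro lebesgue_integral_countable_add Fs) (auto simp: disjoint_family_on_def)
      then show ?case using union by simp
    qed (simp_all add: set_lebesgue_integral_def)
  qed
  then have "AE x in lborel. F x = 0" by (intro sigma_finite_measure.density_zero[OF lborel.sigma_finite_measure_axioms] Fi)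
  then show ?thesis unfolding circ_def
    by (subst AE_restrict_space_iff) (auto simp: F_def elim: AE_mp)
qed

lemma fcoeff_unique:
  assumes "f \<in> L2 L" "g \<in> L2 L" "\<And>k. fcoeff L k f = fcoeff L k g"
  shows "AE x in circ L. f x = g x"
proof -
  have "fcoeff L (- k) (\<lambda>x. f x - g x) = 0" for k using assms by (simp add: fcoeff_diff)
  then have "(LINT x|circ L. expo L k x * (f x - g x)) = 0" for k
    by (simp add: fcoeff_def innerL2_def cnj_expo)
  then have "(\<lambda>x. f x - g x) \<in> null_spectrum"
    using assms by (simp add: null_spectrum_def L2_integrable)
  from null_spectrum_AE_zero[OF this] show ?thesis by simp
qed

end

section \<open>Riesz--Fischer and Parseval\<close>

lemma has_sum_diff:
  fixes f g :: "'a \<Rightarrow> 'b::topological_ab_group_add"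
  assumes "(f has_sum a) A" "(g has_sum b) A"
  shows "((\<lambda>x. f x - g x) has_sum (a - b)) A"
  using has_sum_add[OF assms(1), of "\<lambda>x. - g x" "- b"] assms(2) by (simp add: has_sum_uminus)

lemma sum_le_nn_integral_count_space:
  assumes "finite F"
  shows "(\<Sum>k\<in>F. f k) \<le> (\<integral>\<^sup>+k. f k \<partial>count_space UNIV)"
proof -
  have "(\<Sum>k\<in>F. f k) = (\<integral>\<^sup>+k. f k \<partial>count_space F)"
    using assms by (simp add: nn_integral_count_space_finite)
  also have "\<dots> = (\<integral>\<^sup>+k. f k * indicator F k \<partial>count_space UNIV)"
    by (simp only: nn_integral_restrict_space[symmetric] restrict_count_space sets_count_space Pow_UNIV UNIV_I space_count_space Int_UNIV_right Int_UNIV_left)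
  also have "\<dots> \<le> (\<integral>\<^sup>+k. f k \<partial>count_space UNIV)"
    by (intro nn_integral_mono) (auto split: split_indicator)
  finally show ?thesis .
qed

lemma int_summable_tail:
  fixes a :: "int \<Rightarrow> real"
  assumes "a summable_on UNIV" "\<And>k. 0 \<le> a k" "e > 0"
  obtains N :: nat where "\<And>F. finite F \<Longrightarrow> F \<inter> {- int N..int N} = {} \<Longrightarrow> sum a F \<le> e"
proof -
  obtain F0 where F0: "finite F0" "dist (sum a F0) (infsum a UNIV) \<le> e"
    using has_sum_finite_approximation[OF has_sum_infsum[OF assms(1)] assms(3)] by auto
  \<comment> \<open>The sum of the absolute values dominates each of them and covers an empty
    \<open>F0\<close> as well.\<close>
  define N where "N = nat (\<Sum>k\<in>F0. \<bar>k\<bar>)"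
  have "\<bar>k\<bar> \<le> int N" if "k \<in> F0" for k
    using member_le_sum[of k F0 abs] F0(1) that by (simp add: N_def sum_nonneg)
  then have sub: "F0 \<subseteq> {- int N..int N}" by fastforce
  have "sum a F \<le> e" if F: "finite F" "F \<inter> {- int N..int N} = {}" for F
  proof -
    have "sum a F + sum a F0 = sum a (F \<union> F0)"
      using F F0 sub by (subst sum.union_disjoint) auto
    also have "\<dots> \<le> infsum a UNIV"
      using F F0 assms by (intro finite_sum_le_infsum) auto
    finally show ?thesis using F0(2) by (simp add: dist_real_def)
  qed
  then show ?thesis by (rule that)
qed

context circle
begin

text \<open>Cauchy--Schwarz with a free parameter. At \<open>t = (1/2)^j\<close> it turns squared L2
  norms of size \<open>(1/4)^j\<close> into L1 norms of size \<open>(1/2)^j\<close>.\<close>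

lemma integral_norm_le_sqn:
  assumes f: "f \<in> L2 L" and t: "t > 0"
  shows "(LINT x|circ L. cmod (f x)) \<le> t * L + sqn f / t"
proof -
  have "(LINT x|circ L. cmod (f x)) \<le> (LINT x|circ L. t + (cmod (f x))\<^sup>2 / t)"
  proof (rule integral_mono)
    show "integrable (circ L) (\<lambda>x. cmod (f x))" using f by (simp add: L2_integrable)
    show "integrable (circ L) (\<lambda>x. t + (cmod (f x))\<^sup>2 / t)" using f by (simp add: L2_square_integrable)
    have "t * y \<le> t\<^sup>2 + y\<^sup>2" if "y \<ge> 0" for y
    proof -
      have "2 * (t * y) \<le> t\<^sup>2 + y\<^sup>2" using sum_squares_bound[of t y] by (simp add: mult.assoc)
      moreover have "0 \<le> t * y" using t that by simp
      ultimately show ?thesis by linarith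
    qed
    from this[of "cmod (f x)" for x] show "cmod (f x) \<le> t + (cmod (f x))\<^sup>2 / t" for x
      using t by (simp add: field_simps power2_eq_square)
  qed
  also have "\<dots> = t * L + sqn f / t"
    using f by (simp add: sqn_def L2_square_integrable measure_circ mult.commute)
  finally show ?thesis .
qed

text \<open>The series is cut into blocks whose L2 norms decay geometrically, so that they are
  absolutely summable in L1 and hence almost everywhere. Summability in L1 lets the coefficients
  pass to the limit, and Fatou's lemma bounds the norm. Equality in that bound comes only with
  \<open>parseval\<close>.\<close>

theorem riesz_fischer:
  assumes c: "(\<lambda>k. (cmod (c k))\<^sup>2) summable_on UNIV"
  obtains g where "g \<in> L2 L" "\<And>k. fcoeff L k g = c k" "sqn g \<le> (\<Sum>\<^sub>\<infinity>k. (cmod (c k))\<^sup>2)"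
proof -
  let ?S = "\<Sum>\<^sub>\<infinity>k. (cmod (c k))\<^sup>2"
  have "\<exists>N. \<forall>F. finite F \<longrightarrow> F \<inter> {- int N..int N} = {} \<longrightarrow> (\<Sum>k\<in>F. (cmod (c k))\<^sup>2) \<le> (1/4)^j" for j :: nat
    using int_summable_tail[OF c, of "(1/4)^j"] by (metis zero_le_power2 zero_less_divide_1_iff zero_less_numeral zero_less_power)
  then obtain N where N: "\<And>j F. finite F \<Longrightarrow> F \<inter> {- int (N j)..int (N j)} = {} \<Longrightarrow> (\<Sum>k\<in>F. (cmod (c k))\<^sup>2) \<le> (1/4)^j"
    by metis
  \<comment> \<open>The maximum makes the cutoffs nondecreasing; the summand \<open>j\<close> makes
    them unbounded, so that every frequency is eventually included.\<close>
  define M where "M j = j + Max (N ` {..j})" for j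
  have MN: "N j \<le> M j" for j unfolding M_def by (intro trans_le_add2 Max_ge) auto
  have Mj: "j \<le> M j" for j by (simp add: M_def)
  have Minc: "M j \<le> M (Suc j)" for j unfolding M_def by (intro add_mono Max_mono) auto
  define I where "I j = {- int (M j)..int (M j)}" for j
  have If: "finite (I j)" for j by (simp add: I_def)
  have Iinc: "I j \<subseteq> I (Suc j)" for j using Minc[of j] by (auto simp: I_def)
  define D where "D j = trig (I (Suc j) - I j) c" for j
  have DL: "D j \<in> L2 L" for j by (simp add: D_def trig_L2)
  have [measurable]: "D j \<in> borel_measurable (circ L)" for j using DL by (rule L2_measurable)
  have Dsq: "sqn (D j) \<le> (1/4)^j" for j
    unfolding D_def using MN[of j] by (subst sqn_trig) (auto simp: I_def intro!: N)
  have D1: "(LINT x|circ L. cmod (D j x)) \<le> (L + 1) * (1/2)^j" for j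
  proof -
    have "(LINT x|circ L. cmod (D j x)) \<le> (1/2)^j * L + sqn (D j) / (1/2)^j"
      by (rule integral_norm_le_sqn[OF DL]) simp
    also have "sqn (D j) / (1/2)^j \<le> (1/4)^j / (1/2)^j"
      by (intro divide_right_mono Dsq) simp
    also have "(1/4)^j / (1/2)^j = (1/2::real)^j"
      by (simp add: power_divide[symmetric] flip: power_mult_distrib)
    finally show ?thesis by (simp add: algebra_simps)
  qed
  have sumD: "summable (\<lambda>j. LINT x|circ L. cmod (D j x))"
    by (rule summable_comparison_test'[OF summable_mult[OF summable_geometric[of "1/2::real"]]])
      (use D1 in \<open>auto simp: abs_of_nonneg\<close>)
  have AEs: "AE x in circ L. summable (\<lambda>j. cmod (D j x))"
  proof -
    have "(\<integral>\<^sup>+x. (\<Sum>j. ennreal (cmod (D j x))) \<partial>circ L) = (\<Sum>j. \<integral>\<^sup>+x. ennreal (cmod (D j x)) \<partial>circ L)"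
      by (rule nn_integral_suminf) simp
    also have "\<dots> = (\<Sum>j. ennreal (LINT x|circ L. cmod (D j x)))"
      by (intro suminf_cong nn_integral_eq_integral) (auto intro: integrable_norm L2_integrable DL)
    also have "\<dots> \<noteq> \<infinity>"
      unfolding infinity_ennreal_def by (rule ennreal_suminf_neq_top[OF sumD]) simp
    finally have "AE x in circ L. (\<Sum>j. ennreal (cmod (D j x))) \<noteq> \<infinity>"
      by (intro nn_integral_PInf_AE) auto
    then show ?thesis
      by eventually_elim (auto intro: summable_suminf_not_top)
  qed
  note sums = L2_integrable[OF DL] AEs sumD
  define g where "g x = trig (I 0) c x + (\<Sum>j. D j x)" for x
  have part: "trig (I 0) c x + (\<Sum>j<n. D j x) = trig (I n) c x" for n x
  proof (induction n)
    case (Suc n)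
    have step: "trig (I (Suc n)) c x = trig (I n) c x + D n x"
      unfolding trig_def D_def using sum.subset_diff[OF Iinc If, of "\<lambda>k. c k * expo L k x" n]
      by (simp add: add.commute)
    show ?case unfolding step Suc.IH[symmetric] by (simp add: add.assoc)
  qed simp
  have gi: "integrable (circ L) g"
    unfolding g_def by (intro Bochner_Integration.integrable_add L2_integrable[OF trig_L2] integrable_suminf[OF sums])
  have [measurable]: "g \<in> borel_measurable (circ L)" using gi by simp
  have lim: "AE x in circ L. (\<lambda>n. trig (I n) c x) \<longlonglongrightarrow> g x"
    using AEs
  proof eventually_elim
    case (elim x)
    have "(\<lambda>n. trig (I 0) c x + (\<Sum>j<n. D j x)) \<longlonglongrightarrow> g x"
      unfolding g_def by (intro tendsto_add tendsto_const summable_LIMSEQ summable_norm_cancel[OF elim])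
    then show ?case by (simp only: part)
  qed
  have coef: "fcoeff L k g = c k" for k
  proof -
    have "(\<lambda>j. LINT x|circ L. cnj (expo L k x) * D j x) sums (LINT x|circ L. (\<Sum>j. cnj (expo L k x) * D j x))"
    proof (rule sums_integral)
      show "integrable (circ L) (\<lambda>x. cnj (expo L k x) * D j x)" for j
        by (intro L2_inner_integrable expo_L2 DL)
      show "AE x in circ L. summable (\<lambda>j. norm (cnj (expo L k x) * D j x))"
        using AEs by eventually_elim (simp add: norm_mult norm_expo summable_divide)
      show "summable (\<lambda>j. LINT x|circ L. norm (cnj (expo L k x) * D j x))"
        using sumD by (simp add: norm_mult norm_expo summable_divide)
    qed
    moreover have "(LINT x|circ L. cnj (expo L k x) * (\<Sum>j. D j x)) = (LINT x|circ L. (\<Sum>j. cnj (expo L k x) * D j x))"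
    proof (rule integral_cong_AE)
      show "AE x in circ L. cnj (expo L k x) * (\<Sum>j. D j x) = (\<Sum>j. cnj (expo L k x) * D j x)"
        using AEs by eventually_elim (simp add: suminf_mult summable_norm_cancel)
    qed (auto simp: cnj_expo)
    ultimately have s: "(\<lambda>j. fcoeff L k (D j)) sums (LINT x|circ L. cnj (expo L k x) * (\<Sum>j. D j x))"
      by (simp add: fcoeff_def innerL2_def)
    have gi': "integrable (circ L) (\<lambda>x. cnj (expo L k x) * (\<Sum>j. D j x))"
      unfolding cnj_expo by (intro expo_mult_integrable integrable_suminf[OF sums])
    have "fcoeff L k g = fcoeff L k (trig (I 0) c) + (LINT x|circ L. cnj (expo L k x) * (\<Sum>j. D j x))"
      unfolding g_def fcoeff_def innerL2_def distrib_left
      by (intro Bochner_Integration.integral_add gi' L2_inner_integrable expo_L2 trig_L2)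
    then have "(\<lambda>n. fcoeff L k (trig (I 0) c) + (\<Sum>j<n. fcoeff L k (D j))) \<longlonglongrightarrow> fcoeff L k g"
      using s by (auto simp: sums_def intro!: tendsto_add)
    moreover have "fcoeff L k (trig (I 0) c) + (\<Sum>j<n. fcoeff L k (D j)) = fcoeff L k (trig (I n) c)" for n
    proof -
      have "fcoeff L k (trig (I n) c) = fcoeff L k (\<lambda>x. trig (I 0) c x + (\<Sum>j<n. D j x))"
        unfolding part ..
      also have "\<dots> = fcoeff L k (trig (I 0) c) + (\<Sum>j<n. fcoeff L k (D j))"
        by (simp add: fcoeff_add trig_L2 L2_sum DL fcoeff_sum)
      finally show ?thesis by simp
    qed
    ultimately have "(\<lambda>n. fcoeff L k (trig (I n) c)) \<longlonglongrightarrow> fcoeff L k g" by simp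
    moreover have "eventually (\<lambda>n. fcoeff L k (trig (I n) c) = c k) sequentially"
      using eventually_ge_at_top[of "nat \<bar>k\<bar>"]
    proof eventually_elim
      case (elim n)
      then have "k \<in> I n" using Mj[of n] by (auto simp: I_def)
      then show ?case by (simp add: fcoeff_trig If)
    qed
    ultimately show ?thesis
      by (metis LIMSEQ_unique tendsto_eventually)
  qed
  have "(\<integral>\<^sup>+x. ennreal ((cmod (g x))\<^sup>2) \<partial>circ L) = (\<integral>\<^sup>+x. liminf (\<lambda>n. ennreal ((cmod (trig (I n) c x))\<^sup>2)) \<partial>circ L)"
  proof (rule nn_integral_cong_AE)
    show "AE x in circ L. ennreal ((cmod (g x))\<^sup>2) = liminf (\<lambda>n. ennreal ((cmod (trig (I n) c x))\<^sup>2))"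
      using lim
    proof eventually_elim
      case (elim x)
      have "(\<lambda>n. ennreal ((cmod (trig (I n) c x))\<^sup>2)) \<longlonglongrightarrow> ennreal ((cmod (g x))\<^sup>2)"
        by (intro tendsto_ennrealI tendsto_intros elim)
      then show ?case by (intro lim_imp_Liminf[symmetric]) auto
    qed
  qed
  also have "\<dots> \<le> liminf (\<lambda>n. \<integral>\<^sup>+x. ennreal ((cmod (trig (I n) c x))\<^sup>2) \<partial>circ L)"
    by (rule nn_integral_liminf) (use trig_L2[THEN L2_measurable] in measurable)
  also have "\<dots> = liminf (\<lambda>n. ennreal (\<Sum>k\<in>I n. (cmod (c k))\<^sup>2))"
    by (subst nn_integral_eq_integral)
       (auto simp: L2_square_integrable trig_L2 If simp flip: sqn_def sqn_trig)
  also have "\<dots> \<le> ennreal ?S"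
  proof (rule Liminf_le)
    show "eventually (\<lambda>n. ennreal (\<Sum>k\<in>I n. (cmod (c k))\<^sup>2) \<le> ennreal ?S) sequentially"
      using c If by (intro always_eventually allI ennreal_leI finite_sum_le_infsum) auto
  qed simp
  finally have nn: "(\<integral>\<^sup>+x. ennreal ((cmod (g x))\<^sup>2) \<partial>circ L) \<le> ennreal ?S" .
  have g2: "integrable (circ L) (\<lambda>x. (cmod (g x))\<^sup>2)"
    using nn by (intro integrableI_bounded) (auto simp: le_less_trans)
  have gL: "g \<in> L2 L" using g2 by (simp add: L2_def)
  have "ennreal (sqn g) \<le> ennreal ?S"
    using nn nn_integral_eq_integral[OF g2] by (simp add: sqn_def)
  then have "sqn g \<le> ?S" by (simp add: infsum_nonneg)
  with gL coef show ?thesis by (rule that)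
qed

section \<open>Parseval's identity\<close>

lemma sqn_cong_AE:
  assumes "f \<in> L2 L" "g \<in> L2 L" "AE x in circ L. f x = g x"
  shows "sqn f = sqn g"
  unfolding sqn_def using assms
  by (intro integral_cong_AE) (auto intro: borel_measurable_integrable L2_square_integrable)

text \<open>Bessel's inequality is one direction. The function that \<open>riesz_fischer\<close>
  builds from the coefficients of \<open>f\<close> satisfies the other, and by uniqueness it agrees
  with \<open>f\<close> almost everywhere.\<close>

theorem parseval:
  assumes f: "f \<in> L2 L"
  shows "((\<lambda>k. (cmod (fcoeff L k f))\<^sup>2) has_sum sqn f) UNIV"
proof -
  obtain g where g: "g \<in> L2 L" "\<And>k. fcoeff L k g = fcoeff L k f" "sqn g \<le> (\<Sum>\<^sub>\<infinity>k. (cmod (fcoeff L k f))\<^sup>2)"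
    using riesz_fischer[OF fcoeff_square_summable[OF f]] by metis
  have "sqn g = sqn f" using fcoeff_unique[OF g(1) f g(2)] by (intro sqn_cong_AE g f)
  moreover have "(\<Sum>\<^sub>\<infinity>k. (cmod (fcoeff L k f))\<^sup>2) \<le> sqn f"
    by (intro infsum_le_finite_sums fcoeff_square_summable bessel f) 
  ultimately have "(\<Sum>\<^sub>\<infinity>k. (cmod (fcoeff L k f))\<^sup>2) = sqn f" using g(3) by simp
  then show ?thesis using fcoeff_square_summable[OF f] has_sum_infsum by fastforce
qed

theorem parseval_inner:
  assumes f: "f \<in> L2 L" and g: "g \<in> L2 L"
  shows "((\<lambda>k. Re (cnj (fcoeff L k f) * fcoeff L k g)) has_sum innerK L f g) UNIV"
proof -
  \<comment> \<open>Real polarization, applied with the coefficients of \<open>f\<close> and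
    \<open>g\<close> as \<open>a\<close> and \<open>b\<close>.\<close>
  have pol: "Re (cnj a * b) = ((cmod (b + a))\<^sup>2 - (cmod b)\<^sup>2 - (cmod a)\<^sup>2) / 2" for a b :: complex
    unfolding cmod_power2 by (simp add: power2_eq_square field_simps)
  have "((\<lambda>k. ((cmod (fcoeff L k (\<lambda>x. g x + f x)))\<^sup>2 - (cmod (fcoeff L k g))\<^sup>2 - (cmod (fcoeff L k f))\<^sup>2) / 2)
     has_sum ((sqn (\<lambda>x. g x + f x) - sqn g - sqn f) / 2)) UNIV"
    unfolding divide_inverse
    by (intro has_sum_cmult_left has_sum_diff parseval L2_add f g)
  then show ?thesis
    unfolding pol innerK_def using f g by (simp add: fcoeff_add sqn_add)
qed

lemma inner_le_sum:
  assumes f: "f \<in> L2 L" and g: "g \<in> L2 L" 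
  shows "ennreal (cmod (innerL2 L f g)) \<le> (\<integral>\<^sup>+k. ennreal (cmod (fcoeff L k f)) * ennreal (cmod (fcoeff L k g)) \<partial>count_space UNIV)"
proof -
  \<comment> \<open>A rotation of \<open>g\<close> makes the inner product real, where \<open>parseval_inner\<close> applies.\<close>
  define u where "u = cnj (sgn (innerL2 L f g))"
  have u1: "cmod u \<le> 1" by (simp add: u_def norm_sgn)
  have "u * innerL2 L f g = of_real (cmod (innerL2 L f g))"
  proof (cases "innerL2 L f g = 0")
    case False
    have "u * innerL2 L f g = innerL2 L f g * cnj (innerL2 L f g) / of_real (cmod (innerL2 L f g))"
      by (simp add: u_def sgn_eq)
    also have "innerL2 L f g * cnj (innerL2 L f g) = of_real (cmod (innerL2 L f g)) * of_real (cmod (innerL2 L f g))"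
      by (simp add: complex_norm_square[symmetric] power2_eq_square del: of_real_power)
    finally show ?thesis using False by simp
  qed simp
  then have "innerK L f (\<lambda>x. u * g x) = cmod (innerL2 L f g)"
    by (simp add: innerK_def innerL2_scale_right)
  then have hs: "((\<lambda>k. Re (cnj (fcoeff L k f) * (u * fcoeff L k g))) has_sum cmod (innerL2 L f g)) UNIV"
    using parseval_inner[OF f L2_scale[OF g, of u]] by (simp add: fcoeff_scale)
  let ?a = "\<lambda>k. Re (cnj (fcoeff L k f) * (u * fcoeff L k g))"
  have le: "?a k \<le> cmod (fcoeff L k f) * cmod (fcoeff L k g)" for k
  proof -
    have "?a k \<le> cmod (cnj (fcoeff L k f) * (u * fcoeff L k g))" by (rule complex_Re_le_cmod)
    also have "\<dots> = cmod u * (cmod (fcoeff L k f) * cmod (fcoeff L k g))" by (simp add: norm_mult)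
    also have "\<dots> \<le> cmod (fcoeff L k f) * cmod (fcoeff L k g)"
      using u1 by (simp add: mult_left_le_one_le)
    finally show ?thesis .
  qed
  show ?thesis (is "_ \<le> ?R")
  proof (cases ?R)
    case (real q)
    have "(\<Sum>k\<in>F. ?a k) \<le> q" if F: "finite F" for F
    proof -
      have "(\<Sum>k\<in>F. ?a k) \<le> (\<Sum>k\<in>F. cmod (fcoeff L k f) * cmod (fcoeff L k g))"
        by (intro sum_mono le)
      moreover have "ennreal (\<Sum>k\<in>F. cmod (fcoeff L k f) * cmod (fcoeff L k g)) \<le> ?R"
        using sum_le_nn_integral_count_space[OF F, of "\<lambda>k. ennreal (cmod (fcoeff L k f)) * ennreal (cmod (fcoeff L k g))"]
        by (simp add: ennreal_mult[symmetric] sum_ennreal)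
      then have "(\<Sum>k\<in>F. cmod (fcoeff L k f) * cmod (fcoeff L k g)) \<le> q"
        using real by (simp add: sum_nonneg)
      ultimately show ?thesis by linarith
    qed
    then have "cmod (innerL2 L f g) \<le> q" by (intro has_sum_le_finite_sums[OF hs]) auto
    then show ?thesis unfolding real(2) by (rule ennreal_leI)
  qed simp
qed

section \<open>Functional calculus on Fourier modes\<close>

lemma lap_opD:
  assumes f: "f \<in> lap_dom L a"
  shows "lap_op L a f \<in> L2 L" "fcoeff L k (lap_op L a f) = of_real (a (lap_eig L k)) * fcoeff L k f"
    "sqn (lap_op L a f) = (\<Sum>\<^sub>\<infinity>k. (cmod (of_real (a (lap_eig L k)) * fcoeff L k f))\<^sup>2)"
proof -
  have s: "(\<lambda>k. (cmod (of_real (a (lap_eig L k)) * fcoeff L k f))\<^sup>2) summable_on UNIV"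
    using f by (simp add: lap_dom_def)
  \<comment> \<open>Riesz--Fischer supplies the witness that gives the choice in
    \<open>lap_op\<close> its meaning.\<close>
  have "\<exists>g. g \<in> L2 L \<and> (\<forall>k. fcoeff L k g = of_real (a (lap_eig L k)) * fcoeff L k f)"
    using riesz_fischer[OF s] by metis
  from someI_ex[OF this] f
  have *: "lap_op L a f \<in> L2 L" "\<And>k. fcoeff L k (lap_op L a f) = of_real (a (lap_eig L k)) * fcoeff L k f"
    by (auto simp: lap_op_def)
  show "lap_op L a f \<in> L2 L" "fcoeff L k (lap_op L a f) = of_real (a (lap_eig L k)) * fcoeff L k f"
    by (rule *)+
  show "sqn (lap_op L a f) = (\<Sum>\<^sub>\<infinity>k. (cmod (of_real (a (lap_eig L k)) * fcoeff L k f))\<^sup>2)"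
    using parseval[OF *(1)] unfolding *(2) by (simp add: infsumI)
qed

lemma lap_dom_bounded:
  assumes f: "f \<in> L2 L" and B: "\<And>k. \<bar>a (lap_eig L k)\<bar> \<le> B"
  shows "f \<in> lap_dom L a"
proof -
  have "(\<lambda>k. (cmod (of_real (a (lap_eig L k)) * fcoeff L k f))\<^sup>2) summable_on UNIV"
  proof (rule summable_on_comparison_test)
    show "(\<lambda>k. B\<^sup>2 * (cmod (fcoeff L k f))\<^sup>2) summable_on UNIV"
      by (intro summable_on_cmult_right fcoeff_square_summable f)
    show "(cmod (of_real (a (lap_eig L k)) * fcoeff L k f))\<^sup>2 \<le> B\<^sup>2 * (cmod (fcoeff L k f))\<^sup>2" for k
      using B[of k] by (simp add: norm_mult power_mult_distrib mult_right_mono abs_le_square_iff[symmetric])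
  qed auto
  then show ?thesis using f by (simp add: lap_dom_def)
qed

lemma lap_op_expo:
  "expo L j \<in> lap_dom L a" "sqn (lap_op L a (expo L j)) = (a (lap_eig L j))\<^sup>2"
proof -
  have eq: "(\<lambda>k. (cmod (of_real (a (lap_eig L k)) * fcoeff L k (expo L j)))\<^sup>2) = (\<lambda>k. if k = j then (a (lap_eig L j))\<^sup>2 else 0)"
    by (auto simp: fcoeff_expo)
  have hs: "((\<lambda>k. if k = j then (a (lap_eig L j))\<^sup>2 else 0) has_sum (a (lap_eig L j))\<^sup>2) UNIV"
    by (rule has_sum_finite_neutralI[of "{j}"]) auto
  show d: "expo L j \<in> lap_dom L a"
    unfolding lap_dom_def using hs by (auto simp: expo_L2 eq intro: has_sum_imp_summable)
  show "sqn (lap_op L a (expo L j)) = (a (lap_eig L j))\<^sup>2"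
    unfolding lap_opD(3)[OF d] eq by (rule infsumI[OF hs])
qed

text \<open>Each exponential lies in every domain and is an eigenvector, so testing the form
  inequality on \<open>expo L k\<close> compares the two eigenvalues. Nonnegativity ensures that
  squaring the square roots returns them.\<close>

lemma lap_op_leD:
  assumes "lap_op_le L a b" "0 \<le> a (lap_eig L k)" "0 \<le> b (lap_eig L k)"
  shows "a (lap_eig L k) \<le> b (lap_eig L k)"
proof -
  have "(normK L (lap_op L (\<lambda>t. sqrt (a t)) (expo L k)))\<^sup>2 \<le> (normK L (lap_op L (\<lambda>t. sqrt (b t)) (expo L k)))\<^sup>2"
    using assms(1) lap_op_expo(1) by (auto simp: lap_op_le_def)
  then show ?thesis using assms(2,3) by (simp add: normK_square lap_op_expo(2))
qed

end

section \<open>Gradient and Hessian of the potential\<close>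

text \<open>At a zero of \<open>q\<close>, which is a minimum, \<open>DERIV_fun_powr\<close> does not apply.\<close>

lemma powr_derivative_nonneg:
  fixes q :: "real \<Rightarrow> real"
  assumes q: "(q has_real_derivative q') (at a)" and nn: "\<And>t. 0 \<le> q t" and p: "1 < p"
  shows "((\<lambda>t. q t powr p) has_real_derivative p * q a powr (p - 1) * q') (at a)"
proof (cases "q a = 0")
  case False
  then have "q a > 0" using nn[of a] by simp
  from DERIV_fun_powr[OF q this, of p] show ?thesis by simp
next
  case True
  have "((\<lambda>x::real. \<bar>x\<bar> powr p) has_real_derivative 0) (at 0)"
  proof -
    have "((\<lambda>h::real. \<bar>h\<bar> powr (p - 1)) \<longlongrightarrow> 0) (at 0)"
      using p by (intro tendsto_zero_powrI tendsto_rabs_zero tendsto_ident_at tendsto_const) auto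
    moreover have "norm ((\<bar>0 + h\<bar> powr p - \<bar>0\<bar> powr p) / h) = \<bar>h\<bar> powr (p - 1)" if "h \<noteq> 0" for h :: real
      using that by (simp add: powr_diff)
    then have "eventually (\<lambda>h::real. norm ((\<bar>0 + h\<bar> powr p - \<bar>0\<bar> powr p) / h) = \<bar>h\<bar> powr (p - 1)) (at 0)"
      by (auto simp: eventually_at_filter)
    ultimately have "((\<lambda>h::real. norm ((\<bar>0 + h\<bar> powr p - \<bar>0\<bar> powr p) / h)) \<longlongrightarrow> 0) (at 0)"
      by (subst tendsto_cong)
    then show ?thesis unfolding DERIV_def by (rule tendsto_norm_zero_cancel)
  qed
  then have "((\<lambda>t. \<bar>q t\<bar> powr p) has_real_derivative 0 * q') (at a)"
    using q True by (intro DERIV_chain2[where f="\<lambda>x. \<bar>x\<bar> powr p"]) auto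
  then show ?thesis using True nn by (simp add: abs_of_nonneg)
qed

context circle
begin

section \<open>Continuous functions and uniqueness of gradients\<close>

lemma continuous_integrable:
  fixes f :: "real \<Rightarrow> 'b::{banach,second_countable_topology}"
  assumes "continuous_on UNIV f"
  shows "integrable (circ L) f"
proof -
  have "compact (f ` {0..L})" by (intro compact_continuous_image continuous_on_subset[OF assms]) auto
  then obtain B where "\<And>x. x \<in> {0..L} \<Longrightarrow> norm (f x) \<le> B"
    by (meson bounded_iff compact_imp_bounded imageI)
  then show ?thesis
    by (intro C.integrable_const_bound[where B=B] AE_I2 borel_circ borel_measurable_continuous_onI assms) simp
qed

lemma continuous_L2: "continuous_on UNIV f \<Longrightarrow> f \<in> L2 L"
  unfolding L2_def
  by (auto intro!: continuous_integrable continuous_intros borel_circ borel_measurable_continuous_onI)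

lemma bcontfun_continuous: "continuous_on S (apply_bcontfun \<phi>)"
  using apply_bcontfun[of \<phi>] by (auto simp: bcontfun_def intro: continuous_on_subset)

lemma expo_continuous: "continuous_on S (expo L k)"
  unfolding expo_def [abs_def] by (intro continuous_intros) (use L_pos in auto)

lemma apply_basisK: "apply_bcontfun (basisK L k z) = (\<lambda>x. z * expo L k x)"
  unfolding basisK_def
proof (rule Bcontfun_inverse)
  have "bounded (range (\<lambda>x. z * expo L k x))"
    unfolding bounded_iff by (auto simp: norm_mult norm_expo)
  then show "(\<lambda>x. z * expo L k x) \<in> bcontfun"
    by (auto simp: bcontfun_def intro!: continuous_intros expo_continuous)
qed

lemma basisK_Omega: "basisK L k z \<in> Omega L"
  by (simp add: Omega_def apply_basisK expo_periodic)

lemma sqn_basis: "sqn (\<lambda>x. z * expo L k x) = (cmod z)\<^sup>2"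
proof -
  have "sqn (\<lambda>x. z * expo L k x) = sqn (trig {k} (\<lambda>_. z))" by (simp add: trig_def [abs_def])
  then show ?thesis by (simp add: sqn_trig)
qed

text \<open>The directions \<open>z * expo L k\<close> with \<open>z\<close> equal to 1 and \<i>
  recover real and imaginary parts of every Fourier coefficient from the real inner product, and the
  coefficients determine the function almost everywhere.\<close>

lemma gradK_unique:
  assumes g: "is_gradK L F \<phi> g"
  shows "gradK L F \<phi> \<in> L2 L" "AE x in circ L. gradK L F \<phi> x = g x"
proof -
  let ?h = "gradK L F \<phi>"
  have h: "is_gradK L F \<phi> ?h" unfolding gradK_def using g by (rule someI[where P="is_gradK L F \<phi>"])
  then show L2: "?h \<in> L2 L" by (simp add: is_gradK_def)
  have gL: "g \<in> L2 L" using g by (simp add: is_gradK_def)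
  have "innerK L ?h (apply_bcontfun \<psi>) = innerK L g (apply_bcontfun \<psi>)" if "\<psi> \<in> Omega L" for \<psi>
    using g h that unfolding is_gradK_def by (blast intro: DERIV_unique)
  from this[OF basisK_Omega] have e: "Re (z * innerL2 L ?h (expo L k)) = Re (z * innerL2 L g (expo L k))" for z k
    by (simp add: apply_basisK innerK_def innerL2_scale_right)
  have "innerL2 L ?h (expo L k) = innerL2 L g (expo L k)" for k
    using e[of 1 k] e[of "\<i>" k] by (simp add: complex_eq_iff)
  then have "fcoeff L k ?h = fcoeff L k g" for k
    unfolding fcoeff_def by (metis innerL2_commute)
  then show "AE x in circ L. ?h x = g x" by (rule fcoeff_unique[OF L2 gL])
qed

lemma gradK_inner:
  assumes g: "is_gradK L F \<phi> g" and f: "f \<in> L2 L"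
  shows "innerL2 L f (gradK L F \<phi>) = innerL2 L f g" "innerL2 L (gradK L F \<phi>) f = innerL2 L g f"
proof -
  have "g \<in> L2 L" using g by (simp add: is_gradK_def)
  then show "innerL2 L f (gradK L F \<phi>) = innerL2 L f g" "innerL2 L (gradK L F \<phi>) f = innerL2 L g f"
    using gradK_unique[OF g] f by (auto intro!: innerL2_cong_AE)
qed

lemma gradK_fcoeff:
  assumes g: "is_gradK L F \<phi> g"
  shows "fcoeff L k (gradK L F \<phi>) = fcoeff L k g"
  unfolding fcoeff_def by (rule gradK_inner(1)[OF g expo_L2])

section \<open>Explicit first and second derivatives\<close>

lemma innerK_integral:
  assumes "f \<in> L2 L" "g \<in> L2 L"
  shows "innerK L f g = (LINT x|circ L. Re (cnj (f x) * g x))"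
  unfolding innerK_def innerL2_def by (rule integral_Re[symmetric, OF L2_inner_integrable[OF assms]])

lemma sqn_line:
  assumes "f \<in> L2 L" "h \<in> L2 L"
  shows "sqn (\<lambda>x. f x + t *\<^sub>R h x) = sqn f + 2 * t * innerK L f h + t\<^sup>2 * sqn h"
proof -
  have "sqn (\<lambda>x. of_real t * h x) = t\<^sup>2 * sqn h"
    by (simp add: sqn_def norm_mult power_mult_distrib)
  moreover have "Re (innerL2 L (\<lambda>x. of_real t * h x) f) = t * innerK L f h"
    by (simp add: innerL2_scale_left innerK_def innerL2_commute[of h f])
  ultimately show ?thesis
    using assms sqn_add[OF assms(1) L2_scale[OF assms(2), of "of_real t"]] by (simp add: scaleR_conv_of_real)
qed

lemma sqn_powr_derivative:
  assumes "f \<in> L2 L" "h \<in> L2 L" "1 < p"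
  shows "((\<lambda>t. sqn (\<lambda>x. f x + t *\<^sub>R h x) powr p) has_real_derivative 
     p * sqn f powr (p - 1) * (2 * innerK L f h)) (at 0)"
proof -
  have "((\<lambda>t. sqn (\<lambda>x. f x + t *\<^sub>R h x)) has_real_derivative 2 * innerK L f h) (at 0)"
    unfolding sqn_line[OF assms(1,2)] by (auto intro!: derivative_eq_intros)
  from powr_derivative_nonneg[OF this sqn_nonneg assms(3)] show ?thesis by simp
qed

definition gradV :: "real \<Rightarrow> real \<Rightarrow> real \<Rightarrow> (real \<Rightarrow> complex) \<Rightarrow> real \<Rightarrow> complex" where
  "gradV lam \<kappa> r f x = of_real (- lam * (cmod (f x))\<^sup>2 + \<kappa> * sqn f powr (r - 1)) * f x"

text \<open>The derivative of \<open>gradV\<close> at \<open>f\<close> in the direction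
  \<open>h\<close>. It is only real-linear in \<open>h\<close>, since the squared modulus
  contributes \<open>2 * Re (cnj (f x) * h x)\<close>; the last summand differentiates the factor
  \<open>sqn f powr (r - 1)\<close>.\<close>

definition hessV :: "real \<Rightarrow> real \<Rightarrow> real \<Rightarrow> (real \<Rightarrow> complex) \<Rightarrow> (real \<Rightarrow> complex) \<Rightarrow> real \<Rightarrow> complex" where
  "hessV lam \<kappa> r f h x = of_real (- lam) * (of_real (2 * Re (cnj (f x) * h x)) * f x + of_real ((cmod (f x))\<^sup>2) * h x)
     + of_real (\<kappa> * sqn f powr (r - 1)) * h x
     + of_real (\<kappa> * (2 * r - 2) * sqn f powr (r - 2) * innerK L f h) * f x"

lemma gradV_continuous: "continuous_on UNIV f \<Longrightarrow> continuous_on UNIV (gradV lam \<kappa> r f)"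
  unfolding gradV_def [abs_def] by (intro continuous_intros)

lemma hessV_continuous: "continuous_on UNIV f \<Longrightarrow> continuous_on UNIV h \<Longrightarrow> continuous_on UNIV (hessV lam \<kappa> r f h)"
  unfolding hessV_def [abs_def] by (intro continuous_intros)

lemma innerK_gradV:
  assumes f: "continuous_on UNIV f" and h: "continuous_on UNIV h"
  shows "innerK L (gradV lam \<kappa> r f) h = 
    - lam * (LINT x|circ L. (cmod (f x))\<^sup>2 * Re (cnj (f x) * h x)) + \<kappa> * sqn f powr (r - 1) * innerK L f h"
proof -
  have i: "integrable (circ L) (\<lambda>x. (cmod (f x))\<^sup>2 * Re (cnj (f x) * h x))" "integrable (circ L) (\<lambda>x. Re (cnj (f x) * h x))"
    by (intro continuous_integrable continuous_intros f h)+
  have "innerK L (gradV lam \<kappa> r f) h = 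
     (LINT x|circ L. - lam * ((cmod (f x))\<^sup>2 * Re (cnj (f x) * h x)) + \<kappa> * sqn f powr (r - 1) * Re (cnj (f x) * h x))"
    unfolding innerK_integral[OF continuous_L2[OF gradV_continuous[OF f]] continuous_L2[OF h]]
    by (intro Bochner_Integration.integral_cong refl) (simp add: gradV_def algebra_simps)
  also have "\<dots> = - lam * (LINT x|circ L. (cmod (f x))\<^sup>2 * Re (cnj (f x) * h x))
      + \<kappa> * sqn f powr (r - 1) * (LINT x|circ L. Re (cnj (f x) * h x))"
    using i by (simp only: Bochner_Integration.integral_add integrable_mult_right integral_mult_right_zero)
  finally show ?thesis by (simp only: innerK_integral[OF continuous_L2[OF f] continuous_L2[OF h]])
qed

lemma cmod_square_line:
  "(cmod (a + t *\<^sub>R b))\<^sup>2 = (cmod a)\<^sup>2 + 2 * t * Re (cnj a * b) + t\<^sup>2 * (cmod b)\<^sup>2"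
  unfolding cmod_power2 by (simp add: power2_eq_square algebra_simps)

text \<open>Along a line the L4 term is a polynomial of degree 4 in \<open>t\<close> whose
  coefficients are integrals, so no differentiation under the integral sign occurs: the linear
  coefficient is the derivative at 0.\<close>

lemma is_gradK_V:
  assumes r: "1 < r"
  shows "is_gradK L (V L lam \<kappa> r) \<phi> (gradV lam \<kappa> r (apply_bcontfun \<phi>))"
proof -
  define f where "f = apply_bcontfun \<phi>"
  have f: "continuous_on UNIV f" unfolding f_def by (rule bcontfun_continuous)
  have "((\<lambda>t. V L lam \<kappa> r (\<phi> + t *\<^sub>R \<psi>)) has_real_derivative innerK L (gradV lam \<kappa> r f) (apply_bcontfun \<psi>)) (at 0)" for \<psi>
  proof -
    define h where "h = apply_bcontfun \<psi>"
    have h: "continuous_on UNIV h" unfolding h_def by (rule bcontfun_continuous)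
    define A B where "A x = (cmod (f x))\<^sup>2" and "B x = Re (cnj (f x) * h x)" for x
    define C where "C x = (cmod (h x))\<^sup>2" for x
    have cont: "continuous_on UNIV A" "continuous_on UNIV B" "continuous_on UNIV C"
      unfolding A_def [abs_def] B_def [abs_def] C_def [abs_def] by (intro continuous_intros f h)+
    have L4: "(Lnorm L 4 g) ^ 4 = (LINT x|circ L. ((cmod (g x))\<^sup>2)\<^sup>2)" for g
    proof -
      have "0 \<le> (LINT x|circ L. cmod (g x) powr 4)" by simp
      then have "(Lnorm L 4 g) ^ 4 = (LINT x|circ L. cmod (g x) powr 4)"
        unfolding Lnorm_def by (simp add: powr_powr flip: powr_numeral)
      also have "\<dots> = (LINT x|circ L. ((cmod (g x))\<^sup>2)\<^sup>2)"
        by (intro Bochner_Integration.integral_cong refl) (simp add: powr_numeral)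
      finally show ?thesis .
    qed
    have ap: "apply_bcontfun (\<phi> + t *\<^sub>R \<psi>) = (\<lambda>x. f x + t *\<^sub>R h x)" for t
      by (auto simp: f_def h_def plus_bcontfun.rep_eq scaleR_bcontfun.rep_eq)
    have i: "integrable (circ L) (\<lambda>x. (A x)\<^sup>2)" "integrable (circ L) (\<lambda>x. A x * B x)" 
       "integrable (circ L) (\<lambda>x. 4 * (B x)\<^sup>2 + 2 * A x * C x)" "integrable (circ L) (\<lambda>x. 4 * B x * C x)"
       "integrable (circ L) (\<lambda>x. (C x)\<^sup>2)"
      by (intro continuous_integrable continuous_intros cont)+
    have "(LINT x|circ L. ((cmod (f x + t *\<^sub>R h x))\<^sup>2)\<^sup>2) = 
       (LINT x|circ L. (A x)\<^sup>2 + (4 * t) * (A x * B x) + t^2 * (4 * (B x)\<^sup>2 + 2 * A x * C x) + t^3 * (4 * B x * C x) + t^4 * (C x)\<^sup>2)" for t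
      unfolding cmod_square_line A_def[symmetric] B_def[symmetric] C_def[symmetric]
      by (intro Bochner_Integration.integral_cong refl) algebra
    also have "\<dots> t = (LINT x|circ L. (A x)\<^sup>2) + (4 * t) * (LINT x|circ L. A x * B x) + t^2 * (LINT x|circ L. 4 * (B x)\<^sup>2 + 2 * A x * C x)
         + t^3 * (LINT x|circ L. 4 * B x * C x) + t^4 * (LINT x|circ L. (C x)\<^sup>2)" for t
      using i by (simp only: Bochner_Integration.integral_add Bochner_Integration.integrable_add integrable_mult_right integral_mult_right_zero)
    finally have q: "(LINT x|circ L. ((cmod (f x + t *\<^sub>R h x))\<^sup>2)\<^sup>2) = (LINT x|circ L. (A x)\<^sup>2) + (4 * t) * (LINT x|circ L. A x * B x) + t^2 * (LINT x|circ L. 4 * (B x)\<^sup>2 + 2 * A x * C x)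
         + t^3 * (LINT x|circ L. 4 * B x * C x) + t^4 * (LINT x|circ L. (C x)\<^sup>2)" for t .
    have "((\<lambda>t. (LINT x|circ L. ((cmod (f x + t *\<^sub>R h x))\<^sup>2)\<^sup>2)) has_real_derivative 4 * (LINT x|circ L. A x * B x)) (at 0)"
      unfolding q by (auto intro!: derivative_eq_intros)
    from DERIV_add[OF DERIV_cmult[OF this, of "- lam / 4"] 
       DERIV_cmult[OF sqn_powr_derivative[OF continuous_L2[OF f] continuous_L2[OF h] r], of "\<kappa> / (2 * r)"]]
    have "((\<lambda>t. V L lam \<kappa> r (\<phi> + t *\<^sub>R \<psi>)) has_real_derivative 
       - lam / 4 * (4 * (LINT x|circ L. A x * B x)) + \<kappa> / (2 * r) * (r * sqn f powr (r - 1) * (2 * innerK L f h))) (at 0)"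
      unfolding V_def L4 normK_powr ap .
    moreover have "- lam / 4 * (4 * (LINT x|circ L. A x * B x)) + \<kappa> / (2 * r) * (r * sqn f powr (r - 1) * (2 * innerK L f h))
       = innerK L (gradV lam \<kappa> r f) h"
      unfolding innerK_gradV[OF f h] A_def B_def using r by simp
    ultimately show ?thesis by (simp only: h_def)
  qed
  then show ?thesis unfolding is_gradK_def f_def
    using continuous_L2[OF gradV_continuous[OF bcontfun_continuous]] by auto
qed

lemma innerK_hessV:
  assumes f: "continuous_on UNIV f" and h: "continuous_on UNIV h" and g: "continuous_on UNIV g"
  shows "innerK L (hessV lam \<kappa> r f h) g = 
    - lam * (LINT x|circ L. 2 * Re (cnj (f x) * h x) * Re (cnj (f x) * g x) + (cmod (f x))\<^sup>2 * Re (cnj (h x) * g x)) 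
    + \<kappa> * sqn f powr (r - 1) * innerK L h g + \<kappa> * (2 * r - 2) * sqn f powr (r - 2) * innerK L f h * innerK L f g"
proof -
  let ?I = "\<lambda>x. 2 * Re (cnj (f x) * h x) * Re (cnj (f x) * g x) + (cmod (f x))\<^sup>2 * Re (cnj (h x) * g x)"
  have i: "integrable (circ L) ?I" "integrable (circ L) (\<lambda>x. Re (cnj (h x) * g x))" "integrable (circ L) (\<lambda>x. Re (cnj (f x) * g x))"
    by (intro continuous_integrable continuous_intros f h g)+
  have "innerK L (hessV lam \<kappa> r f h) g = 
     (LINT x|circ L. - lam * ?I x + \<kappa> * sqn f powr (r - 1) * Re (cnj (h x) * g x) 
        + \<kappa> * (2 * r - 2) * sqn f powr (r - 2) * innerK L f h * Re (cnj (f x) * g x))"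
    unfolding innerK_integral[OF continuous_L2[OF hessV_continuous[OF f h]] continuous_L2[OF g]]
    by (intro Bochner_Integration.integral_cong refl) (simp add: hessV_def algebra_simps)
  also have "\<dots> = - lam * (LINT x|circ L. ?I x) + \<kappa> * sqn f powr (r - 1) * (LINT x|circ L. Re (cnj (h x) * g x))
     + \<kappa> * (2 * r - 2) * sqn f powr (r - 2) * innerK L f h * (LINT x|circ L. Re (cnj (f x) * g x))"
    using i by (simp only: Bochner_Integration.integral_add Bochner_Integration.integrable_add integrable_mult_right integral_mult_right_zero)
  finally show ?thesis by (simp only: innerK_integral[OF continuous_L2[OF h] continuous_L2[OF g]] innerK_integral[OF continuous_L2[OF f] continuous_L2[OF g]])
qed

lemma innerK_commute: "innerK L f g = innerK L g f"
  unfolding innerK_def by (subst innerL2_commute) simp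

text \<open>The cubic part is again polynomial along lines. The condition \<open>2 < r\<close> makes
  the exponent \<open>r - 1\<close> of \<open>sqn\<close> exceed 1, so that the power is
  differentiable even where \<open>sqn\<close> vanishes.\<close>

lemma is_gradK_hess:
  assumes r: "2 < r"
  shows "is_gradK L (\<lambda>\<eta>. innerK L (gradK L (V L lam \<kappa> r) \<eta>) (apply_bcontfun \<psi>)) \<phi>
     (hessV lam \<kappa> r (apply_bcontfun \<phi>) (apply_bcontfun \<psi>))"
proof -
  define f where "f = apply_bcontfun \<phi>"
  have f: "continuous_on UNIV f" unfolding f_def by (rule bcontfun_continuous)
  define h where "h = apply_bcontfun \<psi>"
  have h: "continuous_on UNIV h" unfolding h_def by (rule bcontfun_continuous)
  have gr: "innerK L (gradK L (V L lam \<kappa> r) \<eta>) (apply_bcontfun \<psi>) = innerK L (gradV lam \<kappa> r (apply_bcontfun \<eta>)) h" for \<eta>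
    unfolding innerK_def h_def using r by (subst gradK_inner(2)[OF is_gradK_V continuous_L2[OF bcontfun_continuous]]) auto
  have "((\<lambda>t. innerK L (gradV lam \<kappa> r (apply_bcontfun (\<phi> + t *\<^sub>R \<xi>))) h) has_real_derivative 
    innerK L (hessV lam \<kappa> r f h) (apply_bcontfun \<xi>)) (at 0)" for \<xi>
  proof -
    define g where "g = apply_bcontfun \<xi>"
    have g: "continuous_on UNIV g" unfolding g_def by (rule bcontfun_continuous)
    have ap: "apply_bcontfun (\<phi> + t *\<^sub>R \<xi>) = (\<lambda>x. f x + t *\<^sub>R g x)" for t
      by (auto simp: f_def g_def plus_bcontfun.rep_eq scaleR_bcontfun.rep_eq)
    have fg: "continuous_on UNIV (\<lambda>x. f x + t *\<^sub>R g x)" for t by (intro continuous_intros f g)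
    define A B where "A x = (cmod (f x))\<^sup>2" and "B x = Re (cnj (f x) * g x)" for x
    define C D where "C x = (cmod (g x))\<^sup>2" and "D x = Re (cnj (f x) * h x)" for x
    define E where "E x = Re (cnj (g x) * h x)" for x
    have cont: "continuous_on UNIV A" "continuous_on UNIV B" "continuous_on UNIV C" "continuous_on UNIV D" "continuous_on UNIV E"
      unfolding A_def [abs_def] B_def [abs_def] C_def [abs_def] D_def [abs_def] E_def [abs_def] by (intro continuous_intros f h g)+
    have i: "integrable (circ L) (\<lambda>x. A x * D x)" "integrable (circ L) (\<lambda>x. 2 * D x * B x + A x * E x)" 
       "integrable (circ L) (\<lambda>x. 2 * B x * E x + C x * D x)" "integrable (circ L) (\<lambda>x. C x * E x)"
      by (intro continuous_integrable continuous_intros cont)+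
    have lin: "Re (cnj (f x + t *\<^sub>R g x) * h x) = D x + t * E x" for t x
      by (simp add: D_def E_def algebra_simps)
    have "(LINT x|circ L. (cmod (f x + t *\<^sub>R g x))\<^sup>2 * Re (cnj (f x + t *\<^sub>R g x) * h x)) = 
       (LINT x|circ L. A x * D x + t * (2 * D x * B x + A x * E x) + t^2 * (2 * B x * E x + C x * D x) + t^3 * (C x * E x))" for t
      unfolding cmod_square_line lin A_def[symmetric] B_def[symmetric] C_def[symmetric]
      by (intro Bochner_Integration.integral_cong refl) algebra
    also have "\<dots> t = (LINT x|circ L. A x * D x) + t * (LINT x|circ L. 2 * D x * B x + A x * E x)
        + t^2 * (LINT x|circ L. 2 * B x * E x + C x * D x) + t^3 * (LINT x|circ L. C x * E x)" for t
      using i by (simp only: Bochner_Integration.integral_add Bochner_Integration.integrable_add integrable_mult_right integral_mult_right_zero)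
    finally have q: "(LINT x|circ L. (cmod (f x + t *\<^sub>R g x))\<^sup>2 * Re (cnj (f x + t *\<^sub>R g x) * h x)) = 
        (LINT x|circ L. A x * D x) + t * (LINT x|circ L. 2 * D x * B x + A x * E x)
        + t^2 * (LINT x|circ L. 2 * B x * E x + C x * D x) + t^3 * (LINT x|circ L. C x * E x)" for t .
    have d1: "((\<lambda>t. (LINT x|circ L. (cmod (f x + t *\<^sub>R g x))\<^sup>2 * Re (cnj (f x + t *\<^sub>R g x) * h x))) has_real_derivative
        (LINT x|circ L. 2 * D x * B x + A x * E x)) (at 0)"
      unfolding q by (auto intro!: derivative_eq_intros)
    have "innerK L (\<lambda>x. f x + t *\<^sub>R g x) h = innerK L f h + t * innerK L g h" for t
      using innerL2_add_left[OF continuous_L2[OF h] continuous_L2[OF f] L2_scale[OF continuous_L2[OF g], of "of_real t"]]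
      by (simp add: innerK_def scaleR_conv_of_real innerL2_scale_left)
    then have d2: "((\<lambda>t. innerK L (\<lambda>x. f x + t *\<^sub>R g x) h) has_real_derivative innerK L g h) (at 0)"
      by (auto intro!: derivative_eq_intros)
    have r': "1 < r - 1" using r by simp
    note d3 = sqn_powr_derivative[OF continuous_L2[OF f] continuous_L2[OF g] r']
    from DERIV_add[OF DERIV_cmult[OF d1, of "- lam"] DERIV_mult[OF DERIV_cmult[OF d3, of \<kappa>] d2]]
    have "((\<lambda>t. innerK L (gradV lam \<kappa> r (apply_bcontfun (\<phi> + t *\<^sub>R \<xi>))) h) has_real_derivative 
       - lam * (LINT x|circ L. 2 * D x * B x + A x * E x)
       + (\<kappa> * ((r - 1) * sqn f powr (r - 1 - 1) * (2 * innerK L f g)) * innerK L f h + innerK L g h * (\<kappa> * sqn f powr (r - 1)))) (at 0)"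
      unfolding ap innerK_gradV[OF fg h] by simp
    moreover have "- lam * (LINT x|circ L. 2 * D x * B x + A x * E x)
       + (\<kappa> * ((r - 1) * sqn f powr (r - 1 - 1) * (2 * innerK L f g)) * innerK L f h + innerK L g h * (\<kappa> * sqn f powr (r - 1)))
       = innerK L (hessV lam \<kappa> r f h) g"
    proof -
      have E: "E x = Re (cnj (h x) * g x)" for x by (simp add: E_def algebra_simps)
      show ?thesis
        unfolding innerK_hessV[OF f h g] A_def B_def D_def E innerK_commute[of g h] by (simp add: algebra_simps)
    qed
    ultimately show ?thesis by (simp only: g_def)
  qed
  then show ?thesis unfolding is_gradK_def gr unfolding f_def h_def
    using continuous_L2[OF hessV_continuous[OF bcontfun_continuous bcontfun_continuous]] by auto
qed

end

section \<open>The spectral hypotheses and a formula for U\<close>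

text \<open>The integers split into two copies of the naturals. A negative \<open>k\<close>
  corresponds to \<open>n = - k - 1\<close>, whence the shifted series
  \<open>g (Suc n)\<close>.\<close>

lemma int_summable_comparison:
  fixes a :: "int \<Rightarrow> real" and g :: "nat \<Rightarrow> real"
  assumes g: "summable g" "\<And>n. 0 \<le> g n" and a: "\<And>k. 0 \<le> a k" "\<And>k. a k \<le> g (nat \<bar>k\<bar>)"
  shows "a summable_on UNIV"
proof -
  have b1: "bij_betw int UNIV {0..}"
    by (auto simp: bij_betw_def inj_on_def image_iff) (metis nonneg_int_cases)
  have b2: "bij_betw (\<lambda>n. - int n - 1) UNIV {..<0}"
    by (rule bij_betw_byWitness[where f'="\<lambda>k. nat (- k - 1)"]) auto
  have "(\<lambda>k. g (nat \<bar>k\<bar>)) summable_on {0..}"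
    using g by (subst summable_on_reindex_bij_betw[OF b1, symmetric]) (simp add: summable_on_UNIV_nonneg_real_iff)
  moreover have "summable (\<lambda>n. g (Suc n))" using g(1) by (simp add: summable_Suc_iff)
  then have "(\<lambda>k. g (nat \<bar>k\<bar>)) summable_on {..<0}"
    using g(2) by (subst summable_on_reindex_bij_betw[OF b2, symmetric])
      (simp add: summable_on_UNIV_nonneg_real_iff nat_add_distrib add.commute)
  ultimately have "(\<lambda>k. g (nat \<bar>k\<bar>)) summable_on ({0..} \<union> {..<0})"
    by (rule summable_on_Un_disjoint) auto
  moreover have "{0..} \<union> {..<0} = (UNIV :: int set)" by auto
  ultimately show ?thesis using a by (auto intro: summable_on_comparison_test)
qed

locale circle_model = circle +
  fixes m \<beta> s \<gamma> :: real
  assumes m_pos: "0 < m" and \<beta>_pos: "0 < \<beta>" and \<gamma>_less: "\<gamma> < 1 / 8"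
    and lower: "lap_op_le L (\<lambda>_. 1) (sigma2_Cinv_sym \<beta> m s)"
    and upper: "lap_op_le L (sigma2_Cinv_sym \<beta> m s) (\<lambda>t. (t + m\<^sup>2) powr \<gamma>)"
begin

section \<open>Eigenvalues of the operators and their summability\<close>

definition p :: "int \<Rightarrow> real" where
  "p k = lap_eig L k + m\<^sup>2"

definition om :: "int \<Rightarrow> real" where
  "om k = sigma2_Cinv_sym \<beta> m s (lap_eig L k)"

definition sg :: "int \<Rightarrow> real" where
  "sg k = sigma_sym \<beta> m s (lap_eig L k)"

lemma p_ge: "m\<^sup>2 \<le> p k"
  by (simp add: p_def lap_eig_def)

lemma p_pos: "0 < p k"
  using p_ge[of k] m_pos by (smt (verit) zero_less_power)

lemma theta_p: "theta L m \<beta> k = \<beta> * p k"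
  by (simp add: theta_def p_def lap_eig_def)

lemma om_sg: "om k = (sg k)\<^sup>2 * (\<beta> * p k)"
  by (simp add: om_def sg_def sigma2_Cinv_sym_def C_sym_def p_def add.commute)

lemma om_ge_1: "1 \<le> om k"
  using lap_op_leD[OF lower, of k] p_pos[of k] \<beta>_pos om_sg[of k] by (simp add: om_def)

lemma om_le: "om k \<le> p k powr \<gamma>"
  using lap_op_leD[OF upper, of k] om_ge_1[of k] by (simp add: om_def p_def)

text \<open>Passing to a higher power costs a constant, because \<open>p k\<close> is bounded below
  by \<open>m\<^sup>2\<close> but possibly not by 1.\<close>

lemma p_powr_le:
  assumes "a \<le> b" shows "p k powr a \<le> (m\<^sup>2) powr (a - b) * p k powr b"
proof -
  have "p k powr a = p k powr (a - b) * p k powr b" by (simp flip: powr_add)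
  also have "p k powr (a - b) \<le> (m\<^sup>2) powr (a - b)"
    using assms p_ge[of k] m_pos by (intro powr_mono2') auto
  finally show ?thesis by (simp add: mult_right_mono)
qed

lemma p_powr_summable:
  assumes "a \<le> - 9/16" shows "(\<lambda>k. p k powr a) summable_on UNIV"
proof -
  let ?K = "(2 * pi / L)\<^sup>2"
  \<comment> \<open>\<open>p k\<close> dominates a multiple of the square of \<open>k\<close>, so
    -9/16 becomes -9/8. The index 0 is separate because \<open>0 powr (-9/8)\<close> evaluates to 0
    and would not be an upper bound.\<close>
  let ?g = "\<lambda>n. if n = 0 then p 0 powr (-9/16) else ?K powr (-9/16) * real n powr (-9/8)"
  have K: "0 < ?K" using L_pos by simp
  have "(\<lambda>k. p k powr (-9/16)) summable_on UNIV"
  proof (rule int_summable_comparison)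
    have "summable (\<lambda>n. ?K powr (-9/16) * real n powr (-9/8))"
      by (intro summable_mult) (simp add: summable_real_powr_iff)
    moreover have "eventually (\<lambda>n. ?g n = ?K powr (-9/16) * real n powr (-9/8)) sequentially"
      using eventually_gt_at_top[of 0] by eventually_elim simp
    ultimately show "summable ?g" by (subst summable_cong)
    show "p k powr (-9/16) \<le> ?g (nat \<bar>k\<bar>)" for k
    proof (cases "k = 0")
      case False
      have "?K * (real (nat \<bar>k\<bar>))\<^sup>2 \<le> p k"
        by (simp add: p_def lap_eig_def power_mult_distrib power_divide)
      then have "p k powr (-9/16) \<le> (?K * (real (nat \<bar>k\<bar>))\<^sup>2) powr (-9/16)"
        using K False by (intro powr_mono2') auto
      also have "\<dots> = ?K powr (-9/16) * ((real (nat \<bar>k\<bar>))\<^sup>2) powr (-9/16)"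
        by (rule powr_mult)
      also have "((real (nat \<bar>k\<bar>))\<^sup>2) powr (-9/16) = real (nat \<bar>k\<bar>) powr (-9/8)"
      proof -
        have "(real (nat \<bar>k\<bar>))\<^sup>2 = real (nat \<bar>k\<bar>) powr 2" using False by (subst powr_numeral) auto
        then show ?thesis by (simp only: powr_powr) simp
      qed
      finally show ?thesis using False by simp
    qed simp
  qed auto
  then have "(\<lambda>k. (m\<^sup>2) powr (a - -9/16) * p k powr (-9/16)) summable_on UNIV"
    by (rule summable_on_cmult_right)
  then show ?thesis
    by (rule summable_on_comparison_test) (use p_powr_le[of a "-9/16"] assms in auto)
qed

text \<open>Dividing the symbol of \<open>\<sigma>\<^sup>2C\<^sup>-\<^sup>1\<close> by that of
  \<open>C\<^sup>-\<^sup>1\<close> gains a factor \<open>1 / p k\<close> over the upper hypothesis.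
  As \<open>\<gamma> - 1\<close> is below -7/8, this makes \<open>\<sigma>\<^sup>2\<close> trace
  class.\<close>

lemma sg_square_le: "(sg k)\<^sup>2 \<le> p k powr (\<gamma> - 1) / \<beta>"
proof -
  have "(sg k)\<^sup>2 = om k / (\<beta> * p k)" using om_sg[of k] p_pos[of k] \<beta>_pos by simp
  also have "\<dots> \<le> p k powr \<gamma> / (\<beta> * p k)"
    using om_le[of k] p_pos[of k] \<beta>_pos by (intro divide_right_mono) (auto simp: less_imp_le)
  finally show ?thesis using p_pos[of k] by (simp add: powr_diff mult.commute)
qed

lemma sg_square_summable: "(\<lambda>k. (sg k)\<^sup>2) summable_on UNIV"
proof (rule summable_on_comparison_test)
  show "(\<lambda>k. p k powr (\<gamma> - 1) * inverse \<beta>) summable_on UNIV"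
    using \<gamma>_less by (intro summable_on_cmult_left p_powr_summable) simp
qed (use sg_square_le in \<open>auto simp: divide_inverse\<close>)

text \<open>The trace of \<open>\<sigma>\<^sup>2\<close> over the complex Hilbert space, hence half
  of its trace over the real one: each mode carries two real directions.\<close>

definition trsg :: real where
  "trsg = (\<Sum>\<^sub>\<infinity>k. (sg k)\<^sup>2)"

lemma trsg_nonneg: "0 \<le> trsg"
  unfolding trsg_def by (rule infsum_nonneg) simp

lemma sg_square_le_trsg: "(sg k)\<^sup>2 \<le> trsg"
  unfolding trsg_def using finite_sum_le_infsum[OF sg_square_summable, of "{k}"] by simp

section \<open>The trace term and the lower bound for \<open>U\<close>\<close>

lemma sigma_dom:
  assumes "f \<in> L2 L"
  shows "f \<in> lap_dom L (sigma_sym \<beta> m s)" "f \<in> lap_dom L (\<lambda>t. (sigma_sym \<beta> m s t)\<^sup>2)"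
proof -
  show "f \<in> lap_dom L (\<lambda>t. (sigma_sym \<beta> m s t)\<^sup>2)"
    by (rule lap_dom_bounded[OF assms, where B=trsg]) (use sg_square_le_trsg in \<open>simp add: sg_def\<close>)
  have "\<bar>sg k\<bar> \<le> sqrt trsg" for k using real_le_rsqrt[of "\<bar>sg k\<bar>"] sg_square_le_trsg[of k] by simp
  then show "f \<in> lap_dom L (sigma_sym \<beta> m s)"
    by (intro lap_dom_bounded[OF assms, where B="sqrt trsg"]) (simp add: sg_def)
qed

text \<open>Since \<open>\<sigma>\<^sup>2\<close> is diagonal, a basis vector sees only
  \<open>(sg k)\<^sup>2\<close> times the Hessian form in its own direction. The two directions of a
  mode are added because together they turn squared real parts into squared moduli.\<close>

lemma trace_hess:
  fixes \<phi> :: "real \<Rightarrow>\<^sub>C complex"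
  assumes r: "2 < r"
  defines "f \<equiv> apply_bcontfun \<phi>"
  shows "traceK L (\<lambda>\<psi>. lap_op L (\<lambda>t. (sigma_sym \<beta> m s t)\<^sup>2) (hessK L (V L lam \<kappa> r) \<phi> \<psi>)) = 
   (\<Sum>\<^sub>\<infinity>k. (sg k)\<^sup>2 * (- 4 * lam / L * sqn f + 2 * \<kappa> * sqn f powr (r - 1) + \<kappa> * (2 * r - 2) * sqn f powr (r - 2) * (cmod (fcoeff L k f))\<^sup>2))"
proof -
  have f: "continuous_on UNIV f" unfolding f_def by (rule bcontfun_continuous)
  note fL = continuous_L2[OF f]
  define e where "e k z = (\<lambda>x. z * expo L k x)" for k z
  have ec: "continuous_on UNIV (e k z)" for k z unfolding e_def by (intro continuous_intros expo_continuous)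
  have eL: "e k z \<in> L2 L" for k z by (rule continuous_L2[OF ec])
  define J where "J k z = (LINT x|circ L. 2 * Re (cnj (f x) * e k z x) * Re (cnj (f x) * e k z x) + (cmod (f x))\<^sup>2 * Re (cnj (e k z x) * e k z x))" for k z
  define Q where "Q k z = - lam * J k z + \<kappa> * sqn f powr (r - 1) + \<kappa> * (2 * r - 2) * sqn f powr (r - 2) * (innerK L f (e k z))\<^sup>2" for k z
  have basis_term: "innerK L (apply_bcontfun (basisK L k z)) (lap_op L (\<lambda>t. (sigma_sym \<beta> m s t)\<^sup>2) (hessK L (V L lam \<kappa> r) \<phi> (basisK L k z)))
     = (sg k)\<^sup>2 * Q k z" if z: "cmod z = 1" for k z
  proof -
    let ?g = "hessK L (V L lam \<kappa> r) \<phi> (basisK L k z)"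
    note gr = is_gradK_hess[OF r, of lam \<kappa> "basisK L k z" \<phi>]
    have gL: "?g \<in> L2 L" unfolding hessK_def by (rule gradK_unique(1)[OF gr])
    have "fcoeff L k ?g = fcoeff L k (hessV lam \<kappa> r f (e k z))"
      unfolding hessK_def using gradK_fcoeff[OF gr] by (simp add: f_def e_def apply_basisK)
    then have "innerL2 L (e k z) (lap_op L (\<lambda>t. (sigma_sym \<beta> m s t)\<^sup>2) ?g) = 
       of_real ((sg k)\<^sup>2) * innerL2 L (e k z) (hessV lam \<kappa> r f (e k z))"
      using lap_opD(2)[OF sigma_dom(2)[OF gL], of k] unfolding e_def innerL2_scale_left
      by (simp add: fcoeff_def sg_def e_def)
    from arg_cong[where f=Re, OF this] have "innerK L (e k z) (lap_op L (\<lambda>t. (sigma_sym \<beta> m s t)\<^sup>2) ?g) = (sg k)\<^sup>2 * innerK L (e k z) (hessV lam \<kappa> r f (e k z))"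
      by (simp add: innerK_def del: of_real_power)
    also have "innerK L (e k z) (hessV lam \<kappa> r f (e k z)) = Q k z"
    proof -
      have "innerK L (e k z) (e k z) = 1"
        using z sqn_basis[of z k] sqn_eq_inner[of "e k z"] by (simp add: innerK_def e_def)
      then show ?thesis
        unfolding innerK_commute[of "e k z" "hessV lam \<kappa> r f (e k z)"] innerK_hessV[OF f ec ec]
        by (simp add: Q_def J_def power2_eq_square)
    qed
    finally show ?thesis by (simp add: e_def apply_basisK)
  qed
  have inn: "(innerK L f (e k 1))\<^sup>2 + (innerK L f (e k \<i>))\<^sup>2 = (cmod (fcoeff L k f))\<^sup>2" for k
  proof -
    have "(cmod (fcoeff L k f))\<^sup>2 = (cmod (innerL2 L f (expo L k)))\<^sup>2"
      unfolding fcoeff_def by (subst innerL2_commute) simp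
    then show ?thesis by (simp add: innerK_def e_def innerL2_scale_right cmod_power2)
  qed
  have Jint: "integrable (circ L) (\<lambda>x. 2 * Re (cnj (f x) * e k z x) * Re (cnj (f x) * e k z x) + (cmod (f x))\<^sup>2 * Re (cnj (e k z x) * e k z x))" for k z
    by (intro continuous_integrable continuous_intros f ec)
  have Jnn: "0 \<le> J k z" for k z
  proof -
    have "0 \<le> 2 * a * a + b\<^sup>2 * Re (cnj w * w)" for a b :: real and w
    proof -
      have "0 \<le> 2 * (a * a)" "0 \<le> b\<^sup>2 * Re (cnj w * w)" by simp_all
      then show ?thesis by (simp only: mult.assoc add_nonneg_nonneg)
    qed
    then show ?thesis unfolding J_def by (intro Bochner_Integration.integral_nonneg)
  qed
  \<comment> \<open>With squared modulus \<open>1 / L\<close> for the exponential, the squared real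
    parts give 2 and the two remaining terms give 1 each, all in units of
    \<open>sqn f / L\<close>.\<close>
  have Jsum: "J k 1 + J k \<i> = 4 / L * sqn f" for k
  proof -
    have "J k 1 + J k \<i> = (LINT x|circ L. 4 / L * (cmod (f x))\<^sup>2)"
      unfolding J_def Bochner_Integration.integral_add[OF Jint Jint, symmetric]
    proof (intro Bochner_Integration.integral_cong refl)
      fix x
      have n: "(cmod (expo L k x))\<^sup>2 = 1 / L" using L_pos by (simp add: norm_expo power_divide)
      define u where "u = expo L k x"
      have "Re (cnj (f x) * u) * Re (cnj (f x) * u) + Re (cnj (f x) * (\<i> * u)) * Re (cnj (f x) * (\<i> * u)) = (cmod (f x))\<^sup>2 * (cmod u)\<^sup>2"
        unfolding cmod_power2 by (simp add: power2_eq_square algebra_simps)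
      moreover have "Re (cnj u * u) = (cmod u)\<^sup>2" "Re (cnj (\<i> * u) * (\<i> * u)) = (cmod u)\<^sup>2"
        unfolding cmod_power2 by (simp_all add: power2_eq_square algebra_simps)
      ultimately show "2 * Re (cnj (f x) * e k 1 x) * Re (cnj (f x) * e k 1 x) + (cmod (f x))\<^sup>2 * Re (cnj (e k 1 x) * e k 1 x) +
         (2 * Re (cnj (f x) * e k \<i> x) * Re (cnj (f x) * e k \<i> x) + (cmod (f x))\<^sup>2 * Re (cnj (e k \<i> x) * e k \<i> x)) = 4 / L * (cmod (f x))\<^sup>2"
        unfolding e_def u_def[symmetric] mult_1_left using n[folded u_def] by (simp only: mult.assoc distrib_left[symmetric]) (simp add: algebra_simps)
    qed
    then show ?thesis by (simp add: sqn_def)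
  qed
  have Qsum: "Q k 1 + Q k \<i> = - 4 * lam / L * sqn f + 2 * \<kappa> * sqn f powr (r - 1) + \<kappa> * (2 * r - 2) * sqn f powr (r - 2) * (cmod (fcoeff L k f))\<^sup>2" for k
  proof -
    have "Q k 1 + Q k \<i> = - lam * (J k 1 + J k \<i>) + 2 * \<kappa> * sqn f powr (r - 1)
       + \<kappa> * (2 * r - 2) * sqn f powr (r - 2) * ((innerK L f (e k 1))\<^sup>2 + (innerK L f (e k \<i>))\<^sup>2)"
      by (simp add: Q_def algebra_simps)
    then show ?thesis unfolding Jsum inn by simp
  qed
  have bes: "(cmod (fcoeff L k f))\<^sup>2 \<le> sqn f" for k
    using bessel[of "{k}", OF _ fL] by simp
  \<comment> \<open>A bound on \<open>Q\<close> uniform in \<open>k\<close>, so that summability of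
    \<open>(sg k)\<^sup>2\<close> carries over and the sum over pairs can be split.\<close>
  define B where "B = \<bar>lam\<bar> * (4 / L * sqn f) + \<bar>\<kappa>\<bar> * sqn f powr (r - 1) + \<bar>\<kappa>\<bar> * \<bar>2 * r - 2\<bar> * sqn f powr (r - 2) * sqn f"
  have QB: "\<bar>Q k z\<bar> \<le> B" if z: "z = 1 \<or> z = \<i>" for k z
  proof -
    have "J k z \<le> 4 / L * sqn f" using Jnn[of k 1] Jnn[of k \<i>] Jsum[of k] z by auto
    then have "\<bar>lam\<bar> * \<bar>J k z\<bar> \<le> \<bar>lam\<bar> * (4 / L * sqn f)" using Jnn[of k z] by (intro mult_left_mono) auto
    moreover have "(innerK L f (e k z))\<^sup>2 \<le> sqn f"
      using inn[of k] bes[of k] z by (smt (verit) zero_le_power2)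
    then have "\<bar>\<kappa>\<bar> * \<bar>2 * r - 2\<bar> * sqn f powr (r - 2) * (innerK L f (e k z))\<^sup>2 \<le> \<bar>\<kappa>\<bar> * \<bar>2 * r - 2\<bar> * sqn f powr (r - 2) * sqn f"
      by (intro mult_left_mono) auto
    moreover have "\<bar>Q k z\<bar> \<le> \<bar>- lam * J k z\<bar> + \<bar>\<kappa> * sqn f powr (r - 1)\<bar> + \<bar>\<kappa> * (2 * r - 2) * sqn f powr (r - 2) * (innerK L f (e k z))\<^sup>2\<bar>"
      unfolding Q_def by linarith
    ultimately show ?thesis by (simp add: B_def abs_mult)
  qed
  have sQ: "(\<lambda>k. (sg k)\<^sup>2 * Q k z) summable_on UNIV" if z: "z = 1 \<or> z = \<i>" for z
  proof (rule abs_summable_summable, rule summable_on_comparison_test)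
    show "(\<lambda>k. (sg k)\<^sup>2 * B) summable_on UNIV" by (intro summable_on_cmult_left sg_square_summable)
    show "norm ((sg k)\<^sup>2 * Q k z) \<le> (sg k)\<^sup>2 * B" for k
      using QB[OF z, of k] by (simp add: abs_mult mult_left_mono)
  qed auto
  let ?F = "\<lambda>(k, z). (sg k)\<^sup>2 * Q k z"
  have hs: "(?F has_sum (\<Sum>\<^sub>\<infinity>k. (sg k)\<^sup>2 * Q k z)) (UNIV \<times> {z})" if z: "z = 1 \<or> z = \<i>" for z
  proof -
    have b: "bij_betw (\<lambda>k. (k, z)) UNIV (UNIV \<times> {z})" by (auto simp: bij_betw_def inj_on_def)
    show ?thesis
      using has_sum_infsum[OF sQ[OF z]] has_sum_reindex_bij_betw[OF b, of ?F] by simp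
  qed
  have "(?F has_sum ((\<Sum>\<^sub>\<infinity>k. (sg k)\<^sup>2 * Q k 1) + (\<Sum>\<^sub>\<infinity>k. (sg k)\<^sup>2 * Q k \<i>))) (UNIV \<times> {1} \<union> UNIV \<times> {\<i>})"
    by (intro has_sum_Un_disjoint hs) (auto simp: complex_eq_iff)
  moreover have "UNIV \<times> {1} \<union> UNIV \<times> {\<i>} = (UNIV :: int set) \<times> {1, \<i>}" by auto
  ultimately have "(?F has_sum ((\<Sum>\<^sub>\<infinity>k. (sg k)\<^sup>2 * Q k 1) + (\<Sum>\<^sub>\<infinity>k. (sg k)\<^sup>2 * Q k \<i>))) (UNIV \<times> {1, \<i>})"
    by (simp only:)
  from infsumI[OF this] have "infsum ?F ((UNIV :: int set) \<times> {1, \<i>}) = (\<Sum>\<^sub>\<infinity>k. (sg k)\<^sup>2 * Q k 1) + (\<Sum>\<^sub>\<infinity>k. (sg k)\<^sup>2 * Q k \<i>)" .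
  also have "\<dots> = (\<Sum>\<^sub>\<infinity>k. (sg k)\<^sup>2 * Q k 1 + (sg k)\<^sup>2 * Q k \<i>)"
    by (intro infsum_add[symmetric] sQ) auto
  also have "\<dots> = (\<Sum>\<^sub>\<infinity>k. (sg k)\<^sup>2 * (- 4 * lam / L * sqn f + 2 * \<kappa> * sqn f powr (r - 1) + \<kappa> * (2 * r - 2) * sqn f powr (r - 2) * (cmod (fcoeff L k f))\<^sup>2))"
    by (simp only: distrib_left[symmetric] Qsum)
  also have "infsum ?F ((UNIV :: int set) \<times> {1, \<i>}) = traceK L (\<lambda>\<psi>. lap_op L (\<lambda>t. (sigma_sym \<beta> m s t)\<^sup>2) (hessK L (V L lam \<kappa> r) \<phi> \<psi>))"
    unfolding traceK_def by (rule infsum_cong) (auto simp: basis_term)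
  finally show ?thesis .
qed

text \<open>\<open>W\<close> is the squared norm of \<open>\<sigma>f\<close>. It arises from the
  rank-one part of the Hessian of the L2 term of \<open>V\<close>.\<close>

lemma trace_formula:
  fixes \<kappa> r :: real
  assumes f: "f \<in> L2 L"
  defines "W \<equiv> \<Sum>\<^sub>\<infinity>k. (sg k)\<^sup>2 * (cmod (fcoeff L k f))\<^sup>2"
  shows "(\<Sum>\<^sub>\<infinity>k. (sg k)\<^sup>2 * (a + b * (cmod (fcoeff L k f))\<^sup>2)) = trsg * a + W * b"
    and "(\<lambda>k. (sg k)\<^sup>2 * (cmod (fcoeff L k f))\<^sup>2) summable_on UNIV"
    and "0 \<le> W" and "W \<le> trsg * sqn f"
proof -
  have bd: "(sg k)\<^sup>2 * (cmod (fcoeff L k f))\<^sup>2 \<le> trsg * (cmod (fcoeff L k f))\<^sup>2" for k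
    by (intro mult_right_mono sg_square_le_trsg) simp
  have hp: "((\<lambda>k. trsg * (cmod (fcoeff L k f))\<^sup>2) has_sum (trsg * sqn f)) UNIV"
    by (intro has_sum_cmult_right parseval f)
  show sm: "(\<lambda>k. (sg k)\<^sup>2 * (cmod (fcoeff L k f))\<^sup>2) summable_on UNIV"
    by (rule summable_on_comparison_test[OF has_sum_imp_summable[OF hp]]) (use bd in auto)
  show "0 \<le> W" unfolding W_def by (rule infsum_nonneg) simp
  show "W \<le> trsg * sqn f"
    unfolding W_def using has_sum_mono[OF has_sum_infsum[OF sm] hp] bd by simp
  have "((\<lambda>k. (sg k)\<^sup>2 * a + (sg k)\<^sup>2 * (cmod (fcoeff L k f))\<^sup>2 * b) has_sum (trsg * a + W * b)) UNIV"
    unfolding trsg_def W_def by (intro has_sum_add has_sum_cmult_left has_sum_infsum sg_square_summable sm)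
  then show "(\<Sum>\<^sub>\<infinity>k. (sg k)\<^sup>2 * (a + b * (cmod (fcoeff L k f))\<^sup>2)) = trsg * a + W * b"
    by (intro infsumI) (simp add: algebra_simps)
qed

text \<open>The formula is stated for every \<phi>, in the domain of
  \<open>\<sigma>\<^sup>2C\<^sup>-\<^sup>1\<close> or not, because measurability of \<open>U\<close>
  is read off from it.\<close>

lemma U_formula:
  fixes \<phi> :: "real \<Rightarrow>\<^sub>C complex"
  assumes r: "2 < r"
  defines "f \<equiv> apply_bcontfun \<phi>"
  shows "U L m \<beta> lam \<kappa> r s \<phi> = 
     \<beta> / 2 * (- (trsg * (- 4 * lam / L * sqn f + 2 * \<kappa> * sqn f powr (r - 1)) 
         + (\<Sum>\<^sub>\<infinity>k. (sg k)\<^sup>2 * (cmod (fcoeff L k f))\<^sup>2) * (\<kappa> * (2 * r - 2) * sqn f powr (r - 2)))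
       + innerK L (lap_op L (sigma2_Cinv_sym \<beta> m s) f) (gradV lam \<kappa> r f))
     + \<beta>\<^sup>2 / 4 * (\<Sum>\<^sub>\<infinity>k. (sg k)\<^sup>2 * (cmod (fcoeff L k (gradV lam \<kappa> r f)))\<^sup>2)"
proof -
  have f: "continuous_on UNIV f" unfolding f_def by (rule bcontfun_continuous)
  note fL = continuous_L2[OF f]
  have r1: "1 < r" using r by simp
  note gr = is_gradK_V[OF r1, of lam \<kappa> \<phi>, folded f_def]
  \<comment> \<open>Outside its domain the operator returns 0, which lies in L2 as well.\<close>
  have lopL: "lap_op L (sigma2_Cinv_sym \<beta> m s) f \<in> L2 L"
    using lap_opD(1) L2_const[of 0] by (cases "f \<in> lap_dom L (sigma2_Cinv_sym \<beta> m s)") (auto simp: lap_op_def)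
  have "(normK L (lap_op L (sigma_sym \<beta> m s) (gradK L (V L lam \<kappa> r) \<phi>)))\<^sup>2 = 
     (\<Sum>\<^sub>\<infinity>k. (sg k)\<^sup>2 * (cmod (fcoeff L k (gradV lam \<kappa> r f)))\<^sup>2)"
    unfolding normK_square lap_opD(3)[OF sigma_dom(1)[OF gradK_unique(1)[OF gr]]] gradK_fcoeff[OF gr]
    by (simp add: norm_mult power_mult_distrib sg_def)
  moreover have "innerK L (lap_op L (sigma2_Cinv_sym \<beta> m s) f) (gradK L (V L lam \<kappa> r) \<phi>) 
    = innerK L (lap_op L (sigma2_Cinv_sym \<beta> m s) f) (gradV lam \<kappa> r f)"
    unfolding innerK_def gradK_inner(1)[OF gr lopL] ..
  ultimately show ?thesis
    unfolding U_def H0_def trace_hess[OF r] f_def[symmetric] trace_formula(1)[OF fL] by (simp only:)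
qed

text \<open>The lower hypothesis makes all \<open>om k\<close> at least 1, so the pairing of
  \<open>\<sigma>\<^sup>2C\<^sup>-\<^sup>1f\<close> with \<open>f\<close> is at least
  \<open>sqn f\<close>; this yields \<open>\<kappa> * sqn f powr r\<close>. In the trace the quartic
  part has the favourable sign and is dropped, and the other parts contribute the factors 2 and
  \<open>2 * r - 2\<close>, which add up to \<open>2 * r\<close>.\<close>

lemma U_lower_bound:
  fixes \<phi> :: "real \<Rightarrow>\<^sub>C complex"
  assumes r: "2 < r" and lam: "0 < lam" and \<kappa>: "0 < \<kappa>"
  defines "f \<equiv> apply_bcontfun \<phi>"
  assumes dom: "f \<in> lap_dom L (sigma2_Cinv_sym \<beta> m s)"
  shows "\<beta> / 2 * (\<kappa> * sqn f powr r - 2 * r * \<kappa> * trsg * sqn f powr (r - 1) 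
      - lam * cmod (innerL2 L (lap_op L (sigma2_Cinv_sym \<beta> m s) f) (\<lambda>x. of_real ((cmod (f x))\<^sup>2) * f x)))
    \<le> U L m \<beta> lam \<kappa> r s \<phi>"
proof -
  have f: "continuous_on UNIV f" unfolding f_def by (rule bcontfun_continuous)
  note fL = continuous_L2[OF f]
  define g where "g = lap_op L (sigma2_Cinv_sym \<beta> m s) f"
  have gL: "g \<in> L2 L" unfolding g_def by (rule lap_opD(1)[OF dom])
  have gk: "fcoeff L k g = of_real (om k) * fcoeff L k f" for k
    unfolding g_def om_def by (rule lap_opD(2)[OF dom])
  let ?c = "\<lambda>x. of_real ((cmod (f x))\<^sup>2) * f x"
  have cL: "?c \<in> L2 L" by (intro continuous_L2 continuous_intros f)
  define W where "W = (\<Sum>\<^sub>\<infinity>k. (sg k)\<^sup>2 * (cmod (fcoeff L k f))\<^sup>2)"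
  have gr: "gradV lam \<kappa> r f = (\<lambda>x. of_real (- lam) * ?c x + of_real (\<kappa> * sqn f powr (r - 1)) * f x)"
    by (auto simp: gradV_def fun_eq_iff algebra_simps)
  have "innerL2 L g (gradV lam \<kappa> r f) = of_real (- lam) * innerL2 L g ?c + of_real (\<kappa> * sqn f powr (r - 1)) * innerL2 L g f"
    unfolding gr innerL2_add_right[OF gL L2_scale[OF cL] L2_scale[OF fL]] innerL2_scale_right ..
  then have ig: "innerK L g (gradV lam \<kappa> r f) = - lam * Re (innerL2 L g ?c) + \<kappa> * sqn f powr (r - 1) * innerK L g f"
    by (simp add: innerK_def)
  have "sqn f \<le> innerK L g f"
  proof (rule has_sum_mono[OF parseval[OF fL] parseval_inner[OF gL fL]])
    fix k
    have "Re (cnj (fcoeff L k g) * fcoeff L k f) = om k * (cmod (fcoeff L k f))\<^sup>2"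
      unfolding gk cmod_power2 by (simp add: power2_eq_square algebra_simps)
    then show "(cmod (fcoeff L k f))\<^sup>2 \<le> Re (cnj (fcoeff L k g) * fcoeff L k f)"
      using mult_right_mono[OF om_ge_1[of k], of "(cmod (fcoeff L k f))\<^sup>2"] by simp
  qed
  then have "\<kappa> * sqn f powr (r - 1) * sqn f \<le> \<kappa> * sqn f powr (r - 1) * innerK L g f"
    using \<kappa> by (intro mult_left_mono) auto
  moreover have pw: "sqn f powr (a - 1) * sqn f = sqn f powr a" for a
    using sqn_nonneg[of f] by (cases "sqn f = 0") (simp_all add: powr_diff)
  ultimately have A: "\<kappa> * sqn f powr r \<le> \<kappa> * sqn f powr (r - 1) * innerK L g f"
    by (simp add: mult.assoc)
  have "lam * Re (innerL2 L g ?c) \<le> lam * cmod (innerL2 L g ?c)"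
    using lam by (intro mult_left_mono complex_Re_le_cmod) auto
  with A have B: "\<kappa> * sqn f powr r - lam * cmod (innerL2 L g ?c) \<le> innerK L g (gradV lam \<kappa> r f)"
    unfolding ig by linarith
  have "W * (\<kappa> * (2 * r - 2) * sqn f powr (r - 2)) \<le> (trsg * sqn f) * (\<kappa> * (2 * r - 2) * sqn f powr (r - 2))"
    using trace_formula(4)[OF fL] r \<kappa> by (intro mult_right_mono) (auto simp: W_def)
  also have "\<dots> = trsg * (\<kappa> * (2 * r - 2) * sqn f powr (r - 1))"
  proof -
    have "sqn f powr (r - 2) * sqn f = sqn f powr (r - 1)" using pw[of "r - 1"] by simp
    from this[symmetric] show ?thesis by (simp only: mult_ac)
  qed
  finally have C: "W * (\<kappa> * (2 * r - 2) * sqn f powr (r - 2)) \<le> trsg * (\<kappa> * (2 * r - 2) * sqn f powr (r - 1))" .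
  have D: "0 \<le> trsg * (4 * lam / L * sqn f)" using trsg_nonneg lam L_pos sqn_nonneg[of f] by simp
  have E: "0 \<le> (\<Sum>\<^sub>\<infinity>k. (sg k)\<^sup>2 * (cmod (fcoeff L k (gradV lam \<kappa> r f)))\<^sup>2)" by (rule infsum_nonneg) simp
  have "\<kappa> * sqn f powr r - 2 * r * \<kappa> * trsg * sqn f powr (r - 1) - lam * cmod (innerL2 L g ?c)
     \<le> - (trsg * (- 4 * lam / L * sqn f + 2 * \<kappa> * sqn f powr (r - 1)) + W * (\<kappa> * (2 * r - 2) * sqn f powr (r - 2)))
       + innerK L g (gradV lam \<kappa> r f)"
    using B C D by (simp add: algebra_simps)
  then have "\<beta> / 2 * (\<kappa> * sqn f powr r - 2 * r * \<kappa> * trsg * sqn f powr (r - 1) - lam * cmod (innerL2 L g ?c))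
     \<le> \<beta> / 2 * (- (trsg * (- 4 * lam / L * sqn f + 2 * \<kappa> * sqn f powr (r - 1)) + W * (\<kappa> * (2 * r - 2) * sqn f powr (r - 2)))
       + innerK L g (gradV lam \<kappa> r f))"
    using \<beta>_pos by (intro mult_left_mono) auto
  then show ?thesis
    unfolding U_formula[OF r] f_def[symmetric] W_def[symmetric] g_def[symmetric] using E by (simp add: add_increasing2)
qed

end

section \<open>Measurability\<close>

text \<open>Unordered sums become limits of sequences, the form in which measurability passes to the
  limit.\<close>

lemma has_sum_int_LIMSEQ:
  assumes "(f has_sum S) (UNIV :: int set)"
  shows "(\<lambda>n. \<Sum>k\<in>{- int n..int n}. f k) \<longlonglongrightarrow> S"
proof -
  have "filterlim (\<lambda>n. {- int n..int n}) (finite_subsets_at_top UNIV) sequentially"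
  proof (unfold filterlim_def le_filter_def eventually_filtermap, intro allI impI)
    fix P assume "eventually P (finite_subsets_at_top (UNIV :: int set))"
    then obtain X :: "int set" where X: "finite X" "\<And>Y. finite Y \<Longrightarrow> X \<subseteq> Y \<Longrightarrow> P Y"
      by (auto simp: eventually_finite_subsets_at_top)
    define N where "N = nat (\<Sum>k\<in>X. \<bar>k\<bar>)"
    have N: "\<bar>k\<bar> \<le> int N" if "k \<in> X" for k
      using member_le_sum[of k X abs] X(1) that by (simp add: N_def sum_nonneg)
    show "eventually (\<lambda>n. P {- int n..int n}) sequentially"
      using eventually_ge_at_top[of N]
    proof eventually_elim
      case (elim n)
      have "X \<subseteq> {- int n..int n}" using N elim by fastforce
      then show ?case by (intro X(2)) auto
    qed
  qed
  from filterlim_compose[OF assms[unfolded has_sum_def] this] show ?thesis .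
qed

lemma borel_measurable_infsum_int:
  fixes f :: "int \<Rightarrow> 'a \<Rightarrow> real"
  assumes "\<And>k. f k \<in> borel_measurable M" "\<And>x. x \<in> space M \<Longrightarrow> (\<lambda>k. f k x) summable_on UNIV"
  shows "(\<lambda>x. \<Sum>\<^sub>\<infinity>k. f k x) \<in> borel_measurable M"
proof (rule borel_measurable_LIMSEQ_real)
  show "(\<lambda>n. \<Sum>k\<in>{- int n..int n}. f k x) \<longlonglongrightarrow> (\<Sum>\<^sub>\<infinity>k. f k x)" if "x \<in> space M" for x
    by (intro has_sum_int_LIMSEQ has_sum_infsum assms that)
qed (use assms in auto)

text \<open>A criterion with countable quantifiers only; it shows that membership of \<phi> in an
  operator domain is a measurable condition.\<close>

lemma summable_on_int_iff_bounded:
  fixes a :: "int \<Rightarrow> real"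
  assumes nn: "\<And>k. 0 \<le> a k"
  shows "a summable_on UNIV \<longleftrightarrow> (\<exists>B::nat. \<forall>n. (\<Sum>k\<in>{- int n..int n}. a k) \<le> real B)"
proof
  assume a: "a summable_on UNIV"
  obtain B :: nat where "infsum a UNIV \<le> real B" using real_arch_simple by blast
  moreover have "(\<Sum>k\<in>{- int n..int n}. a k) \<le> infsum a UNIV" for n
    by (intro finite_sum_le_infsum a nn) auto
  ultimately show "\<exists>B::nat. \<forall>n. (\<Sum>k\<in>{- int n..int n}. a k) \<le> real B" by (meson order_trans)
next
  assume "\<exists>B::nat. \<forall>n. (\<Sum>k\<in>{- int n..int n}. a k) \<le> real B"
  then obtain B :: nat where B: "\<And>n. (\<Sum>k\<in>{- int n..int n}. a k) \<le> real B" by blast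
  show "a summable_on UNIV"
  proof (rule nonneg_bdd_above_summable_on[OF nn], rule bdd_aboveI2[where M="real B"])
    fix F :: "int set" assume "F \<in> {F. F \<subseteq> UNIV \<and> finite F}"
    then have F: "finite F" by simp
    define N where "N = nat (\<Sum>k\<in>F. \<bar>k\<bar>)"
    have "\<bar>k\<bar> \<le> int N" if "k \<in> F" for k
      using member_le_sum[of k F abs] F that by (simp add: N_def sum_nonneg)
    then have "F \<subseteq> {- int N..int N}" by fastforce
    then have "sum a F \<le> (\<Sum>k\<in>{- int N..int N}. a k)" by (intro sum_mono2 nn) auto
    then show "sum a F \<le> real B" using B[of N] by simp
  qed
qed

context circle
begin

text \<open>A sequence convergent in the sup norm takes its values in one closed disc, on which
  \<open>G\<close> is bounded. On a circle of finite length a constant therefore dominates the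
  integrands.\<close>

lemma continuous_integral_functional:
  fixes G :: "complex \<Rightarrow> 'b::{real_normed_algebra,banach,second_countable_topology}"
  assumes G: "continuous_on UNIV G" and w: "w \<in> borel_measurable borel" "\<And>x. norm (w x) \<le> B"
  shows "continuous_on UNIV (\<lambda>\<phi>. LINT x|circ L. w x * G (apply_bcontfun \<phi> x))"
proof (rule continuous_on_sequentiallyI)
  fix u :: "nat \<Rightarrow> real \<Rightarrow>\<^sub>C complex" and \<phi> assume u: "u \<longlonglongrightarrow> \<phi>"
  have mG: "(\<lambda>x. w x * G (apply_bcontfun \<psi> x)) \<in> borel_measurable (circ L)" for \<psi>
    by (intro borel_circ borel_measurable_times w borel_measurable_continuous_onI
        continuous_on_compose2[OF G] bcontfun_continuous) auto
  obtain K where K: "\<And>n. norm (u n) \<le> K"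
    using convergent_imp_Bseq[of u] u by (auto simp: convergent_def Bseq_def)
  have "compact (G ` cball 0 K)" by (intro compact_continuous_image continuous_on_subset[OF G]) auto
  then obtain D where D: "\<And>z. z \<in> cball 0 K \<Longrightarrow> norm (G z) \<le> D"
    by (meson bounded_iff compact_imp_bounded imageI)
  have uK: "apply_bcontfun (u n) x \<in> cball 0 K" for n x
    using norm_bounded[of "u n" x] K[of n] by simp
  show "(\<lambda>n. LINT x|circ L. w x * G (apply_bcontfun (u n) x)) \<longlonglongrightarrow> (LINT x|circ L. w x * G (apply_bcontfun \<phi> x))"
  proof (rule integral_dominated_convergence[where w="\<lambda>_. B * D"])
    show "AE x in circ L. norm (w x * G (apply_bcontfun (u n) x)) \<le> B * D" for n
    proof (rule AE_I2)
      fix x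
      have "norm (w x * G (apply_bcontfun (u n) x)) \<le> norm (w x) * norm (G (apply_bcontfun (u n) x))"
        by (rule norm_mult_ineq)
      also have "\<dots> \<le> B * D"
        using w(2)[of x] D[OF uK, of n x] norm_ge_zero order_trans by (intro mult_mono) blast+
      finally show "norm (w x * G (apply_bcontfun (u n) x)) \<le> B * D" .
    qed
    show "AE x in circ L. (\<lambda>n. w x * G (apply_bcontfun (u n) x)) \<longlonglongrightarrow> w x * G (apply_bcontfun \<phi> x)"
    proof (rule AE_I2)
      fix x
      have "(\<lambda>n. apply_bcontfun (u n) x) \<longlonglongrightarrow> apply_bcontfun \<phi> x"
      proof (rule metric_tendsto_imp_tendsto[OF u])
        show "eventually (\<lambda>n. dist (apply_bcontfun (u n) x) (apply_bcontfun \<phi> x) \<le> dist (u n) \<phi>) sequentially"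
          by (intro always_eventually allI dist_bounded)
      qed
      then have "(\<lambda>n. G (apply_bcontfun (u n) x)) \<longlonglongrightarrow> G (apply_bcontfun \<phi> x)"
        by (rule continuous_on_tendsto_compose[OF G]) auto
      then show "(\<lambda>n. w x * G (apply_bcontfun (u n) x)) \<longlonglongrightarrow> w x * G (apply_bcontfun \<phi> x)"
        by (intro tendsto_mult tendsto_const)
    qed
  qed (use mG in auto)
qed

end

context circle_model
begin

text \<open>The ingredients are continuous functionals of \<phi> and series of them. The delicate
  one is the pairing with \<open>lap_op\<close>, which jumps to 0 off the domain; it is rewritten as
  a series in Fourier coefficients.\<close>

lemma U_measurable:
  fixes \<mu> :: "(real \<Rightarrow>\<^sub>C complex) measure"
  assumes r: "2 < r" and sets_mu: "sets \<mu> = sets (restrict_space borel (Omega L))"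
  shows "U L m \<beta> lam \<kappa> r s \<in> borel_measurable \<mu>"
proof -
  have cont: "h \<in> borel_measurable \<mu>" if "continuous_on UNIV h" for h :: "(real \<Rightarrow>\<^sub>C complex) \<Rightarrow> 'b::topological_space"
    using measurable_restrict_space1[OF borel_measurable_continuous_onI[OF that]] measurable_cong_sets[OF sets_mu refl]
    by blast
  define S where "S \<phi> = sqn (apply_bcontfun \<phi>)" for \<phi>
  define c where "c k \<phi> = fcoeff L k (apply_bcontfun \<phi>)" for k \<phi>
  define d where "d k \<phi> = fcoeff L k (\<lambda>x. of_real ((cmod (apply_bcontfun \<phi> x))\<^sup>2) * apply_bcontfun \<phi> x)" for k \<phi>
  have [measurable]: "S \<in> borel_measurable \<mu>"
  proof (rule cont)
    have "S = (\<lambda>\<phi>. LINT x|circ L. 1 * (cmod (apply_bcontfun \<phi> x))\<^sup>2)" by (simp add: S_def sqn_def fun_eq_iff)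
    then show "continuous_on UNIV S"
      by (simp only:) (intro continuous_integral_functional[where B=1 and G="\<lambda>z. (cmod z)\<^sup>2"] continuous_intros, auto)
  qed
  have ce: "(\<lambda>x. cnj (expo L k x)) \<in> borel_measurable borel" "norm (cnj (expo L k x)) \<le> 1 / sqrt L" for k x
    unfolding cnj_expo by (auto simp: norm_expo)
  have [measurable]: "c k \<in> borel_measurable \<mu>" for k
  proof (rule cont)
    have "c k = (\<lambda>\<phi>. LINT x|circ L. cnj (expo L k x) * apply_bcontfun \<phi> x)" 
      by (simp add: c_def fcoeff_def innerL2_def fun_eq_iff)
    then show "continuous_on UNIV (c k)"
      by (simp only:) (intro continuous_integral_functional[where B="1 / sqrt L" and G="\<lambda>z. z"] continuous_intros ce)
  qed
  have [measurable]: "d k \<in> borel_measurable \<mu>" for k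
  proof (rule cont)
    have "d k = (\<lambda>\<phi>. LINT x|circ L. cnj (expo L k x) * (of_real ((cmod (apply_bcontfun \<phi> x))\<^sup>2) * apply_bcontfun \<phi> x))" 
      by (simp add: d_def fcoeff_def innerL2_def fun_eq_iff)
    then show "continuous_on UNIV (d k)"
      by (simp only:) (intro continuous_integral_functional[where B="1 / sqrt L" and G="\<lambda>z. of_real ((cmod z)\<^sup>2) * z"] continuous_intros ce)
  qed
  have aL: "apply_bcontfun \<phi> \<in> L2 L" for \<phi> by (intro continuous_L2 bcontfun_continuous)
  define e where "e k \<phi> = of_real (- lam) * d k \<phi> + of_real (\<kappa> * S \<phi> powr (r - 1)) * c k \<phi>" for k \<phi>
  have [measurable]: "e k \<in> borel_measurable \<mu>" for k unfolding e_def [abs_def] by measurable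
  have gL: "gradV lam \<kappa> r (apply_bcontfun \<phi>) \<in> L2 L" for \<phi>
    by (intro continuous_L2 gradV_continuous bcontfun_continuous)
  have e: "fcoeff L k (gradV lam \<kappa> r (apply_bcontfun \<phi>)) = e k \<phi>" for k \<phi>
  proof -
    have gr: "gradV lam \<kappa> r (apply_bcontfun \<phi>) = (\<lambda>x. of_real (- lam) * (of_real ((cmod (apply_bcontfun \<phi> x))\<^sup>2) * apply_bcontfun \<phi> x) 
       + of_real (\<kappa> * S \<phi> powr (r - 1)) * apply_bcontfun \<phi> x)"
      by (auto simp: gradV_def S_def fun_eq_iff algebra_simps)
    have cL: "(\<lambda>x. of_real ((cmod (apply_bcontfun \<phi> x))\<^sup>2) * apply_bcontfun \<phi> x) \<in> L2 L"
      by (intro continuous_L2 continuous_intros bcontfun_continuous)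
    show ?thesis unfolding gr fcoeff_add[OF L2_scale[OF cL] L2_scale[OF aL]] fcoeff_scale e_def c_def d_def ..
  qed
  define D where "D \<phi> \<longleftrightarrow> (\<exists>B::nat. \<forall>n. (\<Sum>k\<in>{- int n..int n}. (cmod (of_real (om k) * c k \<phi>))\<^sup>2) \<le> real B)" for \<phi>
  have [measurable]: "Measurable.pred \<mu> D" unfolding D_def [abs_def] by measurable
  have D: "apply_bcontfun \<phi> \<in> lap_dom L (sigma2_Cinv_sym \<beta> m s) \<longleftrightarrow> D \<phi>" for \<phi>
    using summable_on_int_iff_bounded[of "\<lambda>k. (cmod (of_real (om k) * c k \<phi>))\<^sup>2"] aL[of \<phi>]
    by (simp add: lap_dom_def D_def c_def om_def)
  \<comment> \<open>Setting the terms to 0 off the domain matches the default value of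
    \<open>lap_op\<close> and keeps the series summable for every \<phi>.\<close>
  define I where "I \<phi> = (\<Sum>\<^sub>\<infinity>k. if D \<phi> then Re (cnj (of_real (om k) * c k \<phi>) * e k \<phi>) else 0)" for \<phi>
  have hI: "((\<lambda>k. Re (cnj (of_real (om k) * c k \<phi>) * e k \<phi>)) has_sum 
     innerK L (lap_op L (sigma2_Cinv_sym \<beta> m s) (apply_bcontfun \<phi>)) (gradV lam \<kappa> r (apply_bcontfun \<phi>))) UNIV" if "D \<phi>" for \<phi>
  proof -
    note dom = that[folded D]
    show ?thesis
      using parseval_inner[OF lap_opD(1)[OF dom] gL[of \<phi>]] unfolding lap_opD(2)[OF dom] e by (simp add: c_def om_def)
  qed
  have [measurable]: "I \<in> borel_measurable \<mu>"
    unfolding I_def [abs_def]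
  proof (rule borel_measurable_infsum_int)
    show "(\<lambda>k. if D \<phi> then Re (cnj (of_real (om k) * c k \<phi>) * e k \<phi>) else 0) summable_on UNIV" for \<phi>
      using hI[of \<phi>] by (cases "D \<phi>") (auto intro: has_sum_imp_summable)
    have "(\<lambda>\<phi>. Re (cnj (of_real (om k) * c k \<phi>) * e k \<phi>)) = (\<lambda>\<phi>. om k * (Re (c k \<phi>) * Re (e k \<phi>) + Im (c k \<phi>) * Im (e k \<phi>)))" for k
      by (simp add: fun_eq_iff algebra_simps)
    then have [measurable]: "(\<lambda>\<phi>. Re (cnj (of_real (om k) * c k \<phi>) * e k \<phi>)) \<in> borel_measurable \<mu>" for k
      by (simp only:) measurable
    show "(\<lambda>\<phi>. if D \<phi> then Re (cnj (of_real (om k) * c k \<phi>) * e k \<phi>) else 0) \<in> borel_measurable \<mu>" for k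
      by measurable
  qed
  have I: "innerK L (lap_op L (sigma2_Cinv_sym \<beta> m s) (apply_bcontfun \<phi>)) (gradV lam \<kappa> r (apply_bcontfun \<phi>)) = I \<phi>" for \<phi>
  proof (cases "D \<phi>")
    case True
    then show ?thesis using infsumI[OF hI[OF True]] by (simp add: I_def)
  next
    case False
    then show ?thesis using D[of \<phi>] by (simp add: I_def lap_op_def innerK_def innerL2_def)
  qed
  have [measurable]: "(\<lambda>\<phi>. \<Sum>\<^sub>\<infinity>k. (sg k)\<^sup>2 * (cmod (c k \<phi>))\<^sup>2) \<in> borel_measurable \<mu>"
    by (rule borel_measurable_infsum_int) (use trace_formula(2)[OF aL] in \<open>auto simp: c_def[symmetric]\<close>)
  have [measurable]: "(\<lambda>\<phi>. \<Sum>\<^sub>\<infinity>k. (sg k)\<^sup>2 * (cmod (e k \<phi>))\<^sup>2) \<in> borel_measurable \<mu>"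
    by (rule borel_measurable_infsum_int) (use trace_formula(2)[OF gL] in \<open>auto simp: e\<close>)
  have "U L m \<beta> lam \<kappa> r s = (\<lambda>\<phi>. 
     \<beta> / 2 * (- (trsg * (- 4 * lam / L * S \<phi> + 2 * \<kappa> * S \<phi> powr (r - 1)) 
         + (\<Sum>\<^sub>\<infinity>k. (sg k)\<^sup>2 * (cmod (c k \<phi>))\<^sup>2) * (\<kappa> * (2 * r - 2) * S \<phi> powr (r - 2))) + I \<phi>)
     + \<beta>\<^sup>2 / 4 * (\<Sum>\<^sub>\<infinity>k. (sg k)\<^sup>2 * (cmod (e k \<phi>))\<^sup>2))"
    by (simp only: fun_eq_iff U_formula[OF r] I e S_def c_def simp_thms)
  then show ?thesis by (simp only:) measurable
qed

end

section \<open>The quartic term\<close>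

text \<open>In \<open>ennreal\<close>, sums can be exchanged and reindexed without summability
  conditions, on which the double convolutions rely throughout.\<close>

abbreviation esum :: "(int \<Rightarrow> ennreal) \<Rightarrow> ennreal" where
  "esum f \<equiv> integral\<^sup>N (count_space UNIV) f"

lemma has_sum_esum:
  assumes "(a has_sum S) (UNIV :: int set)" "\<And>k. 0 \<le> a k"
  shows "esum (\<lambda>k. ennreal (a k)) = ennreal S"
proof -
  have "(\<lambda>k. norm (a k)) summable_on UNIV" using has_sum_imp_summable[OF assms(1)] assms(2) by simp
  note s = abs_summable_equivalent[THEN iffD1, OF this]
  show ?thesis
    using nn_integral_conv_infsetsum[OF s] infsetsum_infsum[OF s] infsumI[OF assms(1)] assms(2) by simp
qed

lemma esum_reindex: "bij g \<Longrightarrow> esum (\<lambda>k. f (g k)) = esum f"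
  by (rule nn_integral_bij_count_space)

lemma esum_shift: "esum (\<lambda>n. f (n - c)) = esum f" "esum (\<lambda>n. f (c - n)) = esum f"
  by (rule esum_reindex, rule bij_betw_byWitness[where f'="\<lambda>n. n + c"], auto)
     (rule esum_reindex, rule bij_betw_byWitness[where f'="\<lambda>n. c - n"], auto)

lemma esum_swap: "esum (\<lambda>x. esum (\<lambda>y. f x y)) = esum (\<lambda>y. esum (\<lambda>x. f x y))"
  by (rule nn_integral_count_space_nn_integral) auto

lemma esum_cmult: "esum (\<lambda>x. c * f x) = c * esum f"
  by (rule nn_integral_cmult) simp

lemma esum_multc: "esum (\<lambda>x. f x * c) = esum f * c"
  by (rule nn_integral_multc) simp

lemma esum_mono: "(\<And>x. f x \<le> g x) \<Longrightarrow> esum f \<le> esum g"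
  by (rule nn_integral_mono) auto

lemma Cauchy_Schwarz_esum2:
  "(esum (\<lambda>a. esum (\<lambda>b. f a b * g a b)))\<^sup>2 \<le> esum (\<lambda>a. esum (\<lambda>b. (f a b)\<^sup>2)) * esum (\<lambda>a. esum (\<lambda>b. (g a b)\<^sup>2))"
  using Cauchy_Schwarz_nn_integral[of "\<lambda>(a, b). f a b" "count_space UNIV" "\<lambda>(a, b). g a b"]
    nn_integral_fst_count_space[of "\<lambda>(a, b). f a b * g a b"]
    nn_integral_fst_count_space[of "\<lambda>(a, b). (f a b)\<^sup>2"]
    nn_integral_fst_count_space[of "\<lambda>(a, b). (g a b)\<^sup>2"]
  by (simp add: case_prod_unfold)

text \<open>
  On the right each product omits one of the three variables, so that summing over two free indices of
  \<open>a + b + c = n\<close> gives a bound independent of \<open>n\<close>.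
\<close>

lemma powr_triple_le:
  fixes P Q R :: real
  assumes pos: "0 < P" "0 < Q" "0 < R"
  shows "P powr (-3/8) * Q powr (-3/8) * R powr (-3/8) \<le>
     P powr (-9/16) * Q powr (-9/16) + Q powr (-9/16) * R powr (-9/16) + P powr (-9/16) * R powr (-9/16)"
proof -
  \<comment> \<open>Here \<open>z\<close> is the largest of the three. Its power is split evenly and
    handed to the two smaller ones: 3/8 + 3/16 = 9/16.\<close>
  have main: "x powr (-3/8) * y powr (-3/8) * z powr (-3/8) \<le> x powr (-9/16) * y powr (-9/16)"
    if "0 < x" "0 < y" "x \<le> z" "y \<le> z" for x y z :: real
  proof -
    have "z powr (-3/8) = z powr (-3/16) * z powr (-3/16)" by (simp flip: powr_add)
    also have "\<dots> \<le> x powr (-3/16) * y powr (-3/16)"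
      using that by (intro mult_mono powr_mono2') auto
    finally have "x powr (-3/8) * y powr (-3/8) * z powr (-3/8) \<le> x powr (-3/8) * y powr (-3/8) * (x powr (-3/16) * y powr (-3/16))"
      by (rule mult_left_mono) simp
    also have "\<dots> = (x powr (-3/8) * x powr (-3/16)) * (y powr (-3/8) * y powr (-3/16))" by (simp only: mult_ac)
    also have "\<dots> = x powr (-9/16) * y powr (-9/16)" by (simp flip: powr_add)
    finally show ?thesis .
  qed
  have nn: "0 \<le> P powr (-9/16) * Q powr (-9/16)" "0 \<le> Q powr (-9/16) * R powr (-9/16)" "0 \<le> P powr (-9/16) * R powr (-9/16)"
    by simp_all
  consider "P \<le> R" "Q \<le> R" | "Q \<le> P" "R \<le> P" | "P \<le> Q" "R \<le> Q" by linarith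
  then show ?thesis
  proof cases
    case 1 then show ?thesis using main[of P Q R] pos nn by linarith
  next
    case 2 
    have "P powr (-3/8) * Q powr (-3/8) * R powr (-3/8) = Q powr (-3/8) * R powr (-3/8) * P powr (-3/8)" by (simp only: mult_ac)
    then show ?thesis using main[of Q R P] 2 pos nn by linarith
  next
    case 3
    have "P powr (-3/8) * Q powr (-3/8) * R powr (-3/8) = P powr (-3/8) * R powr (-3/8) * Q powr (-3/8)" by (simp only: mult_ac)
    then show ?thesis using main[of P R Q] 3 pos nn by linarith
  qed
qed

context circle
begin

section \<open>Products and convolutions\<close>

lemma esum_parseval:
  assumes "f \<in> L2 L"
  shows "esum (\<lambda>k. (ennreal (cmod (fcoeff L k f)))\<^sup>2) = ennreal (sqn f)"
  using has_sum_esum[OF parseval[OF assms]] by (simp add: ennreal_power)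

lemma innerL2_Cauchy_Schwarz:
  assumes "f \<in> L2 L" "g \<in> L2 L"
  shows "(cmod (innerL2 L f g))\<^sup>2 \<le> sqn f * sqn g"
proof -
  have "(ennreal (cmod (innerL2 L f g)))\<^sup>2 \<le> (esum (\<lambda>k. ennreal (cmod (fcoeff L k f)) * ennreal (cmod (fcoeff L k g))))\<^sup>2"
    by (intro power_mono inner_le_sum assms) simp
  also have "\<dots> \<le> ennreal (sqn f) * ennreal (sqn g)"
    using Cauchy_Schwarz_nn_integral[of "\<lambda>k. ennreal (cmod (fcoeff L k f))" "count_space UNIV" "\<lambda>k. ennreal (cmod (fcoeff L k g))"]
    by (simp add: esum_parseval assms)
  finally show ?thesis
    by (simp add: ennreal_power sqn_nonneg flip: ennreal_mult)
qed

text \<open>Moving \<open>f\<close> with a conjugate to the other side of the inner product reflects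
  and shifts its frequencies to \<open>n - a\<close>; \<open>inner_le_sum\<close> then yields the
  convolution in absolute values.\<close>

lemma fcoeff_mult_le:
  assumes f: "continuous_on UNIV f" and g: "continuous_on UNIV g"
  shows "ennreal (cmod (fcoeff L n (\<lambda>x. f x * g x))) \<le>
    ennreal (1 / sqrt L) * esum (\<lambda>a. ennreal (cmod (fcoeff L (n - a) f)) * ennreal (cmod (fcoeff L a g)))"
proof -
  let ?h = "\<lambda>x. cnj (f x) * expo L n x"
  have hL: "?h \<in> L2 L" by (intro continuous_L2 continuous_intros f expo_continuous)
  have "fcoeff L n (\<lambda>x. f x * g x) = innerL2 L ?h g"
    by (simp add: fcoeff_def innerL2_def mult_ac)
  then have "ennreal (cmod (fcoeff L n (\<lambda>x. f x * g x))) \<le> esum (\<lambda>a. ennreal (cmod (fcoeff L a ?h)) * ennreal (cmod (fcoeff L a g)))"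
    using inner_le_sum[OF hL continuous_L2[OF g]] by simp
  also have "ennreal (cmod (fcoeff L a ?h)) = ennreal (1 / sqrt L) * ennreal (cmod (fcoeff L (n - a) f))" for a
  proof -
    have "fcoeff L a ?h = (LINT x|circ L. of_real (1 / sqrt L) * (cnj (cnj (expo L (n - a) x) * f x)))"
      unfolding fcoeff_def innerL2_def
    proof (intro Bochner_Integration.integral_cong refl)
      fix x
      have "cnj (expo L a x) * (cnj (f x) * expo L n x) = cnj (f x) * (expo L (- a) x * expo L n x)"
        by (simp add: cnj_expo)
      also have "\<dots> = cnj (f x) * (of_real (1 / sqrt L) * expo L (n - a) x)"
        by (simp only: expo_mult) (simp add: algebra_simps)
      finally show "cnj (expo L a x) * (cnj (f x) * expo L n x) = of_real (1 / sqrt L) * (cnj (cnj (expo L (n - a) x) * f x))"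
        by simp
    qed
    also have "\<dots> = of_real (1 / sqrt L) * cnj (fcoeff L (n - a) f)"
      unfolding fcoeff_def innerL2_def Bochner_Integration.integral_cnj[symmetric] by simp
    finally have "cmod (fcoeff L a ?h) = 1 / sqrt L * cmod (fcoeff L (n - a) f)"
      using L_pos by (simp add: norm_mult norm_divide)
    then show ?thesis using L_pos by (simp only: ennreal_mult norm_ge_zero real_sqrt_ge_0_iff divide_nonneg_nonneg zero_le_one less_imp_le)
  qed
  then have "(\<lambda>a. ennreal (cmod (fcoeff L a ?h)) * ennreal (cmod (fcoeff L a g))) = 
     (\<lambda>a. ennreal (1 / sqrt L) * (ennreal (cmod (fcoeff L (n - a) f)) * ennreal (cmod (fcoeff L a g))))"
    by (simp only: mult.assoc)
  finally show ?thesis by (simp only: esum_cmult)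
qed

end

context circle_model
begin

section \<open>The cube of a function in L2\<close>

definition wsum :: real where
  "wsum = (\<Sum>\<^sub>\<infinity>k. p k powr (-9/16))"

lemma wsum_nonneg: "0 \<le> wsum"
  unfolding wsum_def by (rule infsum_nonneg) simp

lemma esum_wsum: "esum (\<lambda>k. ennreal (p k powr (-9/16))) = ennreal wsum"
  unfolding wsum_def by (intro has_sum_esum has_sum_infsum p_powr_summable) auto

text \<open>\<open>powr_triple_le\<close> leaves products of two weights. Any two of
  \<open>n - c\<close>, \<open>c - a\<close> and \<open>a\<close> range independently over the
  integers, so each product sums to \<open>wsum\<^sup>2\<close>, whatever \<open>n\<close>
  is.\<close>

lemma triple_weight_sum:
  "esum (\<lambda>c. esum (\<lambda>a. ennreal (p (n - c) powr (-3/8)) * ennreal (p (c - a) powr (-3/8)) * ennreal (p a powr (-3/8))))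
     \<le> 3 * (ennreal wsum)\<^sup>2"
proof -
  let ?w = "\<lambda>k. ennreal (p k powr (-9/16))"
  have three: "z + z + z = 3 * z" for z :: ennreal
  proof -
    have "(3 :: ennreal) = 1 + 1 + 1" by simp
    then show ?thesis by (simp only: distrib_right mult_1)
  qed
  have "esum (\<lambda>c. esum (\<lambda>a. ennreal (p (n - c) powr (-3/8)) * ennreal (p (c - a) powr (-3/8)) * ennreal (p a powr (-3/8))))
    \<le> esum (\<lambda>c. esum (\<lambda>a. (?w (n - c) * ?w (c - a) + ?w (c - a) * ?w a) + ?w (n - c) * ?w a))"
    by (intro esum_mono) (use powr_triple_le[OF p_pos p_pos p_pos] in \<open>simp flip: ennreal_mult ennreal_plus\<close>)
  also have "\<dots> = esum (\<lambda>c. esum (\<lambda>a. ?w (n - c) * ?w (c - a))) + esum (\<lambda>c. esum (\<lambda>a. ?w (c - a) * ?w a))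
      + esum (\<lambda>c. esum (\<lambda>a. ?w (n - c) * ?w a))"
    by (simp add: nn_integral_add)
  also have "esum (\<lambda>c. esum (\<lambda>a. ?w (c - a) * ?w a)) = esum (\<lambda>a. esum (\<lambda>c. ?w (c - a) * ?w a))"
    by (rule esum_swap)
  finally show ?thesis
    unfolding esum_cmult esum_multc esum_shift(1)[of ?w] esum_shift(2)[of ?w] esum_wsum
    by (simp only: power2_eq_square three)
qed

text \<open>Weighted Cauchy--Schwarz with coefficients factored as \<open>x k * y k\<close>: the sum
  of the \<open>y\<close> part is bounded uniformly in \<open>n\<close>, while the \<open>x\<close>
  part, summed over \<open>n\<close> too, factorizes into \<open>Y ^ 3\<close>. The plain cube has
  the modulus of the actual cubic term and avoids the reflected frequencies of a conjugate.\<close>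

lemma cubic_L2_bound:
  assumes f: "continuous_on UNIV f"
    and Y: "((\<lambda>k. p k powr (3/8) * (cmod (fcoeff L k f))\<^sup>2) has_sum Y) UNIV"
  shows "sqn (\<lambda>x. f x * (f x * f x)) \<le> (1 / L)\<^sup>2 * (3 * wsum\<^sup>2) * Y ^ 3"
proof -
  define F where "F k = ennreal (cmod (fcoeff L k f))" for k
  define x y where "x k = ennreal (p k powr (3/16) * cmod (fcoeff L k f))" and "y k = ennreal (p k powr (-3/16))" for k
  have F: "F k = x k * y k" for k
  proof -
    have "p k powr (3/16) * p k powr (-3/16) = 1" using p_pos[of k] by (simp flip: powr_add)
    then have "p k powr (3/16) * cmod (fcoeff L k f) * p k powr (-3/16) = cmod (fcoeff L k f)"
      by (simp add: mult.commute mult.left_commute)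
    then show ?thesis by (simp add: F_def x_def y_def flip: ennreal_mult)
  qed
  have y2: "(y k)\<^sup>2 = ennreal (p k powr (-3/8))" for k
  proof -
    have "(p k powr (-3/16))\<^sup>2 = p k powr (-3/8)" by (simp add: power2_eq_square flip: powr_add)
    then show ?thesis by (simp add: y_def ennreal_power)
  qed
  have "(x k)\<^sup>2 = ennreal (p k powr (3/8) * (cmod (fcoeff L k f))\<^sup>2)" for k
  proof -
    have "(p k powr (3/16))\<^sup>2 = p k powr (3/8)" by (simp add: power2_eq_square flip: powr_add)
    then show ?thesis by (simp add: x_def ennreal_power power_mult_distrib)
  qed
  then have x2: "esum (\<lambda>k. (x k)\<^sup>2) = ennreal Y"
    using has_sum_esum[OF Y] by simp
  have Y0: "0 \<le> Y" using has_sum_nonneg[OF Y] by simp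
  let ?l = "ennreal (1 / sqrt L)"
  define S where "S n = esum (\<lambda>c. esum (\<lambda>a. F (n - c) * F (c - a) * F a))" for n
  have ff: "continuous_on UNIV (\<lambda>x. f x * f x)" by (intro continuous_intros f)
  have bound: "ennreal (cmod (fcoeff L n (\<lambda>x. f x * (f x * f x)))) \<le> ?l\<^sup>2 * S n" for n
  proof -
    have "ennreal (cmod (fcoeff L n (\<lambda>x. f x * (f x * f x)))) \<le> ?l * esum (\<lambda>c. F (n - c) * ennreal (cmod (fcoeff L c (\<lambda>x. f x * f x))))"
      unfolding F_def by (rule fcoeff_mult_le[OF f ff])
    also have "\<dots> \<le> ?l * esum (\<lambda>c. F (n - c) * (?l * esum (\<lambda>a. F (c - a) * F a)))"
      unfolding F_def by (intro mult_left_mono esum_mono fcoeff_mult_le f) auto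
    also have "\<dots> = ?l * esum (\<lambda>c. ?l * esum (\<lambda>a. F (n - c) * F (c - a) * F a))"
      by (simp only: mult.left_commute[of "F _" ?l] mult.assoc esum_cmult)
    also have "\<dots> = ?l\<^sup>2 * S n" by (simp only: esum_cmult S_def power2_eq_square mult.assoc)
    finally show ?thesis .
  qed
  have S2: "(S n)\<^sup>2 \<le> esum (\<lambda>c. esum (\<lambda>a. (x (n - c))\<^sup>2 * (x (c - a))\<^sup>2 * (x a)\<^sup>2)) * (3 * (ennreal wsum)\<^sup>2)" for n
  proof -
    have "S n = esum (\<lambda>c. esum (\<lambda>a. (x (n - c) * x (c - a) * x a) * (y (n - c) * y (c - a) * y a)))"
      unfolding S_def F by (simp only: mult_ac)
    then have "(S n)\<^sup>2 \<le> esum (\<lambda>c. esum (\<lambda>a. (x (n - c) * x (c - a) * x a)\<^sup>2)) * esum (\<lambda>c. esum (\<lambda>a. (y (n - c) * y (c - a) * y a)\<^sup>2))"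
      by (simp only: Cauchy_Schwarz_esum2)
    also have "\<dots> \<le> esum (\<lambda>c. esum (\<lambda>a. (x (n - c) * x (c - a) * x a)\<^sup>2)) * (3 * (ennreal wsum)\<^sup>2)"
      unfolding power_mult_distrib[of "y _ * y _" "y _"] power_mult_distrib[of "y _" "y _"] y2 by (intro mult_left_mono triple_weight_sum) simp
    finally show ?thesis by (simp only: power_mult_distrib)
  qed
  have sum3: "esum (\<lambda>n. esum (\<lambda>c. esum (\<lambda>a. (x (n - c))\<^sup>2 * (x (c - a))\<^sup>2 * (x a)\<^sup>2))) = ennreal Y ^ 3"
  proof -
    have "esum (\<lambda>n. esum (\<lambda>c. esum (\<lambda>a. (x (n - c))\<^sup>2 * (x (c - a))\<^sup>2 * (x a)\<^sup>2))) = 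
       esum (\<lambda>c. esum (\<lambda>n. (x (n - c))\<^sup>2 * esum (\<lambda>a. (x (c - a))\<^sup>2 * (x a)\<^sup>2)))"
      by (subst esum_swap) (simp only: mult.assoc esum_cmult)
    also have "\<dots> = ennreal Y * esum (\<lambda>c. esum (\<lambda>a. (x (c - a))\<^sup>2 * (x a)\<^sup>2))"
      unfolding esum_multc esum_shift(1)[of "\<lambda>k. (x k)\<^sup>2"] x2 esum_cmult ..
    also have "esum (\<lambda>c. esum (\<lambda>a. (x (c - a))\<^sup>2 * (x a)\<^sup>2)) = esum (\<lambda>a. esum (\<lambda>c. (x (c - a))\<^sup>2 * (x a)\<^sup>2))"
      by (rule esum_swap)
    also have "\<dots> = ennreal Y * ennreal Y"
      unfolding esum_multc esum_shift(1)[of "\<lambda>k. (x k)\<^sup>2"] x2 esum_cmult ..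
    finally show ?thesis by (simp add: power3_eq_cube mult.assoc)
  qed
  have fffL: "(\<lambda>x. f x * (f x * f x)) \<in> L2 L" by (intro continuous_L2 continuous_intros f)
  have "ennreal (sqn (\<lambda>x. f x * (f x * f x))) = esum (\<lambda>n. (ennreal (cmod (fcoeff L n (\<lambda>x. f x * (f x * f x)))))\<^sup>2)"
    by (rule esum_parseval[OF fffL, symmetric])
  also have "\<dots> \<le> esum (\<lambda>n. (?l\<^sup>2)\<^sup>2 * (S n)\<^sup>2)"
    unfolding power_mult_distrib[symmetric] by (intro esum_mono power_mono bound) simp
  also have "\<dots> \<le> esum (\<lambda>n. (?l\<^sup>2)\<^sup>2 * (esum (\<lambda>c. esum (\<lambda>a. (x (n - c))\<^sup>2 * (x (c - a))\<^sup>2 * (x a)\<^sup>2)) * (3 * (ennreal wsum)\<^sup>2)))"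
    by (intro esum_mono mult_left_mono S2) simp
  also have "\<dots> = (?l\<^sup>2)\<^sup>2 * (ennreal Y ^ 3 * (3 * (ennreal wsum)\<^sup>2))"
    by (simp only: esum_cmult esum_multc sum3)
  also have "?l\<^sup>2 = ennreal (1 / L)"
    using L_pos by (simp add: ennreal_power power_divide)
  also have "(ennreal (1 / L))\<^sup>2 * (ennreal Y ^ 3 * (3 * (ennreal wsum)\<^sup>2)) = ennreal ((1 / L)\<^sup>2 * (3 * wsum\<^sup>2) * Y ^ 3)"
  proof -
    have "(3::ennreal) = ennreal 3" by simp
    then show ?thesis using L_pos Y0 wsum_nonneg
      by (simp only: ennreal_power ennreal_mult' ennreal_mult zero_le_power zero_le_numeral mult_nonneg_nonneg less_imp_le zero_less_divide_1_iff mult_ac)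
  qed
  finally show ?thesis
    using L_pos Y0 wsum_nonneg by (subst (asm) ennreal_le_iff) auto
qed

text \<open>Under the root stand the constant lost in comparing \<open>(om k)\<^sup>2\<close> with
  \<open>p k powr (3/8)\<close> and the constant of \<open>cubic_L2_bound\<close>.\<close>

definition quartic_const :: real where
  "quartic_const = sqrt ((m\<^sup>2) powr (2 * \<gamma> - 3/8) * ((1 / L)\<^sup>2 * (3 * wsum\<^sup>2)))"

text \<open>Up to constants, \<open>Y\<close> bounds the squared norm of
  \<open>\<sigma>\<^sup>2C\<^sup>-\<^sup>1f\<close> and \<open>Y ^ 3\<close> that of the cubic term,
  so Cauchy--Schwarz gives \<open>Y\<^sup>2\<close>. Finiteness of \<open>Y\<close> also puts
  \<open>f\<close> in the domain, where \<open>lap_op\<close> is the true operator.\<close>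

lemma quartic_bound:
  assumes f: "continuous_on UNIV f"
    and Y: "((\<lambda>k. p k powr (3/8) * (cmod (fcoeff L k f))\<^sup>2) has_sum Y) UNIV"
  shows "f \<in> lap_dom L (sigma2_Cinv_sym \<beta> m s)"
    and "cmod (innerL2 L (lap_op L (sigma2_Cinv_sym \<beta> m s) f) (\<lambda>x. of_real ((cmod (f x))\<^sup>2) * f x))
          \<le> quartic_const * Y\<^sup>2"
proof -
  have fL: "f \<in> L2 L" by (rule continuous_L2[OF f])
  let ?C = "(m\<^sup>2) powr (2 * \<gamma> - 3/8)"
  have le: "(cmod (of_real (om k) * fcoeff L k f))\<^sup>2 \<le> ?C * (p k powr (3/8) * (cmod (fcoeff L k f))\<^sup>2)" for k
  proof -
    have "(om k)\<^sup>2 \<le> (p k powr \<gamma>)\<^sup>2" using om_le[of k] om_ge_1[of k] by (intro power_mono) auto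
    also have "\<dots> = p k powr (2 * \<gamma>)" by (simp add: power2_eq_square flip: powr_add)
    also have "\<dots> \<le> ?C * p k powr (3/8)" using \<gamma>_less by (intro p_powr_le) simp
    finally show ?thesis by (simp add: norm_mult power_mult_distrib mult_right_mono flip: mult.assoc)
  qed
  have hs: "((\<lambda>k. ?C * (p k powr (3/8) * (cmod (fcoeff L k f))\<^sup>2)) has_sum (?C * Y)) UNIV"
    by (intro has_sum_cmult_right Y)
  have sm: "(\<lambda>k. (cmod (of_real (om k) * fcoeff L k f))\<^sup>2) summable_on UNIV"
    by (rule summable_on_comparison_test[OF has_sum_imp_summable[OF hs]]) (use le in auto)
  then show dom: "f \<in> lap_dom L (sigma2_Cinv_sym \<beta> m s)"
    using fL by (simp add: lap_dom_def om_def)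
  define g where "g = lap_op L (sigma2_Cinv_sym \<beta> m s) f"
  have gL: "g \<in> L2 L" unfolding g_def by (rule lap_opD(1)[OF dom])
  have Y0: "0 \<le> Y" using has_sum_nonneg[OF Y] by simp
  have sg: "sqn g \<le> ?C * Y"
    using has_sum_mono[OF has_sum_infsum[OF sm] hs] le unfolding g_def lap_opD(3)[OF dom] by (simp add: om_def)
  let ?c = "\<lambda>x. of_real ((cmod (f x))\<^sup>2) * f x"
  have cL: "?c \<in> L2 L" by (intro continuous_L2 continuous_intros f)
  have "sqn ?c = sqn (\<lambda>x. f x * (f x * f x))"
    unfolding sqn_def by (intro Bochner_Integration.integral_cong refl) (simp add: norm_mult power2_eq_square)
  then have sc: "sqn ?c \<le> (1 / L)\<^sup>2 * (3 * wsum\<^sup>2) * Y ^ 3" using cubic_L2_bound[OF f Y] by simp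
  have "(cmod (innerL2 L g ?c))\<^sup>2 \<le> sqn g * sqn ?c" by (rule innerL2_Cauchy_Schwarz[OF gL cL])
  also have "\<dots> \<le> (?C * Y) * ((1 / L)\<^sup>2 * (3 * wsum\<^sup>2) * Y ^ 3)"
    using sg sc Y0 sqn_nonneg by (intro mult_mono) auto
  also have "\<dots> = (quartic_const * Y\<^sup>2)\<^sup>2"
    unfolding quartic_const_def power_mult_distrib[of "sqrt _"]
    by (subst real_sqrt_pow2) (simp_all add: power2_eq_square power3_eq_cube)
  finally show "cmod (innerL2 L (lap_op L (sigma2_Cinv_sym \<beta> m s) f) ?c) \<le> quartic_const * Y\<^sup>2"
    unfolding g_def[symmetric] by (rule power2_le_imp_le) (simp add: quartic_const_def)
qed

end

section \<open>Gaussian estimates\<close>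

lemma nn_integral_gaussian:
  fixes \<rho> :: real
  assumes "0 < \<rho>"
  shows "(\<integral>\<^sup>+x. ennreal (exp (- (\<rho> * x\<^sup>2 / 2))) \<partial>lborel) = ennreal (sqrt (2 * pi / \<rho>))"
proof -
  define \<sigma> where "\<sigma> = 1 / sqrt \<rho>"
  have \<sigma>: "0 < \<sigma>" "\<sigma>\<^sup>2 = 1 / \<rho>" using assms by (simp_all add: \<sigma>_def power_divide)
  have e: "exp (- (\<rho> * x\<^sup>2 / 2)) = sqrt (2 * pi / \<rho>) * normal_density 0 \<sigma> x" for x
    using assms by (simp add: normal_density_def \<sigma>(2))
  have "(\<integral>\<^sup>+x. ennreal (normal_density 0 \<sigma> x) \<partial>lborel) = 1"
    using \<sigma>(1) by (subst nn_integral_eq_integral) auto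
  then show ?thesis
    unfolding e using assms by (simp add: ennreal_mult nn_integral_cmult)
qed

lemma nn_integral_gaussian_complex:
  fixes \<rho> :: real
  assumes "0 < \<rho>"
  shows "(\<integral>\<^sup>+z. ennreal (exp (- (\<rho> * (cmod z)\<^sup>2 / 2))) \<partial>lborel) = ennreal (2 * pi / \<rho>)"
proof -
  have "(\<integral>\<^sup>+z. ennreal (exp (- (\<rho> * (cmod z)\<^sup>2 / 2))) \<partial>lborel) = 
     (\<integral>\<^sup>+z. (\<Prod>b\<in>(Basis :: complex set). ennreal (exp (- (\<rho> * (z \<bullet> b)\<^sup>2 / 2)))) \<partial>lborel)"
    by (intro nn_integral_cong) (simp add: Basis_complex_def cmod_power2 add_divide_distrib distrib_left
       flip: ennreal_mult exp_add)
  also have "\<dots> = (\<Prod>b\<in>(Basis :: complex set). ennreal (sqrt (2 * pi / \<rho>)))"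
    by (subst nn_integral_lborel_prod) (auto simp: nn_integral_gaussian[OF assms])
  also have "\<dots> = ennreal (2 * pi / \<rho>)"
    using assms by (simp add: Basis_complex_def flip: ennreal_mult)
  finally show ?thesis .
qed

text \<open>Turns normalisation factors into exponentials, so that a product over modes is governed
  by a sum. It reduces to \<open>1 \<le> (1 + 2 * x) * (1 - x)\<close>, which is where
  \<open>x \<le> 1 / 2\<close> enters.\<close>

lemma inverse_le_exp:
  fixes x :: real
  assumes "0 \<le> x" "x \<le> 1 / 2"
  shows "1 / (1 - x) \<le> exp (2 * x)"
proof -
  have "x * x \<le> x * (1 / 2)" using assms by (intro mult_left_mono) auto
  then have "1 \<le> (1 + 2 * x) * (1 - x)" by (simp add: algebra_simps)
  also have "\<dots> \<le> exp (2 * x) * (1 - x)"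
    using assms exp_ge_add_one_self[of "2 * x"] by (intro mult_right_mono) auto
  finally show ?thesis using assms by (simp add: field_simps)
qed

text \<open>Tilting replaces \<theta> by \<open>\<theta> - 2 * u\<close>, and the normalisations
  have ratio \<open>1 / (1 - 2 * u / \<theta>)\<close>. The condition
  \<open>u \<le> \<theta> / 4\<close> keeps \<open>2 * u / \<theta>\<close> in the range of
  \<open>inverse_le_exp\<close>.\<close>

lemma gaussian_exp_moment:
  fixes X :: "'a \<Rightarrow> complex"
  assumes X: "distributed M lborel X (\<lambda>z. ennreal (\<theta> / (2 * pi) * exp (- \<theta> * (cmod z)\<^sup>2 / 2)))"
    and u: "0 \<le> u" "u \<le> \<theta> / 4" "0 < \<theta>"
  shows "(\<integral>\<^sup>+\<omega>. ennreal (exp (u * (cmod (X \<omega>))\<^sup>2)) \<partial>M) \<le> ennreal (exp (4 * u / \<theta>))"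
proof -
  define \<rho> where "\<rho> = \<theta> - 2 * u"
  have \<rho>: "0 < \<rho>" using u by (simp add: \<rho>_def)
  have "(\<integral>\<^sup>+\<omega>. ennreal (exp (u * (cmod (X \<omega>))\<^sup>2)) \<partial>M) = 
     (\<integral>\<^sup>+z. ennreal (\<theta> / (2 * pi) * exp (- \<theta> * (cmod z)\<^sup>2 / 2)) * ennreal (exp (u * (cmod z)\<^sup>2)) \<partial>lborel)"
    by (rule distributed_nn_integral[OF X, symmetric]) measurable
  also have "\<dots> = (\<integral>\<^sup>+z. ennreal (\<theta> / (2 * pi)) * ennreal (exp (- (\<rho> * (cmod z)\<^sup>2 / 2))) \<partial>lborel)"
    using u by (intro nn_integral_cong)
      (simp add: \<rho>_def mult.assoc field_simps flip: ennreal_mult exp_add)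
  also have "\<dots> = ennreal (\<theta> / (2 * pi)) * ennreal (2 * pi / \<rho>)"
    by (subst nn_integral_cmult) (auto simp: nn_integral_gaussian_complex[OF \<rho>])
  also have "\<dots> = ennreal (1 / (1 - 2 * u / \<theta>))"
    using u \<rho> by (simp add: \<rho>_def field_simps flip: ennreal_mult)
  also have "\<dots> \<le> ennreal (exp (4 * u / \<theta>))"
    using inverse_le_exp[of "2 * u / \<theta>"] u by (intro ennreal_leI) (simp add: field_simps)
  finally show ?thesis .
qed

section \<open>Absorption by the potential and the resulting series\<close>

lemma potential_bound:
  fixes a b c r :: real
  assumes a: "0 < a" and b: "0 \<le> b" and c: "0 \<le> c" and r: "9 \<le> r"
  obtains D where "0 \<le> D"
    "\<And>S Y n. 0 \<le> S \<Longrightarrow> 0 \<le> Y \<Longrightarrow> 1 \<le> n \<Longrightarrow> Y \<le> n powr (3/8) * (1 + S) \<Longrightarrow>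
       b * S powr (r - 1) + c * Y\<^sup>2 - a * S powr r \<le> D * (1 + n powr (27/28))"
proof -
  \<comment> \<open>With \<open>x = n powr (1/28)\<close>: for \<open>S \<le> K * x ^ 3\<close> the quartic term is of order \<open>x ^ 27\<close>,
    and for larger \<open>S\<close> half of \<open>a * S powr r\<close> absorbs it.\<close>
  define K where "K = max 1 (8 * c / a)"
  \<comment> \<open>The value of \<open>b * S powr (r - 1)\<close> at \<open>S = 2 * b / a\<close>;
    beyond that point half of \<open>a * S powr r\<close> dominates.\<close>
  define D1 where "D1 = b * (2 * b / a) powr (r - 1)"
  have K: "1 \<le> K" "8 * c / a \<le> K" by (simp_all add: K_def)
  have D1: "0 \<le> D1" using b by (simp add: D1_def)
  have p1: "b * S powr (r - 1) \<le> a / 2 * S powr r + D1" if S: "0 \<le> S" for S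
  proof (cases "2 * b / a \<le> S")
    case True
    then have "b \<le> a / 2 * S" using a by (simp add: field_simps)
    then have "b * S powr (r - 1) \<le> a / 2 * S * S powr (r - 1)" by (intro mult_right_mono) auto
    also have "S * S powr (r - 1) = S powr r" using S by (cases "S = 0") (simp_all add: powr_diff)
    then have "a / 2 * S * S powr (r - 1) = a / 2 * S powr r" by simp
    finally show ?thesis using D1 by simp
  next
    case False
    then have "b * S powr (r - 1) \<le> D1"
      unfolding D1_def using S r b by (intro mult_left_mono powr_mono2) auto
    moreover have "0 \<le> a / 2 * S powr r" using a by simp
    ultimately show ?thesis by simp
  qed
  have p2: "c * Y\<^sup>2 \<le> a / 2 * S powr r + 4 * c * K\<^sup>2 * n powr (27/28)"
    if S: "0 \<le> S" and Y: "0 \<le> Y" "Y \<le> n powr (3/8) * (1 + S)" and n: "1 \<le> n" for S Y n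
  proof -
    define x where "x = n powr (1/28)"
    have x1: "1 \<le> x" using n by (simp add: x_def ge_one_powr_ge_zero)
    have xp: "x ^ i = n powr (real i / 28)" for i
      using n by (simp add: x_def powr_power)
    \<comment> \<open>Squaring produces \<open>n powr (3/4)\<close>, that is \<open>x ^ 21\<close>.
      Below the threshold \<open>S\<^sup>2\<close> adds at most order \<open>x ^ 6\<close>, whence
      the power 27.\<close>
    have "Y\<^sup>2 \<le> (n powr (3/8) * (1 + S))\<^sup>2" using Y by (intro power_mono) auto
    also have "\<dots> = x ^ 21 * (1 + S)\<^sup>2"
      by (simp add: power_mult_distrib xp) (simp add: power2_eq_square flip: powr_add)
    finally have "Y\<^sup>2 \<le> x ^ 21 * (1 + S)\<^sup>2" .
    then have cY: "c * Y\<^sup>2 \<le> c * (x ^ 21 * (1 + S)\<^sup>2)" using c by (intro mult_left_mono) auto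
    have x27: "n powr (27/28) = x ^ 27" by (simp add: xp)
    show ?thesis
    proof (cases "S \<le> K * x ^ 3")
      case True
      have "1 \<le> K * x ^ 3" using K(1) one_le_power[OF x1, of 3] mult_mono[of 1 K 1 "x ^ 3"] by simp
      then have "(1 + S)\<^sup>2 \<le> (2 * (K * x ^ 3))\<^sup>2" using S True by (intro power_mono) auto
      then have "c * (x ^ 21 * (1 + S)\<^sup>2) \<le> c * (x ^ 21 * (2 * (K * x ^ 3))\<^sup>2)"
        using c x1 by (intro mult_left_mono) auto
      also have "\<dots> = 4 * c * K\<^sup>2 * x ^ 27" by algebra
      finally show ?thesis using cY a unfolding x27 by (smt (verit) powr_ge_zero mult_nonneg_nonneg divide_nonneg_nonneg)
    next
      case False
      have Kx: "K * x ^ 3 \<le> S" using False by simp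
      have "1 \<le> K * x ^ 3" using K(1) one_le_power[OF x1, of 3] mult_mono[of 1 K 1 "x ^ 3"] by simp
      then have S1: "1 \<le> S" using Kx by simp
      have "(1 + S)\<^sup>2 \<le> (2 * S)\<^sup>2" using S1 by (intro power_mono) auto
      then have "c * (x ^ 21 * (1 + S)\<^sup>2) \<le> c * (x ^ 21 * (2 * S)\<^sup>2)"
        using c x1 by (intro mult_left_mono) auto
      also have "\<dots> = 4 * c * (x ^ 21 * S\<^sup>2)" by algebra
      \<comment> \<open>Seven factors of the threshold \<open>K * x ^ 3\<close> absorb
        \<open>x ^ 21\<close>; being at most \<open>S\<close>, they combine with
        \<open>S\<^sup>2\<close> to \<open>S ^ 9\<close>, which is where the exponent 9
        arises.\<close>
      also have "\<dots> \<le> a / 2 * K ^ 7 * (x ^ 21 * S\<^sup>2)"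
      proof (rule mult_right_mono)
        have "K \<le> K ^ 7" using K(1) power_increasing[of 1 7 K] by simp
        then have "8 * c / a \<le> K ^ 7" using K(2) by simp
        then show "4 * c \<le> a / 2 * K ^ 7" using a by (simp add: field_simps)
      qed (use x1 in simp)
      also have "\<dots> = a / 2 * ((K * x ^ 3) ^ 7 * S\<^sup>2)" by (simp add: power_mult_distrib flip: power_mult)
      also have "\<dots> \<le> a / 2 * (S ^ 7 * S\<^sup>2)"
        using a Kx K(1) x1 by (intro mult_left_mono mult_right_mono power_mono) auto
      also have "S ^ 7 * S\<^sup>2 = S ^ 9" by (simp flip: power_add)
      also have "S ^ 9 = S powr 9" using S1 by simp
      also have "a / 2 * S powr 9 \<le> a / 2 * S powr r"
        using a r S1 by (intro mult_left_mono powr_mono) auto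
      finally have "c * (x ^ 21 * (1 + S)\<^sup>2) \<le> a / 2 * S powr r" .
      moreover have "0 \<le> 4 * c * K\<^sup>2 * n powr (27/28)" using c by simp
      ultimately show ?thesis using cY by linarith
    qed
  qed
  show ?thesis
  proof (rule that[of "D1 + 4 * c * K\<^sup>2"])
    show "0 \<le> D1 + 4 * c * K\<^sup>2" using D1 c by simp
    fix S Y n :: real
    assume *: "0 \<le> S" "0 \<le> Y" "1 \<le> n" "Y \<le> n powr (3/8) * (1 + S)"
    have "b * S powr (r - 1) + c * Y\<^sup>2 - a * S powr r \<le> D1 + 4 * c * K\<^sup>2 * n powr (27/28)"
      using p1[OF *(1)] p2[OF *(1,2,4,3)] by linarith
    also have "\<dots> \<le> (D1 + 4 * c * K\<^sup>2) * (1 + n powr (27/28))"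
    proof -
      have "0 \<le> D1 * n powr (27/28)" "0 \<le> 4 * c * K\<^sup>2" using D1 c by simp_all
      then show ?thesis by (simp add: algebra_simps)
    qed
    finally show "b * S powr (r - 1) + c * Y\<^sup>2 - a * S powr r \<le> (D1 + 4 * c * K\<^sup>2) * (1 + n powr (27/28))" .
  qed
qed

lemma eventually_powr_le_linear:
  fixes q c D :: real
  assumes "q < 1" "0 < c"
  shows "eventually (\<lambda>x. D * x powr q \<le> c * x) at_top"
proof -
  have "((\<lambda>x::real. D * x powr (q - 1)) \<longlongrightarrow> D * 0) at_top"
    using assms by (intro tendsto_mult tendsto_const tendsto_neg_powr filterlim_ident) auto
  then have "eventually (\<lambda>x::real. D * x powr (q - 1) < c) at_top"
    using assms by (intro order_tendstoD(2)) auto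
  then show ?thesis using eventually_gt_at_top[of 0]
  proof eventually_elim
    case (elim x)
    then have "D * x powr (q - 1) * x \<le> c * x" by (intro mult_right_mono) auto
    then show ?case using elim by (simp add: powr_diff)
  qed
qed

text \<open>Each sublinear correction eventually takes at most a quarter of the linear decay,
  leaving a geometric series of ratio \<open>exp (- b / 2)\<close>. The extra \<open>b / 4\<close>
  in its constant pays for \<open>real n + 1\<close> in place of \<open>real n\<close>.\<close>

lemma summable_exp_sublinear:
  fixes b D T :: real
  assumes "0 < b"
  shows "summable (\<lambda>n. exp (D * (1 + (real n + 1) powr (27/28)) - b * real n + T * real n powr (5/8)))"
proof (rule summable_comparison_test_ev)
  show "summable (\<lambda>n. exp (D + b / 4) * exp (- b / 2) ^ n)"
    using assms by (intro summable_mult summable_geometric) auto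
  have b4: "0 < b / 4" using assms by simp
  have l1: "filterlim (\<lambda>n. real n + 1) at_top sequentially"
    using filterlim_compose[OF filterlim_real_sequentially filterlim_Suc] by (simp add: add.commute)
  have "eventually (\<lambda>n. D * (real n + 1) powr (27/28) \<le> b / 4 * (real n + 1)) sequentially"
    using eventually_compose_filterlim[OF eventually_powr_le_linear[OF _ b4] l1] by simp
  moreover have "eventually (\<lambda>n. T * real n powr (5/8) \<le> b / 4 * real n) sequentially"
    using eventually_compose_filterlim[OF eventually_powr_le_linear[OF _ b4] filterlim_real_sequentially] by simp
  ultimately show "eventually (\<lambda>n. norm (exp (D * (1 + (real n + 1) powr (27/28)) - b * real n + T * real n powr (5/8)))
     \<le> exp (D + b / 4) * exp (- b / 2) ^ n) sequentially"
  proof eventually_elim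
    case (elim n)
    have "D * (1 + (real n + 1) powr (27/28)) - b * real n + T * real n powr (5/8) \<le> (D + b / 4) + real n * (- b / 2)"
      using elim by (simp add: algebra_simps)
    then show ?case by (simp add: exp_of_nat_mult[symmetric] flip: exp_add)
  qed
qed

locale gaussian_model = circle_model +
  fixes \<mu> :: "(real \<Rightarrow>\<^sub>C complex) measure"
  assumes mu: "is_mu L m \<beta> \<mu>"
begin

sublocale prob_space \<mu>
  using mu by (simp add: is_mu_def)

section \<open>Exponential moments and the random cutoff\<close>

definition X :: "int \<Rightarrow> (real \<Rightarrow>\<^sub>C complex) \<Rightarrow> complex" where
  "X k \<phi> = fcoeff L k (apply_bcontfun \<phi>)"

definition y :: "int \<Rightarrow> (real \<Rightarrow>\<^sub>C complex) \<Rightarrow> real" where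
  "y k \<phi> = p k powr (3/8) * (cmod (X k \<phi>))\<^sup>2"

lemma y_nonneg: "0 \<le> y k \<phi>"
  by (simp add: y_def)

lemma X_indep: "indep_vars (\<lambda>_. borel) X UNIV"
  using mu by (simp add: is_mu_def X_def [abs_def])

lemma X_distributed: "distributed \<mu> lborel (X k) (\<lambda>z. ennreal (\<beta> * p k / (2 * pi) * exp (- (\<beta> * p k) * (cmod z)\<^sup>2 / 2)))"
  using mu by (simp add: is_mu_def X_def [abs_def] theta_p)

lemma X_measurable [measurable]: "X k \<in> borel_measurable \<mu>"
  using X_indep by (auto simp: indep_vars_def)

lemma y_measurable [measurable]: "y k \<in> borel_measurable \<mu>"
  unfolding y_def [abs_def] by measurable

definition psum :: real where
  "psum = (\<Sum>\<^sub>\<infinity>k. p k powr (-5/8))"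

text \<open>Independence factorizes the moment. The tilt of mode \<open>k\<close> is
  \<open>t * p k powr (3/8)\<close>, at most a quarter of its \<theta> by the condition on
  \<open>t\<close>, and its cost is proportional to \<open>p k powr (-5/8)\<close>; this makes the
  bound uniform in \<open>F\<close>.\<close>

lemma exp_moment_finite:
  assumes F: "finite F" and t: "0 \<le> t" "\<And>k. k \<in> F \<Longrightarrow> t \<le> \<beta> / 4 * p k powr (5/8)"
  shows "(\<integral>\<^sup>+\<phi>. ennreal (exp (t * (\<Sum>k\<in>F. y k \<phi>))) \<partial>\<mu>) \<le> ennreal (exp (4 * t / \<beta> * psum))"
proof -
  have "(\<integral>\<^sup>+\<phi>. ennreal (exp (t * (\<Sum>k\<in>F. y k \<phi>))) \<partial>\<mu>) = (\<integral>\<^sup>+\<phi>. (\<Prod>k\<in>F. ennreal (exp (t * y k \<phi>))) \<partial>\<mu>)"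
    using F by (simp add: sum_distrib_left exp_sum prod_ennreal)
  also have "\<dots> = (\<Prod>k\<in>F. \<integral>\<^sup>+\<phi>. ennreal (exp (t * y k \<phi>)) \<partial>\<mu>)"
  proof (rule indep_vars_nn_integral[OF F])
    have "indep_vars (\<lambda>_. borel) X F" by (rule indep_vars_subset[OF X_indep]) simp
    from indep_vars_compose2[OF this, of "\<lambda>k z. ennreal (exp (t * (p k powr (3/8) * (cmod z)\<^sup>2)))" "\<lambda>_. borel"]
    show "indep_vars (\<lambda>_. borel) (\<lambda>k \<phi>. ennreal (exp (t * y k \<phi>))) F"
      by (simp add: y_def)
  qed simp
  also have "\<dots> \<le> (\<Prod>k\<in>F. ennreal (exp (4 * t / \<beta> * p k powr (-5/8))))"
  proof (rule prod_mono_ennreal)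
    fix k assume k: "k \<in> F"
    let ?u = "t * p k powr (3/8)"
    have pp: "p k powr (5/8) * p k powr (3/8) = p k" "p k powr (3/8) / p k = p k powr (-5/8)"
      using p_pos[of k] powr_diff[of "p k" "3/8" 1] by (simp_all flip: powr_add)
    have "?u \<le> \<beta> / 4 * p k powr (5/8) * p k powr (3/8)" using t(2)[OF k] by (intro mult_right_mono) auto
    then have u: "?u \<le> \<beta> * p k / 4" using pp(1) by (simp add: mult.assoc)
    have "(\<integral>\<^sup>+\<phi>. ennreal (exp (?u * (cmod (X k \<phi>))\<^sup>2)) \<partial>\<mu>) \<le> ennreal (exp (4 * ?u / (\<beta> * p k)))"
      by (rule gaussian_exp_moment[OF X_distributed _ u]) (use t p_pos \<beta>_pos in auto)
    also have "4 * ?u / (\<beta> * p k) = 4 * t / \<beta> * (p k powr (3/8) / p k)" by simp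
    finally show "(\<integral>\<^sup>+\<phi>. ennreal (exp (t * y k \<phi>)) \<partial>\<mu>) \<le> ennreal (exp (4 * t / \<beta> * p k powr (-5/8)))"
      unfolding pp(2) by (simp add: y_def mult.assoc)
  qed
  also have "\<dots> = ennreal (exp (4 * t / \<beta> * (\<Sum>k\<in>F. p k powr (-5/8))))"
    using F by (simp add: sum_distrib_left exp_sum prod_ennreal)
  also have "\<dots> \<le> ennreal (exp (4 * t / \<beta> * psum))"
  proof -
    have "(\<Sum>k\<in>F. p k powr (-5/8)) \<le> psum"
      unfolding psum_def by (intro finite_sum_le_infsum p_powr_summable F) auto
    then have "4 * t / \<beta> * (\<Sum>k\<in>F. p k powr (-5/8)) \<le> 4 * t / \<beta> * psum"
      using t(1) \<beta>_pos by (intro mult_left_mono) auto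
    then show ?thesis by (intro ennreal_leI) (simp only: exp_le_cancel_iff)
  qed
  finally show ?thesis .
qed

text \<open>Stands for the exponential of the whole sum over \<open>A\<close>, but is measurable and
  has a moment bound before convergence is known; convergence is itself derived from it.\<close>

definition expsup :: "real \<Rightarrow> int set \<Rightarrow> (real \<Rightarrow>\<^sub>C complex) \<Rightarrow> ennreal" where
  "expsup t A \<phi> = (SUP N. ennreal (exp (t * (\<Sum>k\<in>{- int N..int N} \<inter> A. y k \<phi>))))"

lemma expsup_measurable [measurable]: "expsup t A \<in> borel_measurable \<mu>"
  unfolding expsup_def [abs_def] by measurable

lemma expsup_moment:
  assumes t: "0 \<le> t" "\<And>k. k \<in> A \<Longrightarrow> t \<le> \<beta> / 4 * p k powr (5/8)"
  shows "(\<integral>\<^sup>+\<phi>. expsup t A \<phi> \<partial>\<mu>) \<le> ennreal (exp (4 * t / \<beta> * psum))"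
proof -
  have "(\<integral>\<^sup>+\<phi>. expsup t A \<phi> \<partial>\<mu>) = (SUP N. \<integral>\<^sup>+\<phi>. ennreal (exp (t * (\<Sum>k\<in>{- int N..int N} \<inter> A. y k \<phi>))) \<partial>\<mu>)"
    unfolding expsup_def
  proof (rule nn_integral_monotone_convergence_SUP)
    show "incseq (\<lambda>N \<phi>. ennreal (exp (t * (\<Sum>k\<in>{- int N..int N} \<inter> A. y k \<phi>))))"
      using t(1) by (intro incseq_SucI le_funI ennreal_leI)
       (auto intro!: mult_left_mono sum_mono2 y_nonneg)
  qed measurable
  also have "\<dots> \<le> ennreal (exp (4 * t / \<beta> * psum))"
    using t by (intro SUP_least exp_moment_finite) auto
  finally show ?thesis .
qed

lemma expsup_ge:
  assumes "((\<lambda>k. if k \<in> A then y k \<phi> else 0) has_sum S) UNIV"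
  shows "ennreal (exp (t * S)) \<le> expsup t A \<phi>"
proof (rule LIMSEQ_le_const2)
  have "(\<Sum>k\<in>{- int n..int n}. if k \<in> A then y k \<phi> else 0) = (\<Sum>k\<in>{- int n..int n} \<inter> A. y k \<phi>)" for n
    by (subst sum.inter_restrict) auto
  with has_sum_int_LIMSEQ[OF assms]
  have "(\<lambda>n. \<Sum>k\<in>{- int n..int n} \<inter> A. y k \<phi>) \<longlonglongrightarrow> S" by simp
  then show "(\<lambda>n. ennreal (exp (t * (\<Sum>k\<in>{- int n..int n} \<inter> A. y k \<phi>)))) \<longlonglongrightarrow> ennreal (exp (t * S))"
    by (intro tendsto_ennrealI tendsto_intros)
  show "\<exists>N. \<forall>n\<ge>N. ennreal (exp (t * (\<Sum>k\<in>{- int n..int n} \<inter> A. y k \<phi>))) \<le> expsup t A \<phi>"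
    unfolding expsup_def by (rule exI[of _ 0], intro allI impI, rule SUP_upper2[OF UNIV_I], rule order_refl)
qed

text \<open>A finite moment makes \<open>expsup\<close> finite almost everywhere, and this bounds
  all partial sums.\<close>

lemma AE_summable: "AE \<phi> in \<mu>. (\<lambda>k. y k \<phi>) summable_on UNIV"
proof -
  \<comment> \<open>The largest tilt admissible for all modes at once, since \<open>p\<close>
    attains its minimum \<open>m\<^sup>2\<close> at frequency 0.\<close>
  define t where "t = \<beta> / 4 * (m\<^sup>2) powr (5/8)"
  have t: "0 < t" using \<beta>_pos m_pos by (simp add: t_def)
  have "t \<le> \<beta> / 4 * p k powr (5/8)" for k
    unfolding t_def using \<beta>_pos p_ge[of k] by (intro mult_left_mono powr_mono2) auto
  then have "(\<integral>\<^sup>+\<phi>. expsup t UNIV \<phi> \<partial>\<mu>) \<le> ennreal (exp (4 * t / \<beta> * psum))"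
    using t by (intro expsup_moment) auto
  also have "\<dots> < \<infinity>" by simp
  finally have "AE \<phi> in \<mu>. expsup t UNIV \<phi> \<noteq> \<infinity>"
    by (intro nn_integral_PInf_AE) auto
  then show ?thesis
  proof eventually_elim
    case (elim \<phi>)
    then obtain q where q: "expsup t UNIV \<phi> = ennreal q" "0 \<le> q" by (cases "expsup t UNIV \<phi>") auto
    have "(\<Sum>k\<in>{- int N..int N}. y k \<phi>) \<le> q / t" for N
    proof -
      have "ennreal (exp (t * (\<Sum>k\<in>{- int N..int N}. y k \<phi>))) \<le> ennreal q"
        unfolding q(1)[symmetric] expsup_def by (rule SUP_upper2[of N]) auto
      then have "exp (t * (\<Sum>k\<in>{- int N..int N}. y k \<phi>)) \<le> q" using q(2) by simp
      then have "t * (\<Sum>k\<in>{- int N..int N}. y k \<phi>) \<le> q"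
        using exp_ge_add_one_self[of "t * (\<Sum>k\<in>{- int N..int N}. y k \<phi>)"] by linarith
      then show ?thesis using t by (simp add: field_simps)
    qed
    moreover obtain B :: nat where "q / t \<le> real B" using real_arch_simple by blast
    ultimately show ?case
      by (subst summable_on_int_iff_bounded) (auto intro: y_nonneg order_trans)
  qed
qed

text \<open>The second conclusion is Markov's inequality in pointwise form: the indicator of
  reaching level \<open>n\<close> is replaced by a measurable factor that is at least 1 there. The
  cutoff itself never has to be a measurable function of \<phi>.\<close>

lemma frequency_cutoff:
  assumes sm: "(\<lambda>k. y k \<phi>) summable_on UNIV"
  defines "Y \<equiv> \<Sum>\<^sub>\<infinity>k. y k \<phi>"
  obtains n :: nat where "Y \<le> (real n + 1) powr (3/8) * (1 + sqn (apply_bcontfun \<phi>))"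
    "ennreal 1 \<le> ennreal (exp (- (\<beta> / 4 * real n))) * expsup (\<beta> / 4 * real n powr (5/8)) {k. real n < p k} \<phi>"
proof -
  define tail where "tail n = (\<Sum>\<^sub>\<infinity>k. if real n < p k then y k \<phi> else 0)" for n :: nat
  have smt: "(\<lambda>k. if real n < p k then y k \<phi> else 0) summable_on UNIV" for n :: nat
    by (rule summable_on_comparison_test[OF sm]) (auto simp: y_nonneg)
  have hst: "((\<lambda>k. if real n < p k then y k \<phi> else 0) has_sum tail n) UNIV" for n :: nat
    unfolding tail_def by (rule has_sum_infsum[OF smt])
  have hs: "((\<lambda>k. y k \<phi>) has_sum Y) UNIV" unfolding Y_def by (rule has_sum_infsum[OF sm])
  have tailY: "tail n \<le> Y" for n
    by (rule has_sum_mono[OF hst hs]) (simp add: y_nonneg)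
  have fL: "apply_bcontfun \<phi> \<in> L2 L" by (intro continuous_L2 bcontfun_continuous)
  let ?S = "sqn (apply_bcontfun \<phi>)"
  have lowhigh: "Y \<le> real n powr (3/8) * ?S + tail n" for n
  proof (rule has_sum_mono[OF hs has_sum_add[OF has_sum_cmult_right[OF parseval[OF fL]] hst]])
    fix k
    have "p k powr (3/8) \<le> real n powr (3/8)" if "p k \<le> real n"
      using that p_pos[of k] by (intro powr_mono2) auto
    then show "y k \<phi> \<le> real n powr (3/8) * (cmod (fcoeff L k (apply_bcontfun \<phi>)))\<^sup>2 + (if real n < p k then y k \<phi> else 0)"
      by (auto simp: y_def X_def intro!: mult_right_mono)
  qed
  \<comment> \<open>Index \<open>n\<close> is tested at level \<open>Suc n\<close>, so failure at
    the predecessor bounds \<open>tail n\<close> from below at the same \<open>n\<close>; for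
    \<open>n = 0\<close> the exponent below is simply 0.\<close>
  define good where "good n \<longleftrightarrow> tail (Suc n) \<le> real (Suc n) powr (3/8)" for n
  have "\<exists>n. good n"
  proof -
    have Y0: "0 \<le> Y" using has_sum_nonneg[OF hs] by (simp add: y_nonneg)
    obtain n :: nat where "Y powr (8/3) \<le> real n" using real_arch_simple by blast
    then have "(Y powr (8/3)) powr (3/8) \<le> real (Suc n) powr (3/8)" by (intro powr_mono2) auto
    then have "Y \<le> real (Suc n) powr (3/8)" using Y0 by (simp add: powr_powr)
    then show ?thesis using tailY[of "Suc n"] unfolding good_def by (intro exI[of _ n]) linarith
  qed
  define n where "n = (LEAST n. good n)"
  have n: "good n" unfolding n_def by (rule LeastI_ex) fact
  show ?thesis
  proof (rule that[of n])
    show "Y \<le> (real n + 1) powr (3/8) * (1 + ?S)"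
      using lowhigh[of "Suc n"] n unfolding good_def by (simp add: algebra_simps)
    have ge: "0 \<le> \<beta> / 4 * real n powr (5/8) * tail n - \<beta> / 4 * real n"
    proof (cases n)
      case (Suc n')
      then have "\<not> good n'" using not_less_Least[of n' good] by (simp add: n_def)
      then have "real n powr (3/8) \<le> tail n" using Suc by (simp add: good_def)
      then have "\<beta> / 4 * real n powr (5/8) * real n powr (3/8) \<le> \<beta> / 4 * real n powr (5/8) * tail n"
        using \<beta>_pos by (intro mult_left_mono) auto
      moreover have "real n powr (5/8) * real n powr (3/8) = real n" by (simp flip: powr_add)
      ultimately show ?thesis by (simp add: mult.assoc)
    qed simp
    have "ennreal 1 \<le> ennreal (exp (\<beta> / 4 * real n powr (5/8) * tail n - \<beta> / 4 * real n))"
      using ge by (intro ennreal_leI) simp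
    also have "\<dots> = ennreal (exp (- (\<beta> / 4 * real n))) * ennreal (exp (\<beta> / 4 * real n powr (5/8) * tail n))"
      by (simp flip: ennreal_mult exp_add)
    also have "\<dots> \<le> ennreal (exp (- (\<beta> / 4 * real n))) * expsup (\<beta> / 4 * real n powr (5/8)) {k. real n < p k} \<phi>"
      using hst[of n] by (intro mult_left_mono expsup_ge) auto
    finally show "ennreal 1 \<le> ennreal (exp (- (\<beta> / 4 * real n))) * expsup (\<beta> / 4 * real n powr (5/8)) {k. real n < p k} \<phi>" .
  qed
qed

text \<open>The level found for \<phi> is unknown, so the bound at that level is majorized by the
  sum over all levels. Integrating term by term leaves a numerical series.\<close>

theorem exp_U_integrable:
  assumes lam: "0 < lam" and \<kappa>: "0 < \<kappa>" and r: "9 < r" and \<tau>: "0 < \<tau>"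
  shows "integrable \<mu> (\<lambda>\<phi>. exp (- \<tau> * U L m \<beta> lam \<kappa> r s \<phi>))"
proof -
  have r2: "2 < r" using r by simp
  have [measurable]: "U L m \<beta> lam \<kappa> r s \<in> borel_measurable \<mu>"
    using mu by (intro U_measurable r2) (simp add: is_mu_def)
  define a where "a = \<tau> * (\<beta> / 2) * \<kappa>"
  define b where "b = \<tau> * (\<beta> / 2) * (2 * r * \<kappa> * trsg)"
  define c where "c = \<tau> * (\<beta> / 2) * (lam * quartic_const)"
  have qc: "0 \<le> quartic_const" by (simp add: quartic_const_def)
  have abc: "0 < a" "0 \<le> b" "0 \<le> c"
    using \<tau> \<beta>_pos \<kappa> lam r trsg_nonneg qc by (simp_all add: a_def b_def c_def)
  obtain D where D: "0 \<le> D"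
    "\<And>S Y n. 0 \<le> S \<Longrightarrow> 0 \<le> Y \<Longrightarrow> 1 \<le> n \<Longrightarrow> Y \<le> n powr (3/8) * (1 + S) \<Longrightarrow>
       b * S powr (r - 1) + c * Y\<^sup>2 - a * S powr r \<le> D * (1 + n powr (27/28))"
    using potential_bound[OF abc, of r] r by (metis less_imp_le)
  let ?w = "\<lambda>n. D * (1 + (real n + 1) powr (27/28)) - \<beta> / 4 * real n"
  let ?e = "\<lambda>n \<phi>. expsup (\<beta> / 4 * real n powr (5/8)) {k. real n < p k} \<phi>"
  have "AE \<phi> in \<mu>. ennreal (exp (- \<tau> * U L m \<beta> lam \<kappa> r s \<phi>)) \<le> (\<Sum>n. ennreal (exp (?w n)) * ?e n \<phi>)"
    using AE_summable
  proof eventually_elim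
    case (elim \<phi>)
    define f where "f = apply_bcontfun \<phi>"
    define Y where "Y = (\<Sum>\<^sub>\<infinity>k. y k \<phi>)"
    have f: "continuous_on UNIV f" unfolding f_def by (rule bcontfun_continuous)
    have hs: "((\<lambda>k. p k powr (3/8) * (cmod (fcoeff L k f))\<^sup>2) has_sum Y) UNIV"
      using has_sum_infsum[OF elim] by (simp add: Y_def f_def y_def X_def)
    have Y0: "0 \<le> Y" using has_sum_nonneg[OF hs] by simp
    note qb = quartic_bound[OF f hs]
    obtain n where n: "Y \<le> (real n + 1) powr (3/8) * (1 + sqn f)" "ennreal 1 \<le> ennreal (exp (- (\<beta> / 4 * real n))) * ?e n \<phi>"
      using frequency_cutoff[OF elim] unfolding f_def Y_def by metis
    let ?Q = "cmod (innerL2 L (lap_op L (sigma2_Cinv_sym \<beta> m s) f) (\<lambda>x. of_real ((cmod (f x))\<^sup>2) * f x))"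
    have "\<tau> * (\<beta> / 2 * (\<kappa> * sqn f powr r - 2 * r * \<kappa> * trsg * sqn f powr (r - 1) - lam * ?Q)) \<le> \<tau> * U L m \<beta> lam \<kappa> r s \<phi>"
      unfolding f_def using qb(1)[unfolded f_def] \<tau> by (intro mult_left_mono U_lower_bound[OF r2 lam \<kappa>]) auto
    moreover have "\<tau> * (\<beta> / 2) * (lam * ?Q) \<le> \<tau> * (\<beta> / 2) * (lam * (quartic_const * Y\<^sup>2))"
      using qb(2) \<tau> \<beta>_pos lam by (intro mult_left_mono) auto
    ultimately have "- \<tau> * U L m \<beta> lam \<kappa> r s \<phi> \<le> b * sqn f powr (r - 1) + c * Y\<^sup>2 - a * sqn f powr r"
      by (simp add: a_def b_def c_def algebra_simps)
    also have "\<dots> \<le> D * (1 + (real n + 1) powr (27/28))"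
      using n(1) by (intro D(2) sqn_nonneg Y0) auto
    finally have "ennreal (exp (- \<tau> * U L m \<beta> lam \<kappa> r s \<phi>)) \<le> ennreal (exp (D * (1 + (real n + 1) powr (27/28)))) * ennreal 1"
      by (simp add: ennreal_leI)
    also have "\<dots> \<le> ennreal (exp (D * (1 + (real n + 1) powr (27/28)))) * (ennreal (exp (- (\<beta> / 4 * real n))) * ?e n \<phi>)"
      by (intro mult_left_mono n(2)) simp
    also have "\<dots> = ennreal (exp (?w n)) * ?e n \<phi>"
      by (simp add: mult.assoc[symmetric] flip: ennreal_mult exp_add)
    also have "\<dots> \<le> (\<Sum>n. ennreal (exp (?w n)) * ?e n \<phi>)"
      using sum_le_suminf[of "\<lambda>n. ennreal (exp (?w n)) * ?e n \<phi>" "{n}"] by simp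
    finally show ?case .
  qed
  then have "(\<integral>\<^sup>+\<phi>. ennreal (exp (- \<tau> * U L m \<beta> lam \<kappa> r s \<phi>)) \<partial>\<mu>) \<le> (\<integral>\<^sup>+\<phi>. (\<Sum>n. ennreal (exp (?w n)) * ?e n \<phi>) \<partial>\<mu>)"
    by (rule nn_integral_mono_AE)
  also have "\<dots> = (\<Sum>n. ennreal (exp (?w n)) * (\<integral>\<^sup>+\<phi>. ?e n \<phi> \<partial>\<mu>))"
    by (subst nn_integral_suminf) (simp_all add: nn_integral_cmult)
  also have "\<dots> \<le> (\<Sum>n. ennreal (exp (?w n + psum * real n powr (5/8))))"
  proof (intro suminf_le summableI)
    fix n :: nat
    \<comment> \<open>The modes summed here have \<open>p k > n\<close>, so the tilt
      \<open>\<beta> / 4 * real n powr (5/8)\<close> is admissible for each of them.\<close>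
    have "(\<integral>\<^sup>+\<phi>. ?e n \<phi> \<partial>\<mu>) \<le> ennreal (exp (4 * (\<beta> / 4 * real n powr (5/8)) / \<beta> * psum))"
      using \<beta>_pos by (intro expsup_moment) (auto intro!: mult_left_mono powr_mono2)
    also have "4 * (\<beta> / 4 * real n powr (5/8)) / \<beta> * psum = psum * real n powr (5/8)" using \<beta>_pos by simp
    finally have "ennreal (exp (?w n)) * (\<integral>\<^sup>+\<phi>. ?e n \<phi> \<partial>\<mu>) \<le> ennreal (exp (?w n)) * ennreal (exp (psum * real n powr (5/8)))"
      by (intro mult_left_mono) auto
    also have "\<dots> = ennreal (exp (?w n + psum * real n powr (5/8)))"
      by (simp only: exp_add ennreal_mult exp_ge_zero)
    finally show "ennreal (exp (?w n)) * (\<integral>\<^sup>+\<phi>. ?e n \<phi> \<partial>\<mu>) \<le> ennreal (exp (?w n + psum * real n powr (5/8)))" .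
  qed
  also have "\<dots> < \<infinity>"
    unfolding infinity_ennreal_def less_top[symmetric]
    by (rule ennreal_suminf_neq_top[OF summable_exp_sublinear]) (use \<beta>_pos in auto)
  finally have fin: "(\<integral>\<^sup>+\<phi>. ennreal (exp (- \<tau> * U L m \<beta> lam \<kappa> r s \<phi>)) \<partial>\<mu>) < \<infinity>" .
  show ?thesis
    by (rule integrableI_nonneg) (use fin in auto)
qed

end

theorem theorem5p7:
  fixes L m \<beta> lam \<kappa> r s \<gamma> :: real
    and \<mu> :: "(real \<Rightarrow>\<^sub>C complex) measure"
  assumes "L > 0" "m > 0" "\<beta> > 0" "lam > 0" "\<kappa> > 0"
    and "s > 0"
    and "r > 9"
    and "0 < \<gamma>" "\<gamma> < 1 / 8"
    and "lap_op_le L (\<lambda>_. 1) (sigma2_Cinv_sym \<beta> m s)"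
    and "lap_op_le L (sigma2_Cinv_sym \<beta> m s) (\<lambda>t. (t + m\<^sup>2) powr \<gamma>)"
    and "is_mu L m \<beta> \<mu>"
  shows "\<forall>\<tau>>0. integrable \<mu> (\<lambda>\<phi>. exp (- \<tau> * U L m \<beta> lam \<kappa> r s \<phi>))"
proof -
  interpret gaussian_model L m \<beta> s \<gamma> \<mu>
    by unfold_locales (use assms in auto)
  show ?thesis using exp_U_integrable assms by blast
qed

end
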